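(* Let $A$ be a unital $*$-algebra over $\Bbbk$ whose $*$-codimension sequence $c_n^{*}(A)$ has cubic growth, and let $\mathbb{M}$ be its associated $3$-admissible sequence. There are exactly $54$ distinct $*$-codimension sequences arising from such $*$-algebras $A$, and they are the ones listed below (for a positive integer $m$, $[m]=\{1,2,\dots,m\}$): (1) If $\mathbb{M}$ is a $3$-admissible singleton, then $$c_n^{*}(A)= 1+\binom{n}{1}+5\binom{n}{2}+u\binom{n}{3},\qquad u \in [29].$$ (2) If $\mathbb{M}$ is a $3$-admissible pair, then one of the following holds: (i) $c_n^{*}(A)= 1+\binom{n}{1}+4\binom{n}{2}+a\binom{n}{3}$, where $a \in [15]$; (ii) $c_n^{*}(A)= 1+\binom{n}{1}+3\binom{n}{2}+b\binom{n}{3}$, where $b \in [5]$; (iii) $c_n^{*}(A)= 1+\binom{n}{1}+2\binom{n}{2}+c\binom{n}{3}$, where $c \in [4]$; (iv) $c_n^{*}(A)= 1+\binom{n}{1}+\binom{n}{2}+\binom{n}{3}$.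
   Context: $\Bbbk$ is a field of characteristic zero; all algebras are associative and unital over $\Bbbk$. A $*$-algebra is a pair $(A,* )$ with $*$ an algebra antiautomorphism ($\Bbbk$-linear) of $A$ whose square is the identity; put $A^{+}=\{a: a^*=a\}$ and $A^{-}=\{a: a^*=-a\}$. The free $*$-algebra is the free unital associative algebra $\Bbbk\langle Y,Z\rangle$ on $Y=\{y_1,y_2,\dots\}$, $Z=\{z_1,z_2,\dots\}$ with the antiautomorphism $*$ determined by $y_i^*=y_i$, $z_i^*=-z_i$. A polynomial $f\in\Bbbk\langle Y,Z\rangle$ is a $*$-identity of $A$ if it vanishes under every substitution of the $y_i$ by elements of $A^{+}$ and the $z_i$ by elements of $A^{-}$; $\mathrm{Id}^{*}(A)$ is the set of all $*$-identities. It is a $\mathrm{T}^*$-ideal, i.e. an ideal of $\Bbbk\langle Y,Z\rangle$ invariant under all algebra endomorphisms commuting with $*$. For a set $S$, $\langle S\rangle_{\mathrm{T}^*}$ is the $\mathrm{T}^*$-ideal generated by $S$. $V_n^{*}$ is the span of the monomials $v_{\sigma(1)}\cdots v_{\sigma(n)}$ with $\sigma\in\mathbb{S}_n$ and $v_i\in\{y_i,z_i\}$ for each $i$. The $*$-codimension sequence is $c_n^{*}(A)=\dim_\Bbbk V_n^{*}/(V_n^{*}\cap \mathrm{Id}^{*}(A))$, $n\ge1$. It has polynomial growth $n^k$ if $c_n^{*}(A)=qn^k+O(n^{k-1})$ as $n\to\infty$ for some constant $q>0$; cubic growth means $k=3$. Let $B(Y)$ be the subalgebra of $\Bbbk\langle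 Y,Z\rangle$ generated by the variables in $Z$ and all (iterated) commutators of elements of $Y\cup Z$; $\Gamma_n^{*}=B(Y)\cap V_n^{*}$ ($Y$-proper multilinear polynomials of degree $n$), $\Gamma_0^{*}=\Bbbk$. The hyperoctahedral group $\mathbb{H}_n=\mathbb{Z}_2\wr\mathbb{S}_n$, with elements $(a_1,\dots,a_n;\sigma)$, $a_i\in\{1,-1\}$, $\sigma\in\mathbb{S}_n$, acts on $V_n^{*}$ by $y_i\mapsto y_{\sigma(i)}$, $z_i\mapsto a_{\sigma(i)}z_{\sigma(i)}$, and $\Gamma_n^{*}$ is a submodule. For $1\le s\le k$, a sequence $\mathbb{M}=(M_s,\dots,M_k)$, with each $M_i$ a left $\Bbbk\mathbb{H}_i$-submodule of $\Gamma_i^{*}$ closed under the involution $*$, is called $k$-admissible if: (1) if $s<k$ then $M_s\ne0$; (2) $M_k$ is a proper submodule of $\Gamma_k^{*}$; (3) for every $s+1\le j\le k$, $(\langle M_s\rangle_{\mathrm{T}^*}+\dots+\langle M_{j-1}\rangle_{\mathrm{T}^*})\cap\Gamma_j^{*}\subset M_j$. It is called a $k$-admissible singleton if it has the form $(M_k)$ and a $k$-admissible pair if it has the form $(M_{k-1},M_k)$. A $*$-algebra $A$ is associated with $\mathbb{M}$ if $\Gamma_i^{*}\cap\mathrm{Id}^{*}(A)=0$ for $1\le i<s$, $=M_i$ for $s\le i\le k$, and $=\Gamma_i^{*}$ for $i>k$. *)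

theory Defs
  imports
    Complex_Main
    "HOL-Library.Poly_Mapping"
    "HOL-Library.Set_Algebras"
    "HOL-Library.FuncSet"
    "HOL-Library.Landau_Symbols"
    "HOL-Combinatorics.Permutations"
    "HOL-Algebra.Module"
begin

section \<open>The free star-algebra\<close>

text \<open>
  The letter \<open>Yv i\<close> is the symmetric variable \<open>y\<close> with index \<open>i + 1\<close> and
  \<open>Zv i\<close> the skew variable \<open>z\<close> with index \<open>i + 1\<close>; consequently \<open>{1, \<dots>, n}\<close>
  is rendered as \<open>{..<n}\<close>.
\<close>

datatype letter = Yv nat | Zv nat

text \<open>
  Lists form the free monoid.  It is written additively, because finitely supported functions
  on an additive monoid carry the convolution product; so \<open>letter list \<Rightarrow>\<^sub>0 'k\<close> is the monoid
  algebra of the free monoid on the letters, i.e. the free unital associative algebra.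
\<close>

instantiation list :: (type) monoid_add
begin

definition zero_list_def: "(0 :: 'a list) = []"
definition plus_list_def: "(u :: 'a list) + v = u @ v"

instance by standard (simp_all add: zero_list_def plus_list_def)

end

type_synonym 'k fpoly = "letter list \<Rightarrow>\<^sub>0 'k"

definition fscale :: "'k::field \<Rightarrow> 'k fpoly \<Rightarrow> 'k fpoly"
  where "fscale c p = Poly_Mapping.map ((*) c) p"

lemma fscale_conv_mult: "fscale c p = Poly_Mapping.single 0 c * p"
  by (simp add: fscale_def mult_map_scale_conv_mult)

lemma lookup_fscale: "Poly_Mapping.lookup (fscale c p) w = c * Poly_Mapping.lookup p w"
  by (simp add: fscale_def Poly_Mapping.map.rep_eq when_def)

global_interpretation free: vector_space fscale
  by standard (auto intro!: poly_mapping_eqI simp: lookup_fscale lookup_add algebra_simps)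

definition monom :: "letter list \<Rightarrow> 'k::field fpoly"
  where "monom w = Poly_Mapping.single w 1"

definition var :: "letter \<Rightarrow> 'k::field fpoly"
  where "var x = monom [x]"

definition comm :: "'k::field fpoly \<Rightarrow> 'k fpoly \<Rightarrow> 'k fpoly"
  where "comm p q = p * q - q * p"

fun letter_sign :: "letter \<Rightarrow> 'k::field"
  where "letter_sign (Yv i) = 1" | "letter_sign (Zv i) = - 1"

definition word_sign :: "letter list \<Rightarrow> 'k::field"
  where "word_sign w = prod_list (map letter_sign w)"

text \<open>The involution sends a word \<open>x\<^sub>1 \<dots> x\<^sub>m\<close> to \<open>(x\<^sub>m)\<^sup>* \<dots> (x\<^sub>1)\<^sup>*\<close>.\<close>

definition fstar :: "'k::field fpoly \<Rightarrow> 'k fpoly"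
  where "fstar p = (\<Sum>w\<in>Poly_Mapping.keys p.
    Poly_Mapping.single (rev w) (word_sign w * Poly_Mapping.lookup p w))"

lemma word_sign_append: "word_sign (u @ v) = word_sign u * word_sign v"
  by (simp add: word_sign_def)

lemma word_sign_rev: "word_sign (rev w) = word_sign w"
  by (induction w) (simp_all add: word_sign_def)

lemma word_sign_square: "word_sign w * word_sign w = (1 :: 'k::field)"
proof (induction w)
  case (Cons x w)
  have "letter_sign x * letter_sign x = (1 :: 'k)" by (cases x) simp_all
  moreover have "word_sign (x # w) * word_sign (x # w) =
      (letter_sign x * letter_sign x) * (word_sign w * word_sign w :: 'k)"
    by (simp add: word_sign_def)
  ultimately show ?case using Cons by simp
qed (simp add: word_sign_def)

lemma lookup_fstar:
  "Poly_Mapping.lookup (fstar p) w = word_sign w * Poly_Mapping.lookup p (rev w)"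
proof -
  have "Poly_Mapping.lookup (fstar p) w =
      (\<Sum>v\<in>Poly_Mapping.keys p.
        if v = rev w then word_sign w * Poly_Mapping.lookup p (rev w) else 0)"
    unfolding fstar_def lookup_sum lookup_single
    by (rule sum.cong) (auto simp: when_def word_sign_rev)
  then show ?thesis by (simp add: in_keys_iff)
qed

lemma fstar_fstar: "fstar (fstar p) = p"
  by (rule poly_mapping_eqI)
    (simp add: lookup_fstar word_sign_rev mult.assoc [symmetric] word_sign_square)

lemma fstar_add: "fstar (p + q) = fstar p + fstar q"
  by (rule poly_mapping_eqI) (simp add: lookup_fstar lookup_add algebra_simps)

lemma fstar_fscale: "fstar (fscale c p) = fscale c (fstar p)"
  by (rule poly_mapping_eqI) (simp add: lookup_fstar lookup_fscale)

lemma fstar_single: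
  "fstar (Poly_Mapping.single w c) = Poly_Mapping.single (rev w) (word_sign w * c)"
  by (rule poly_mapping_eqI) (auto simp: lookup_fstar lookup_single when_def word_sign_rev)

lemma fstar_Yv: "fstar (var (Yv i)) = var (Yv i)"
  by (simp add: var_def monom_def fstar_single word_sign_def)

lemma fstar_Zv: "fstar (var (Zv i)) = - var (Zv i)"
  by (simp add: var_def monom_def fstar_single word_sign_def single_uminus)

lemma fpoly_conv_sum_single:
  "(\<Sum>w\<in>Poly_Mapping.keys p. Poly_Mapping.single w (Poly_Mapping.lookup p w)) = p"
  (is "?s = _")
proof (rule poly_mapping_eqI)
  fix v
  have "Poly_Mapping.lookup ?s v =
      (\<Sum>w\<in>Poly_Mapping.keys p. if w = v then Poly_Mapping.lookup p v else 0)"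
    unfolding lookup_sum lookup_single by (rule sum.cong) (auto simp: when_def)
  then show "Poly_Mapping.lookup ?s v = Poly_Mapping.lookup p v"
    by (simp add: in_keys_iff)
qed

lemma fstar_sum: "fstar (sum f I) = (\<Sum>i\<in>I. fstar (f i))"
  by (rule poly_mapping_eqI) (simp add: lookup_fstar lookup_sum sum_distrib_left)

lemma fstar_mult: "fstar (p * q) = fstar q * fstar (p :: 'k::field fpoly)"
proof -
  define P where "P = (\<lambda>w. Poly_Mapping.single w (Poly_Mapping.lookup p w))"
  define Q where "Q = (\<lambda>w. Poly_Mapping.single w (Poly_Mapping.lookup q w))"
  have p: "p = (\<Sum>w\<in>Poly_Mapping.keys p. P w)" and q: "q = (\<Sum>w\<in>Poly_Mapping.keys q. Q w)"
    by (simp_all add: P_def Q_def fpoly_conv_sum_single)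
  have "fstar (P u * Q v) = fstar (Q v) * fstar (P u)" for u v
    by (simp add: P_def Q_def mult_single fstar_single plus_list_def word_sign_append mult.commute
        mult.left_commute)
  then have "fstar ((\<Sum>u\<in>Poly_Mapping.keys p. P u) * (\<Sum>v\<in>Poly_Mapping.keys q. Q v)) =
      (\<Sum>u\<in>Poly_Mapping.keys p. \<Sum>v\<in>Poly_Mapping.keys q. fstar (Q v) * fstar (P u))"
    by (simp add: sum_product fstar_sum)
  also have "\<dots> = (\<Sum>v\<in>Poly_Mapping.keys q. \<Sum>u\<in>Poly_Mapping.keys p. fstar (Q v) * fstar (P u))"
    by (rule sum.swap)
  also have "\<dots> = fstar (\<Sum>v\<in>Poly_Mapping.keys q. Q v) * fstar (\<Sum>u\<in>Poly_Mapping.keys p. P u)"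
    by (simp add: sum_product fstar_sum)
  finally show ?thesis using p q by simp
qed

text \<open>The algebra endomorphism of the free algebra that maps each letter \<open>x\<close> to \<open>\<phi> x\<close>.\<close>

definition fsubst :: "(letter \<Rightarrow> 'k fpoly) \<Rightarrow> 'k::field fpoly \<Rightarrow> 'k fpoly"
  where "fsubst \<phi> p =
    (\<Sum>w\<in>Poly_Mapping.keys p. fscale (Poly_Mapping.lookup p w) (prod_list (map \<phi> w)))"

definition star_endo :: "('k::field fpoly \<Rightarrow> 'k fpoly) \<Rightarrow> bool"
  where "star_endo h \<longleftrightarrow>
    (\<forall>p q. h (p + q) = h p + h q) \<and>
    (\<forall>c p. h (fscale c p) = fscale c (h p)) \<and>
    (\<forall>p q. h (p * q) = h p * h q) \<and>
    h 1 = 1 \<and>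
    (\<forall>p. h (fstar p) = fstar (h p))"

definition Tstar_ideal :: "'k::field fpoly set \<Rightarrow> bool"
  where "Tstar_ideal I \<longleftrightarrow>
    free.subspace I \<and>
    (\<forall>f\<in>I. \<forall>p. p * f \<in> I \<and> f * p \<in> I) \<and>
    (\<forall>h. star_endo h \<longrightarrow> h ` I \<subseteq> I)"

definition Tstar_gen :: "'k::field fpoly set \<Rightarrow> 'k fpoly set"
  where "Tstar_gen S = \<Inter> {I. Tstar_ideal I \<and> S \<subseteq> I}"


section \<open>Multilinear and proper polynomials\<close>

definition Vstar :: "nat \<Rightarrow> 'k::field fpoly set"
  where "Vstar n = free.span
    {monom (map (\<lambda>i. v (\<sigma> i)) [0..<n]) | \<sigma> v.
       \<sigma> permutes {..<n} \<and> (\<forall>i<n. v i \<in> {Yv i, Zv i})}"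

text \<open>Left-normed commutators \<open>[x\<^sub>1, x\<^sub>2, \<dots>, x\<^sub>m]\<close> of letters, \<open>m \<ge> 2\<close>.\<close>

inductive_set iter_comms :: "'k::field fpoly set"
  where
    "comm (var x) (var y) \<in> iter_comms"
  | "c \<in> iter_comms \<Longrightarrow> comm c (var x) \<in> iter_comms"

inductive_set unital_subalgebra_gen :: "'k::field fpoly set \<Rightarrow> 'k fpoly set"
  for S :: "'k fpoly set"
  where
    one: "1 \<in> unital_subalgebra_gen S"
  | gen: "p \<in> S \<Longrightarrow> p \<in> unital_subalgebra_gen S"
  | add: "p \<in> unital_subalgebra_gen S \<Longrightarrow> q \<in> unital_subalgebra_gen S
      \<Longrightarrow> p + q \<in> unital_subalgebra_gen S"
  | scale: "p \<in> unital_subalgebra_gen S \<Longrightarrow> fscale c p \<in> unital_subalgebra_gen S"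
  | mult: "p \<in> unital_subalgebra_gen S \<Longrightarrow> q \<in> unital_subalgebra_gen S
      \<Longrightarrow> p * q \<in> unital_subalgebra_gen S"

definition proper_polys :: "'k::field fpoly set"
  where "proper_polys = unital_subalgebra_gen (range (\<lambda>i. var (Zv i)) \<union> iter_comms)"

definition Gam :: "nat \<Rightarrow> 'k::field fpoly set"
  where "Gam n = proper_polys \<inter> Vstar n"

text \<open>
  The action of \<open>(a; \<sigma>)\<close> in the hyperoctahedral group of degree \<open>n\<close>: the signs are
  \<open>a 0, \<dots>, a (n - 1)\<close> and \<open>\<sigma>\<close> permutes \<open>{..<n}\<close>.
\<close>

definition hyper_act :: "(nat \<Rightarrow> 'k) \<Rightarrow> (nat \<Rightarrow> nat) \<Rightarrow> 'k::field fpoly \<Rightarrow> 'k fpoly"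
  where "hyper_act a \<sigma> = fsubst (\<lambda>x. case x of
      Yv i \<Rightarrow> var (Yv (\<sigma> i))
    | Zv i \<Rightarrow> fscale (a (\<sigma> i)) (var (Zv (\<sigma> i))))"

definition hyper_submodule :: "nat \<Rightarrow> 'k::field fpoly set \<Rightarrow> bool"
  where "hyper_submodule n M \<longleftrightarrow>
    free.subspace M \<and> M \<subseteq> Gam n \<and>
    (\<forall>a \<sigma>. (\<forall>i<n. a i \<in> {1, - 1}) \<and> \<sigma> permutes {..<n} \<longrightarrow> hyper_act a \<sigma> ` M \<subseteq> M)"


section \<open>Algebras with involution\<close>

definition scalar_ring :: "'k::field ring"
  where "scalar_ring = \<lparr>carrier = UNIV, mult = (*), one = 1, zero = 0, add = (+)\<rparr>"

text \<open>
  A unital associative algebra is a \<^locale>\<open>ring\<close> whose additive group is a module over the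
  field and whose product is bilinear (the library's locale for algebras is restricted to
  commutative ones).
\<close>

locale star_algebra = ring A + module scalar_ring A
  for A :: "('k::field_char_0, 'a) module" (structure) +
  fixes star :: "'a \<Rightarrow> 'a"
  assumes smult_mult_left:
      "\<lbrakk>x \<in> carrier A; y \<in> carrier A\<rbrakk> \<Longrightarrow> (c \<odot> x) \<otimes> y = c \<odot> (x \<otimes> y)"
    and smult_mult_right:
      "\<lbrakk>x \<in> carrier A; y \<in> carrier A\<rbrakk> \<Longrightarrow> x \<otimes> (c \<odot> y) = c \<odot> (x \<otimes> y)"
    and star_closed: "x \<in> carrier A \<Longrightarrow> star x \<in> carrier A"
    and star_add: "\<lbrakk>x \<in> carrier A; y \<in> carrier A\<rbrakk> \<Longrightarrow> star (x \<oplus> y) = star x \<oplus> star y"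
    and star_smult: "x \<in> carrier A \<Longrightarrow> star (c \<odot> x) = c \<odot> star x"
    and star_mult: "\<lbrakk>x \<in> carrier A; y \<in> carrier A\<rbrakk> \<Longrightarrow> star (x \<otimes> y) = star y \<otimes> star x"
    and star_star: "x \<in> carrier A \<Longrightarrow> star (star x) = x"

definition sym_part :: "('k::field_char_0, 'a) module \<Rightarrow> ('a \<Rightarrow> 'a) \<Rightarrow> 'a set"
  where "sym_part A star = {x \<in> carrier A. star x = x}"

definition skew_part :: "('k::field_char_0, 'a) module \<Rightarrow> ('a \<Rightarrow> 'a) \<Rightarrow> 'a set"
  where "skew_part A star = {x \<in> carrier A. star x = \<ominus>\<^bsub>A\<^esub> x}"

definition word_value :: "('k::field_char_0, 'a) module \<Rightarrow> (letter \<Rightarrow> 'a) \<Rightarrow> letter list \<Rightarrow> 'a"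
  where "word_value A \<phi> w = foldr (\<lambda>x r. \<phi> x \<otimes>\<^bsub>A\<^esub> r) w \<one>\<^bsub>A\<^esub>"

definition poly_value :: "('k::field_char_0, 'a) module \<Rightarrow> (letter \<Rightarrow> 'a) \<Rightarrow> 'k fpoly \<Rightarrow> 'a"
  where "poly_value A \<phi> f =
    (\<Oplus>\<^bsub>A\<^esub>w\<in>Poly_Mapping.keys f. Poly_Mapping.lookup f w \<odot>\<^bsub>A\<^esub> word_value A \<phi> w)"

definition Id_star :: "('k::field_char_0, 'a) module \<Rightarrow> ('a \<Rightarrow> 'a) \<Rightarrow> 'k fpoly set"
  where "Id_star A star = {f. \<forall>\<phi>.
    (\<forall>i. \<phi> (Yv i) \<in> sym_part A star) \<and> (\<forall>i. \<phi> (Zv i) \<in> skew_part A star)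
      \<longrightarrow> poly_value A \<phi> f = \<zero>\<^bsub>A\<^esub>}"


section \<open>Codimensions\<close>

text \<open>
  \<open>B\<close> is a system of representatives of a basis of the quotient space \<open>V / W\<close>.
\<close>

definition quot_basis :: "'k::field fpoly set \<Rightarrow> 'k fpoly set \<Rightarrow> 'k fpoly set \<Rightarrow> bool"
  where "quot_basis V W B \<longleftrightarrow>
    B \<subseteq> V \<and> V \<subseteq> free.span B + W \<and>
    (\<forall>F c. finite F \<and> F \<subseteq> B \<and> (\<Sum>b\<in>F. fscale (c b) b) \<in> W \<longrightarrow> (\<forall>b\<in>F. c b = 0))"

definition quot_dim :: "'k::field fpoly set \<Rightarrow> 'k fpoly set \<Rightarrow> nat"
  where "quot_dim V W = card (SOME B. quot_basis V W B)"

definition codim :: "('k::field_char_0, 'a) module \<Rightarrow> ('a \<Rightarrow> 'a) \<Rightarrow> nat \<Rightarrow> nat"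
  where "codim A star n = quot_dim (Vstar n) (Vstar n \<inter> Id_star A star)"

definition poly_growth :: "(nat \<Rightarrow> nat) \<Rightarrow> nat \<Rightarrow> bool"
  where "poly_growth c k \<longleftrightarrow>
    (\<exists>q::real. q > 0 \<and>
      (\<lambda>n. real (c n) - q * real n ^ k) \<in> O(\<lambda>n. real n powi (int k - 1)))"

text \<open>
  Sequences are indexed by \<open>n \<ge> 1\<close>; \<^const>\<open>restrict\<close> makes equality of functions mean equality
  of the terms with \<open>n \<ge> 1\<close>.
\<close>

definition codim_seq :: "('k::field_char_0, 'a) module \<Rightarrow> ('a \<Rightarrow> 'a) \<Rightarrow> nat \<Rightarrow> nat"
  where "codim_seq A star = restrict (codim A star) {1..}"

definition binom_seq :: "nat \<Rightarrow> nat \<Rightarrow> nat \<Rightarrow> nat"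
  where "binom_seq p q =
    (\<lambda>n\<in>{1..}. 1 + (n choose 1) + p * (n choose 2) + q * (n choose 3))"


section \<open>Admissible sequences\<close>

text \<open>
  A sequence \<open>(M\<^sub>s, \<dots>, M\<^sub>k)\<close> with \<open>1 \<le> s \<le> k\<close> is a list whose length \<open>k + 1 - s\<close> lies between
  \<open>1\<close> and \<open>k\<close>, and which therefore determines \<open>s\<close>.
\<close>

definition start_index :: "nat \<Rightarrow> 'k fpoly set list \<Rightarrow> nat"
  where "start_index k M = k + 1 - length M"

definition entry :: "nat \<Rightarrow> 'k fpoly set list \<Rightarrow> nat \<Rightarrow> 'k fpoly set"
  where "entry k M i = M ! (i - start_index k M)"

definition admissible :: "nat \<Rightarrow> 'k::field fpoly set list \<Rightarrow> bool"
  where "admissible k M \<longleftrightarrow>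
    1 \<le> length M \<and> length M \<le> k \<and>
    (\<forall>i\<in>{start_index k M..k}.
       hyper_submodule i (entry k M i) \<and> fstar ` entry k M i \<subseteq> entry k M i) \<and>
    (start_index k M < k \<longrightarrow> entry k M (start_index k M) \<noteq> {0}) \<and>
    entry k M k \<noteq> Gam k \<and>
    (\<forall>j\<in>{start_index k M + 1..k}.
       (\<Sum>i\<in>{start_index k M..<j}. Tstar_gen (entry k M i)) \<inter> Gam j \<subseteq> entry k M j)"

definition associated ::
    "nat \<Rightarrow> ('k::field_char_0, 'a) module \<Rightarrow> ('a \<Rightarrow> 'a) \<Rightarrow> 'k fpoly set list \<Rightarrow> bool"
  where "associated k A star M \<longleftrightarrow>
    (\<forall>i. 1 \<le> i \<and> i < start_index k M \<longrightarrow> Gam i \<inter> Id_star A star = {0}) \<and>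
    (\<forall>i. start_index k M \<le> i \<and> i \<le> k \<longrightarrow> Gam i \<inter> Id_star A star = entry k M i) \<and>
    (\<forall>i. k < i \<longrightarrow> Gam i \<inter> Id_star A star = Gam i)"


section \<open>The dimension of a quotient space\<close>

lemma quot_basis_card:
  fixes V W B :: "'k::field fpoly set"
  assumes W: "free.subspace W" and V: "free.subspace V" and WV: "W \<subseteq> V"
    and fin: "finite S" "V \<subseteq> free.span S"
    and B: "quot_basis V W B"
  shows "free.dim V = card B + free.dim W"
proof -
  obtain C where C: "C \<subseteq> W" "free.independent C" "W \<subseteq> free.span C" "card C = free.dim W"
    using free.basis_exists [of W] by blast
  have spC: "free.span C = W"
    using C free.span_minimal [OF C(1) W] by blast
  have BV: "B \<subseteq> V" and VB: "V \<subseteq> free.span B + W"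
    and ind: "\<And>F c. finite F \<Longrightarrow> F \<subseteq> B \<Longrightarrow> (\<Sum>b\<in>F. fscale (c b) b) \<in> W \<Longrightarrow> \<forall>b\<in>F. c b = 0"
    using B unfolding quot_basis_def by blast+
  have disj: "B \<inter> C = {}"
  proof (rule ccontr)
    assume "B \<inter> C \<noteq> {}"
    then obtain b where b: "b \<in> B" "b \<in> C" by blast
    have "\<forall>x\<in>{b}. (1::'k) = 0"
      by (rule ind [where c = "\<lambda>_. 1"]) (use b C in auto)
    then show False by simp
  qed
  have indBC: "free.independent (B \<union> C)"
    unfolding free.independent_explicit_module
  proof (intro allI impI)
    fix F u x
    assume F: "finite F" "F \<subseteq> B \<union> C" and s: "(\<Sum>v\<in>F. fscale (u v) v) = 0" and x: "x \<in> F"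
    have split: "(\<Sum>v\<in>F. fscale (u v) v) =
        (\<Sum>v\<in>F \<inter> B. fscale (u v) v) + (\<Sum>v\<in>F \<inter> C. fscale (u v) v)"
      using F disj by (subst sum.union_disjoint [symmetric]) (auto intro!: sum.cong)
    have sC: "(\<Sum>v\<in>F \<inter> C. fscale (u v) v) \<in> W"
      using C W by (intro free.subspace_sum free.subspace_scale) auto
    have "(\<Sum>v\<in>F \<inter> B. fscale (u v) v) = - (\<Sum>v\<in>F \<inter> C. fscale (u v) v)"
      using split s by (simp add: eq_neg_iff_add_eq_0)
    then have "(\<Sum>v\<in>F \<inter> B. fscale (u v) v) \<in> W"
      using free.subspace_neg [OF W sC] by simp
    then have uB: "\<forall>v\<in>F \<inter> B. u v = 0"
      using ind [of "F \<inter> B" u] F by blast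
    then have "(\<Sum>v\<in>F \<inter> C. fscale (u v) v) = 0"
      using split s by simp
    then have "\<forall>v\<in>F \<inter> C. u v = 0"
      using C(2) F free.independentD [of C "F \<inter> C" u] by blast
    then show "u x = 0" using uB x F by blast
  qed
  have "V \<subseteq> free.span (B \<union> C)"
  proof
    fix v assume "v \<in> V"
    then obtain b w where v: "v = b + w" "b \<in> free.span B" "w \<in> W"
      using VB by (auto simp: set_plus_def)
    then show "v \<in> free.span (B \<union> C)"
      using spC free.span_mono [of B "B \<union> C"] free.span_mono [of C "B \<union> C"]
      by (auto intro!: free.span_add)
  qed
  moreover have "B \<union> C \<subseteq> V" using BV C WV by blast
  moreover have "finite (B \<union> C)"
    using free.independent_span_bound [OF fin(1) indBC] \<open>B \<union> C \<subseteq> V\<close> fin(2) by blast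
  ultimately have "free.dim V = card (B \<union> C)"
    using indBC free.basis_card_eq_dim by metis
  then show ?thesis
    using disj C(4) \<open>finite (B \<union> C)\<close> by (simp add: card_Un_disjoint)
qed

lemma quot_basis_exists:
  fixes V W :: "'k::field fpoly set"
  assumes W: "free.subspace W" and V: "free.subspace V" and WV: "W \<subseteq> V"
  shows "\<exists>B. quot_basis V W B"
proof -
  obtain C where C: "C \<subseteq> W" "free.independent C" "W \<subseteq> free.span C"
    using free.basis_exists [of W] by metis
  have spC: "free.span C = W"
    using C free.span_minimal [OF C(1) W] by blast
  obtain D where D: "C \<subseteq> D" "D \<subseteq> V" "free.independent D" "V \<subseteq> free.span D"
    using free.maximal_independent_subset_extend [OF subset_trans [OF C(1) WV] C(2)] by metis
  have "V \<subseteq> free.span (D - C) + W"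
  proof -
    have "free.span D = free.span ((D - C) \<union> C)" using D by (simp add: Un_absorb2)
    also have "\<dots> = {x + y | x y. x \<in> free.span (D - C) \<and> y \<in> free.span C}"
      by (rule free.span_Un)
    finally have "free.span D = free.span (D - C) + W"
      unfolding set_plus_def spC by blast
    then show ?thesis using D(4) by simp
  qed
  moreover have "\<forall>b\<in>F. c b = 0"
    if F: "finite F" "F \<subseteq> D - C" "(\<Sum>b\<in>F. fscale (c b) b) \<in> W" for F c
  proof -
    obtain G u where G: "finite G" "G \<subseteq> C" "(\<Sum>b\<in>F. fscale (c b) b) = (\<Sum>g\<in>G. fscale (u g) g)"
      using F(3) spC free.span_explicit [of C] by auto
    define e where "e = (\<lambda>x. if x \<in> F then c x else - u x)"
    have FG: "F \<inter> G = {}" using F G by blast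
    have "(\<Sum>x\<in>F \<union> G. fscale (e x) x) = (\<Sum>x\<in>F. fscale (e x) x) + (\<Sum>x\<in>G. fscale (e x) x)"
      using F G FG by (simp add: sum.union_disjoint)
    also have "(\<Sum>x\<in>F. fscale (e x) x) = (\<Sum>x\<in>F. fscale (c x) x)"
      by (rule sum.cong) (simp_all add: e_def)
    also have "(\<Sum>x\<in>G. fscale (e x) x) = (\<Sum>x\<in>G. - fscale (u x) x)"
      using FG by (intro sum.cong) (auto simp: e_def)
    finally have "(\<Sum>x\<in>F \<union> G. fscale (e x) x) = 0"
      using G by (simp add: sum_negf)
    moreover have "F \<union> G \<subseteq> D" "finite (F \<union> G)" using F G D(1) by auto
    ultimately have "e x = 0" if "x \<in> F \<union> G" for x
      using free.independentD [of D "F \<union> G" e x] D(3) that by blast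
    then show ?thesis unfolding e_def by (metis UnI1)
  qed
  ultimately have "quot_basis V W (D - C)"
    using D unfolding quot_basis_def by blast
  then show ?thesis ..
qed

lemma quot_dim_eq:
  fixes V W :: "'k::field fpoly set"
  assumes "free.subspace W" "free.subspace V" "W \<subseteq> V" "finite S" "V \<subseteq> free.span S"
  shows "quot_dim V W = free.dim V - free.dim W"
  using quot_basis_card [OF assms someI_ex [OF quot_basis_exists [OF assms(1-3)]]]
  by (simp add: quot_dim_def)

end

theory Submission
  imports Defs "HOL-Library.Infinite_Set"
begin

text \<open>
  Substituting \<open>1\<close> for a symmetric variable is a partial derivative on multilinear polynomials, and
  the proper polynomials are annihilated by all these derivatives.  Since identities of a unital
  algebra are closed under such substitutions and under multiplication, the derivatives yield exact
  sequences which give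
  \<open>c n = (\<Sum>k\<le>n. (n choose k) * \<gamma> k)\<close>, where \<open>\<gamma> k\<close> is the codimension of the identities among the
  polynomials of degree \<open>k\<close> that all derivatives annihilate (\<open>quot_dim_proper_codim\<close>).  Cubic growth
  therefore means \<open>\<gamma> 3 \<noteq> 0\<close> and \<open>\<gamma> k = 0\<close> for \<open>k > 3\<close>; then \<open>\<gamma> 0 = \<gamma> 1 = 1\<close>, and the sequence is
  determined by the pair \<open>(\<gamma> 2, \<gamma> 3)\<close>.  The exact sequences for the full spaces also yield
  the dimensions 5 and 29 of the spaces of degree two and three.

  Under the hyperoctahedral group and the involution together these two spaces are multiplicity free:
  degree two has components of dimensions 1, 2, 1, 1 and degree three has components of dimensions
  2, seven times 3, and 1, 1, 2, 2.  Hence the identities of degree two or three are a direct sum of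
  components (\<open>components\<close>), and it suffices to know which of four and twelve generators are
  identities.

  For the upper bounds, each generator of degree two that is an identity forces some of the generators
  of degree three to be identities, because it may be applied to products of variables that are
  symmetric or skew.  The resulting table leaves \<open>\<gamma> 3 \<le> 29, 15, 5, 4, 1\<close> for
  \<open>\<gamma> 2 = 5, 4, 3, 2, 1\<close> (\<open>proper_codim_bounds\<close>).

  For the realisation of all pairs within these bounds, a set of components is prescribed and the
  largest ideal is taken that is orthogonal to their generators with respect to the form for which
  words are orthonormal.  Distinct components are orthogonal, so exactly the prescribed components of
  degree three survive (\<open>gen3_component_ideal_iff\<close>), and suitable identities of degree two persist
  (\<open>untouched\<close>).  The quotient of the free algebra by such an ideal has precisely that ideal as its
  set of identities (\<open>Id_star_rel_free\<close>).  Subset sums of the dimensions of the components fill the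
  ranges without gaps, which gives \<open>29 + 15 + 5 + 4 + 1 = 54\<close> sequences.
\<close>

section \<open>Homomorphisms of the free algebra\<close>

abbreviation coeff :: "'k::field fpoly \<Rightarrow> letter list \<Rightarrow> 'k"
  where "coeff \<equiv> Poly_Mapping.lookup"

lemmas coeff_simps = lookup_add lookup_minus lookup_uminus lookup_fscale

lemma fscale_mult_left: "fscale c p * q = fscale c (p * q)"
  by (simp add: fscale_conv_mult mult.assoc)

lemma fscale_mult_right: "p * fscale c q = fscale c (p * (q :: 'k::field fpoly))"
proof -
  have "Poly_Mapping.single 0 c * r = r * Poly_Mapping.single 0 c" for r :: "'k fpoly"
  proof -
    have "Poly_Mapping.single 0 c * r =
        (\<Sum>w\<in>Poly_Mapping.keys r. Poly_Mapping.single 0 c * Poly_Mapping.single w (coeff r w))"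
      by (subst (1) fpoly_conv_sum_single [of r, symmetric]) (simp add: sum_distrib_left)
    also have "\<dots> =
        (\<Sum>w\<in>Poly_Mapping.keys r. Poly_Mapping.single w (coeff r w) * Poly_Mapping.single 0 c)"
      by (simp add: mult_single mult.commute)
    also have "\<dots> = r * Poly_Mapping.single 0 c"
      by (subst (3) fpoly_conv_sum_single [of r, symmetric]) (simp add: sum_distrib_right)
    finally show ?thesis .
  qed
  then show ?thesis by (metis fscale_conv_mult mult.assoc)
qed

lemma single_eq_fscale: "Poly_Mapping.single w c = fscale c (monom w)"
  by (rule poly_mapping_eqI) (simp add: lookup_fscale monom_def lookup_single when_def)

lemma fpoly_expansion:
  "p = (\<Sum>w\<in>Poly_Mapping.keys p. fscale (coeff p w) (monom w))"
  using fpoly_conv_sum_single [of p] by (simp add: single_eq_fscale)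

lemma coeff_monom: "coeff (monom w) v = (if v = w then 1 else 0)"
  by (simp add: monom_def lookup_single when_def)

lemma monom_append: "monom (u @ v) = monom u * (monom v :: 'k::field fpoly)"
  by (simp add: monom_def mult_single plus_list_def)

lemma monom_Nil: "monom [] = (1 :: 'k::field fpoly)"
  by (simp add: monom_def flip: zero_list_def)

lemma monom_Cons: "monom (x # w) = var x * (monom w :: 'k::field fpoly)"
  using monom_append [of "[x]" w] by (simp add: var_def)

lemma monom_conv_prod_list: "monom w = (prod_list (map var w) :: 'k::field fpoly)"
  by (induction w) (simp_all add: monom_Nil monom_Cons)

text \<open>
  The factorisations of a word in the free monoid are its cuts into a prefix and a suffix.
\<close>

lemma coeff_mult:
  fixes p q :: "'k::field fpoly"
  shows "coeff (p * q) w = (\<Sum>i\<le>length w. coeff p (take i w) * coeff q (drop i w))"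
proof -
  define R where "R p q = (\<Sum>i\<le>length w. coeff p (take i w) * coeff q (drop i w))"
    for p q :: "'k fpoly"
  have R_sum_left: "R (sum f S) q = (\<Sum>x\<in>S. R (f x) q)" for f S q
    unfolding R_def lookup_sum sum_distrib_right by (rule sum.swap)
  have R_sum_right: "R p (sum f S) = (\<Sum>x\<in>S. R p (f x))" for f S p
    unfolding R_def lookup_sum sum_distrib_left by (rule sum.swap)
  have R_scale: "R (fscale c p) q = c * R p q" "R p (fscale c q) = c * R p q" for c p q
    by (simp_all add: R_def lookup_fscale sum_distrib_left ac_simps)
  have monom: "coeff (monom u * monom v) w = R (monom u) (monom v)" for u v
  proof -
    have "R (monom u) (monom v) =
        (\<Sum>i\<le>length w. if i = length u then (if w = u @ v then 1 else 0) else 0)"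
      unfolding R_def
    proof (rule sum.cong [OF refl])
      fix i assume "i \<in> {..length w}"
      then have "take i w = u \<and> drop i w = v \<longleftrightarrow> i = length u \<and> w = u @ v"
        by (metis append_eq_conv_conj append_take_drop_id atMost_iff length_take min.absorb2)
      moreover have "coeff (monom u :: 'k fpoly) (take i w) * coeff (monom v) (drop i w) =
          (if take i w = u \<and> drop i w = v then 1 else 0)"
        by (simp add: coeff_monom)
      ultimately show "coeff (monom u :: 'k fpoly) (take i w) * coeff (monom v) (drop i w) =
          (if i = length u then (if w = u @ v then 1 else 0) else 0)"
        by presburger
    qed
    also have "\<dots> = (if w = u @ v then 1 else 0)" by auto
    finally show ?thesis by (simp add: coeff_monom flip: monom_append)
  qed
  have left: "coeff (monom u * q) w = R (monom u) q" for u q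
  proof -
    let ?e = "\<Sum>v\<in>Poly_Mapping.keys q. fscale (coeff q v) (monom v)"
    have "coeff (monom u * ?e) w = R (monom u) ?e"
      by (simp only: sum_distrib_left lookup_sum lookup_fscale fscale_mult_right monom
          R_sum_right R_scale)
    then show ?thesis by (simp only: fpoly_expansion [symmetric])
  qed
  let ?e = "\<Sum>v\<in>Poly_Mapping.keys p. fscale (coeff p v) (monom v)"
  have "coeff (?e * q) w = R ?e q"
    by (simp only: sum_distrib_right lookup_sum lookup_fscale fscale_mult_left left
        R_sum_left R_scale)
  then show ?thesis by (simp only: fpoly_expansion [symmetric] R_def)
qed

lemma coeff_one: "coeff 1 w = (if w = [] then 1 else 0)"
  by (simp add: lookup_one when_def zero_list_def)

lemma coeff_mult_Nil: "coeff (p * q) [] = coeff p [] * coeff q []"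
  by (simp add: coeff_mult)

lemma coeff_mult_1: "coeff (p * q) [a] = coeff p [] * coeff q [a] + coeff p [a] * coeff q []"
  by (simp add: coeff_mult atMost_Suc)

lemma coeff_mult_2:
  "coeff (p * q) [a, b] =
    coeff p [] * coeff q [a, b] + coeff p [a] * coeff q [b] + coeff p [a, b] * coeff q []"
  by (simp add: coeff_mult atMost_Suc algebra_simps)

lemma coeff_mult_3:
  "coeff (p * q) [a, b, c] =
    coeff p [] * coeff q [a, b, c] + coeff p [a] * coeff q [b, c]
    + coeff p [a, b] * coeff q [c] + coeff p [a, b, c] * coeff q []"
  by (simp add: coeff_mult atMost_Suc algebra_simps)

lemmas coeff_mult_short = coeff_mult_Nil coeff_mult_1 coeff_mult_2 coeff_mult_3

locale falg_hom =
  fixes h :: "'k::field fpoly \<Rightarrow> 'k fpoly"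
  assumes add: "h (p + q) = h p + h q"
    and scale: "h (fscale c p) = fscale c (h p)"
    and mult: "h (p * q) = h p * h q"
    and one: "h 1 = 1"
begin

lemma zero: "h 0 = 0"
  using add [of 0 0] by simp

lemma minus: "h (- p) = - h p"
  using add [of p "- p"] zero by (simp add: eq_neg_iff_add_eq_0 add.commute)

lemma diff: "h (p - q) = h p - h q"
  using add [of p "- q"] by (simp add: minus)

lemma sum: "h (sum f S) = (\<Sum>i\<in>S. h (f i))"
  by (induction S rule: infinite_finite_induct) (simp_all add: zero add)

lemma comm: "h (comm p q) = comm (h p) (h q)"
  by (simp add: comm_def diff mult)

lemma monom: "h (monom w) = prod_list (map (\<lambda>x. h (var x)) w)"
  by (induction w) (simp_all add: monom_Nil monom_Cons one mult)

lemma expansion: "h p = (\<Sum>w\<in>Poly_Mapping.keys p.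
    fscale (coeff p w) (prod_list (map (\<lambda>x. h (var x)) w)))"
  by (subst fpoly_expansion [of p]) (simp add: sum scale monom)

lemma conv_fsubst: "h = fsubst (\<lambda>x. h (var x))"
  unfolding fsubst_def by (rule ext) (rule expansion)

lemmas hom_simps = add scale mult one zero minus diff comm

end

lemma star_endo_iff: "star_endo h \<longleftrightarrow> falg_hom h \<and> (\<forall>p. h (fstar p) = fstar (h p))"
  unfolding star_endo_def falg_hom_def by auto

lemma star_endo_hom: "star_endo h \<Longrightarrow> falg_hom h"
  and star_endo_fstar: "star_endo h \<Longrightarrow> h (fstar p) = fstar (h p)"
  by (simp_all add: star_endo_iff)

lemma fsubst_superset:
  assumes "finite K" "Poly_Mapping.keys p \<subseteq> K"
  shows "fsubst \<phi> p = (\<Sum>w\<in>K. fscale (coeff p w) (prod_list (map \<phi> w)))"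
  unfolding fsubst_def
  by (rule sum.mono_neutral_left) (use assms in \<open>auto simp: in_keys_iff\<close>)

lemma fsubst_monom: "fsubst \<phi> (monom w) = (prod_list (map \<phi> w) :: 'k::field fpoly)"
  by (simp add: fsubst_def monom_def)

lemma fsubst_add: "fsubst \<phi> (p + q) = fsubst \<phi> p + (fsubst \<phi> q :: 'k::field fpoly)"
proof -
  let ?K = "Poly_Mapping.keys p \<union> Poly_Mapping.keys q"
  have "fsubst \<phi> r = (\<Sum>w\<in>?K. fscale (coeff r w) (prod_list (map \<phi> w)))"
    if "r \<in> {p, q, p + q}" for r
    by (rule fsubst_superset) (use that keys_add [of p q] in auto)
  then show ?thesis
    by (simp add: lookup_add free.scale_left_distrib sum.distrib)
qed

lemma fsubst_fscale: "fsubst \<phi> (fscale c p) = fscale c (fsubst \<phi> p :: 'k::field fpoly)"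
proof -
  have "fsubst \<phi> (fscale c p) =
      (\<Sum>w\<in>Poly_Mapping.keys p. fscale (coeff (fscale c p) w) (prod_list (map \<phi> w)))"
    by (rule fsubst_superset) (auto simp: in_keys_iff lookup_fscale)
  then show ?thesis by (simp add: fsubst_def lookup_fscale free.scale_sum_right)
qed

lemma fsubst_sum: "fsubst \<phi> (sum f S) = (\<Sum>i\<in>S. fsubst \<phi> (f i) :: 'k::field fpoly)"
proof (induction S rule: infinite_finite_induct)
  case empty
  show ?case by (simp add: fsubst_def)
next
  case (infinite A)
  then show ?case by (simp add: fsubst_def)
qed (simp add: fsubst_add)

interpretation fsubst: falg_hom "fsubst \<phi>" for \<phi> :: "letter \<Rightarrow> 'k::field fpoly"
proof
  fix p q :: "'k fpoly"
  have *: "fsubst \<phi> (monom u * monom v) = fsubst \<phi> (monom u) * fsubst \<phi> (monom v)" for u v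
    by (simp add: fsubst_monom flip: monom_append)
  show "fsubst \<phi> (p * q) = fsubst \<phi> p * fsubst \<phi> q"
    by (subst (1 2) fpoly_expansion [of p], subst (1 2) fpoly_expansion [of q])
      (simp add: sum_product fsubst_sum fscale_mult_left fscale_mult_right fsubst_fscale *)
  show "fsubst \<phi> 1 = 1" by (simp add: fsubst_monom flip: monom_Nil)
qed (simp_all add: fsubst_add fsubst_fscale)

lemma fsubst_var: "fsubst \<phi> (var x) = (\<phi> x :: 'k::field fpoly)"
  by (simp add: var_def fsubst_monom)

lemma fstar_one: "fstar 1 = (1 :: 'k::field fpoly)"
  by (rule poly_mapping_eqI) (simp add: lookup_fstar coeff_one word_sign_def)

lemma fstar_zero: "fstar 0 = (0 :: 'k::field fpoly)"
  by (rule poly_mapping_eqI) (simp add: lookup_fstar)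

lemma fstar_minus: "fstar (- p) = - fstar p"
  by (rule poly_mapping_eqI) (simp add: lookup_fstar)

lemma fstar_diff: "fstar (p - q) = fstar p - fstar q"
  using fstar_add [of p "- q"] by (simp add: fstar_minus)

lemma fstar_comm: "fstar (comm p q) = comm (fstar q) (fstar p)"
  by (simp add: comm_def fstar_diff fstar_mult)

lemmas fstar_simps = fstar_add fstar_diff fstar_minus fstar_mult fstar_comm fstar_fscale
  fstar_one fstar_zero fstar_Yv fstar_Zv fstar_fstar

lemma fsubst_fstar:
  assumes Y: "\<And>i. fstar (\<phi> (Yv i)) = \<phi> (Yv i)" and Z: "\<And>i. fstar (\<phi> (Zv i)) = - \<phi> (Zv i)"
  shows "fsubst \<phi> (fstar p) = fstar (fsubst \<phi> (p :: 'k::field fpoly))"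
proof -
  have var: "fsubst \<phi> (fstar (var x)) = fstar (fsubst \<phi> (var x))" for x
    by (cases x) (simp_all add: fstar_Yv fstar_Zv fsubst_var fsubst.minus Y Z)
  have *: "fsubst \<phi> (fstar (monom w)) = fstar (fsubst \<phi> (monom w))" for w
    by (induction w) (simp_all add: monom_Nil fstar_one fsubst.one monom_Cons fstar_mult
        fsubst.mult var)
  show ?thesis
    by (subst (1 2) fpoly_expansion [of p]) (simp add: fstar_sum fstar_fscale fsubst.sum fsubst.scale *)
qed

lemma star_endo_fsubst:
  assumes "\<And>i. fstar (\<phi> (Yv i)) = \<phi> (Yv i)" and "\<And>i. fstar (\<phi> (Zv i)) = - \<phi> (Zv i)"
  shows "star_endo (fsubst \<phi> :: 'k::field fpoly \<Rightarrow> _)"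
  using fsubst_fstar [OF assms] by (simp add: star_endo_iff fsubst.falg_hom_axioms)

lemma star_endo_image_Yv: "star_endo h \<Longrightarrow> fstar (h (var (Yv i))) = h (var (Yv i))"
  by (metis star_endo_fstar fstar_Yv)

lemma star_endo_image_Zv: "star_endo h \<Longrightarrow> fstar (h (var (Zv i))) = - h (var (Zv i))"
  by (metis star_endo_fstar fstar_Zv star_endo_hom falg_hom.minus)

lemma star_endo_comp: "star_endo g \<Longrightarrow> star_endo h \<Longrightarrow> star_endo (\<lambda>p. g (h p))"
  by (simp add: star_endo_def)

lemma star_endo_id: "star_endo (\<lambda>p. p)"
  by (simp add: star_endo_def)

lemma two_fpoly_inverse: "fscale (1 / 2) (p + p) = (p :: 'k::field_char_0 fpoly)"
  by (rule poly_mapping_eqI) (simp add: coeff_simps)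

section \<open>Star-closed T-star-ideals\<close>

text \<open>
  The set of star-identities of an algebra is of this kind. Closure under the involution is an
  extra condition, because the involution reverses products and so is no endomorphism.
\<close>

locale closed_ideal =
  fixes I :: "'k::field_char_0 fpoly set"
  assumes Tstar: "Tstar_ideal I"
    and star: "f \<in> I \<Longrightarrow> fstar f \<in> I"
begin

lemma subspace: "free.subspace I"
  and left: "f \<in> I \<Longrightarrow> p * f \<in> I"
  and right: "f \<in> I \<Longrightarrow> f * p \<in> I"
  and endo: "star_endo h \<Longrightarrow> f \<in> I \<Longrightarrow> h f \<in> I"
  using Tstar unfolding Tstar_ideal_def by blast+

lemma zero: "0 \<in> I"
  and add: "f \<in> I \<Longrightarrow> g \<in> I \<Longrightarrow> f + g \<in> I"
  and diff: "f \<in> I \<Longrightarrow> g \<in> I \<Longrightarrow> f - g \<in> I"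
  and minus: "f \<in> I \<Longrightarrow> - f \<in> I"
  and scale: "f \<in> I \<Longrightarrow> fscale c f \<in> I"
  using subspace by (auto intro: free.subspace_0 free.subspace_add free.subspace_diff
      free.subspace_neg free.subspace_scale)

lemma sum: "(\<And>i. i \<in> S \<Longrightarrow> f i \<in> I) \<Longrightarrow> sum f S \<in> I"
  using subspace by (rule free.subspace_sum)

lemma scale_iff: "c \<noteq> 0 \<Longrightarrow> fscale c f \<in> I \<longleftrightarrow> f \<in> I"
  using scale [of "fscale c f" "1 / c"] scale [of f c] by auto

lemma minus_iff: "- f \<in> I \<longleftrightarrow> f \<in> I"
  using minus [of f] minus [of "- f"] by auto

lemma half: "f + f \<in> I \<Longrightarrow> f \<in> I"
  using scale [of "f + f" "1 / 2"] by (simp add: two_fpoly_inverse)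

lemma comm_left: "f \<in> I \<Longrightarrow> comm f p \<in> I"
  and comm_right: "f \<in> I \<Longrightarrow> comm p f \<in> I"
  by (simp_all add: comm_def diff left right)

text \<open>
  This is where characteristic zero separates a polynomial into parts: if an operation that
  preserves the ideal fixes \<open>f\<close> and negates \<open>g\<close>, it turns \<open>f + g\<close> into \<open>f - g\<close>.
\<close>

lemma split: "f + g \<in> I \<Longrightarrow> f - g \<in> I \<Longrightarrow> f \<in> I \<and> g \<in> I"
  using add [of "f + g" "f - g"] diff [of "f + g" "f - g"] half [of f] half [of g] by simp

end

lemma closed_ideal_UNIV: "closed_ideal UNIV"
  by standard (auto simp: Tstar_ideal_def)

lemma closed_ideal_zero: "closed_ideal {0 :: 'k::field_char_0 fpoly}"
  by standard (auto simp: Tstar_ideal_def fstar_zero dest: star_endo_hom falg_hom.zero)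

section \<open>Dimensions of finite-dimensional subspaces\<close>

interpretation fpair: vector_space_pair fscale fscale ..

lemma (in falg_hom) linear: "Vector_Spaces.linear fscale fscale h"
  by (simp add: Vector_Spaces.linear_iff free.vector_space_axioms add scale)

lemma quot_basis_independent:
  assumes "quot_basis V W B" "free.subspace W"
  shows "free.independent B"
  unfolding free.independent_explicit_module
proof (intro allI impI)
  fix F u v
  assume "finite F" "F \<subseteq> B" "(\<Sum>v\<in>F. fscale (u v) v) = 0" "v \<in> F"
  then have "(\<Sum>v\<in>F. fscale (u v) v) \<in> W"
    using free.subspace_0 [OF assms(2)] by simp
  then show "u v = 0"
    using assms(1) \<open>finite F\<close> \<open>F \<subseteq> B\<close> \<open>v \<in> F\<close> unfolding quot_basis_def by blast
qed

text \<open>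
  Rank and nullity for a finite-dimensional subspace of the free algebra: a basis of a complement
  of the kernel is mapped to a basis of the image.
\<close>

lemma dim_kernel_image:
  fixes V :: "'k::field fpoly set"
  assumes lin: "Vector_Spaces.linear fscale fscale D" and V: "free.subspace V"
    and fin: "finite S" "V \<subseteq> free.span S"
  shows "free.dim V = free.dim {f \<in> V. D f = 0} + free.dim (D ` V)"
proof -
  interpret D: Vector_Spaces.linear fscale fscale D by fact
  let ?W = "{f \<in> V. D f = 0}"
  have W: "free.subspace ?W"
    using V by (auto simp: free.subspace_def D.zero D.add D.scale)
  obtain B where B: "quot_basis V ?W B"
    using quot_basis_exists [OF W V] by auto
  then have BV: "B \<subseteq> V" and VB: "V \<subseteq> free.span B + ?W"
    and ind: "\<And>F c. finite F \<Longrightarrow> F \<subseteq> B \<Longrightarrow> (\<Sum>b\<in>F. fscale (c b) b) \<in> ?W \<Longrightarrow> \<forall>b\<in>F. c b = 0"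
    unfolding quot_basis_def by blast+
  have "free.independent B" using B W by (rule quot_basis_independent)
  moreover have "inj_on D (free.span B)"
  proof (subst D.inj_on_iff_eq_0 [OF free.subspace_span], intro ballI impI)
    fix x assume x: "x \<in> free.span B" "D x = 0"
    obtain F c where F: "finite F" "F \<subseteq> B" "x = (\<Sum>b\<in>F. fscale (c b) b)"
      using x(1) unfolding free.span_explicit mem_Collect_eq by (elim exE conjE)
    have "x \<in> V" using x(1) free.span_minimal [OF BV V] by blast
    then have "(\<Sum>b\<in>F. fscale (c b) b) \<in> ?W" using x(2) unfolding F(3) [symmetric] by blast
    then have "\<forall>b\<in>F. c b = 0" by (rule ind [OF F(1,2)])
    then show "x = 0" using F(3) by simp
  qed
  ultimately have "free.independent (D ` B)"
    by (rule fpair.linear_independent_injective_image [OF lin])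
  moreover have "D ` V \<subseteq> free.span (D ` B)"
  proof
    fix y assume "y \<in> D ` V"
    then obtain b w where "y = D (b + w)" "b \<in> free.span B" "D w = 0"
      using VB by (force simp: set_plus_def)
    then show "y \<in> free.span (D ` B)" by (auto simp: D.add D.span_image)
  qed
  ultimately have "free.dim (D ` V) = card (D ` B)"
    using BV by (intro free.basis_card_eq_dim [symmetric]) auto
  also have "\<dots> = card B"
    by (rule card_image [OF inj_on_subset [OF \<open>inj_on D (free.span B)\<close> free.span_superset]])
  finally show ?thesis
    using quot_basis_card [OF W V _ fin B] by simp
qed

lemma dim_subspace_mono:
  fixes V :: "'k::field fpoly set"
  assumes "free.subspace W" "free.subspace V" "W \<subseteq> V" "finite S" "V \<subseteq> free.span S"
  shows "free.dim W \<le> free.dim V"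
  using quot_basis_card [OF assms] quot_basis_exists [OF assms(1-3)] by fastforce

lemma dim_subspace_eq:
  fixes V :: "'k::field fpoly set"
  assumes "free.subspace W" "free.subspace V" "W \<subseteq> V" "finite S" "V \<subseteq> free.span S"
    and "free.dim W = free.dim V"
  shows "W = V"
proof -
  obtain B where B: "quot_basis V W B" using quot_basis_exists [OF assms(1-3)] ..
  obtain T where T: "T \<subseteq> V" "free.independent T" "V \<subseteq> free.span T"
    using free.basis_exists [of V] by metis
  have "card B = 0" using quot_basis_card [OF assms(1-5) B] assms(6) by simp
  moreover have "finite B"
    using free.independent_span_bound [OF assms(4) quot_basis_independent [OF B assms(1)]]
      B assms(5) unfolding quot_basis_def by blast
  ultimately have "B = {}" by simp
  then show ?thesis using B assms(3) by (auto simp: quot_basis_def set_plus_def)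
qed

lemma (in falg_hom) image_span_subset:
  assumes "free.subspace T" "\<And>s. s \<in> S \<Longrightarrow> h s \<in> T" "f \<in> free.span S"
  shows "h f \<in> T"
  using assms(3)
proof (induction rule: free.span_induct_alt)
  case base
  show ?case using assms(1) by (simp add: zero free.subspace_0)
next
  case (step c x y)
  then show ?case using assms by (simp add: add scale free.subspace_add free.subspace_scale)
qed

lemma falg_hom_ext:
  assumes "falg_hom h" "falg_hom g" "\<And>x. h (var x) = g (var x)"
  shows "h = g"
proof -
  have "h = fsubst (\<lambda>x. h (var x))" by (rule falg_hom.conv_fsubst [OF assms(1)])
  also have "\<dots> = fsubst (\<lambda>x. g (var x))" by (simp add: assms(3))
  also have "\<dots> = g" by (rule falg_hom.conv_fsubst [OF assms(2), symmetric])
  finally show ?thesis .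
qed

section \<open>Multilinear polynomials and substitution of one\<close>

fun idx :: "letter \<Rightarrow> nat"
  where "idx (Yv i) = i" | "idx (Zv i) = i"

text \<open>
  The index set is arbitrary because the reduction to proper polynomials removes single indices.
\<close>

definition mwords :: "nat set \<Rightarrow> letter list set"
  where "mwords A = {w. distinct (map idx w) \<and> idx ` set w = A}"

definition multilin :: "nat set \<Rightarrow> 'k::field fpoly set"
  where "multilin A = free.span (monom ` mwords A)"

text \<open>
  Substituting one for the symmetric variable \<open>i\<close> acts on multilinear polynomials as a partial
  derivative. The skew variable of the same index has to go to zero, the only skew scalar, so that
  the substitution commutes with the involution.
\<close>

definition drop_var :: "nat \<Rightarrow> 'k::field fpoly \<Rightarrow> 'k fpoly"
  where "drop_var i = fsubst (\<lambda>x. if x = Yv i then 1 else if x = Zv i then 0 else var x)"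

text \<open>
  The polynomials that are proper in the indices from \<open>U\<close> only. For \<open>A = U = {..<n}\<close> they
  contain \<^term>\<open>Gam n\<close>; the intermediate sets carry the induction that reduces
  codimensions to proper codimensions.
\<close>

definition proper_multilin :: "nat set \<Rightarrow> nat set \<Rightarrow> 'k::field fpoly set"
  where "proper_multilin A U = {f \<in> multilin A. \<forall>i\<in>U. drop_var i f = 0}"

lemma length_mwords: "w \<in> mwords A \<Longrightarrow> length w = card A"
  unfolding mwords_def by (metis (mono_tags, lifting) distinct_card length_map mem_Collect_eq set_map)

lemma finite_mwords:
  assumes "finite A" shows "finite (mwords A)"
proof (rule finite_subset)
  have "x \<in> Yv ` A \<union> Zv ` A" if "idx x \<in> A" for x
    using that by (cases x) auto
  then show "mwords A \<subseteq> {w. set w \<subseteq> Yv ` A \<union> Zv ` A \<and> length w = card A}"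
    using length_mwords by (auto simp: mwords_def)
qed (use assms in \<open>auto intro!: finite_lists_length_eq\<close>)

lemma subspace_multilin: "free.subspace (multilin A)"
  by (simp add: multilin_def)

lemma multilin_fin:
  assumes "finite A"
  shows "finite (monom ` mwords A)" "multilin A \<subseteq> free.span (monom ` mwords A)"
  using finite_mwords [OF assms] by (auto simp: multilin_def)

lemma drop_var_hom: "falg_hom (drop_var i)"
  unfolding drop_var_def by (rule fsubst.falg_hom_axioms)

interpretation drop_var: falg_hom "drop_var i" for i
  by (rule drop_var_hom)

lemma drop_var_star_endo: "star_endo (drop_var i)"
  unfolding drop_var_def
  by (rule star_endo_fsubst) (auto simp: fstar_simps)

lemma drop_var_var:
  "drop_var i (var x) = (if x = Yv i then 1 else if x = Zv i then 0 else var x)"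
  by (simp add: drop_var_def fsubst_var)

lemma drop_var_commute: "drop_var i (drop_var j f) = drop_var j (drop_var i f)"
proof -
  have "(\<lambda>f. drop_var i (drop_var j f)) = (\<lambda>f. drop_var j (drop_var i f))"
    by (rule falg_hom_ext)
      (unfold_locales, auto simp: drop_var.hom_simps drop_var_var)
  then show ?thesis by metis
qed

lemma drop_var_monom_free:
  assumes "i \<notin> idx ` set w"
  shows "drop_var i (monom w) = monom w"
  using assms by (induction w) (auto simp: monom_Nil monom_Cons drop_var.one drop_var.mult drop_var_var)

lemma drop_var_multilin_free:
  assumes "f \<in> multilin A" "i \<notin> A"
  shows "drop_var i f = f"
  using assms(1) unfolding multilin_def
proof (induction rule: free.span_induct_alt)
  case (step c x y)
  then show ?case
    using assms(2) by (auto simp: drop_var.add drop_var.scale mwords_def drop_var_monom_free)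
qed (simp add: drop_var.zero)

lemma mwords_split:
  assumes "w \<in> mwords A" "i \<in> A"
  obtains u v x where "w = u @ x # v" "x = Yv i \<or> x = Zv i" "u @ v \<in> mwords (A - {i})"
    "i \<notin> idx ` set u" "i \<notin> idx ` set v"
proof -
  obtain x where x: "x \<in> set w" "idx x = i" using assms by (auto simp: mwords_def)
  then obtain u v where w: "w = u @ x # v" by (meson split_list)
  have "x = Yv i \<or> x = Zv i" by (cases x) (use x in auto)
  moreover have "u @ v \<in> mwords (A - {i})" "i \<notin> idx ` set u" "i \<notin> idx ` set v"
    using assms x(2) unfolding w mwords_def by (auto, (metis imageI)+)
  ultimately show ?thesis using that w by blast
qed

lemma drop_var_multilin:
  assumes "f \<in> multilin A" "i \<in> A"
  shows "drop_var i f \<in> multilin (A - {i})"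
proof (rule drop_var.image_span_subset [OF subspace_multilin])
  show "f \<in> free.span (monom ` mwords A)" using assms by (simp add: multilin_def)
  fix s :: "'a fpoly" assume "s \<in> monom ` mwords A"
  then obtain w where w: "w \<in> mwords A" "s = monom w" by auto
  obtain u v x where uvx: "w = u @ x # v" "x = Yv i \<or> x = Zv i" "u @ v \<in> mwords (A - {i})"
    "i \<notin> idx ` set u" "i \<notin> idx ` set v"
    using mwords_split [OF w(1) assms(2)] .
  have "drop_var i s = 0 \<or> drop_var i s = monom (u @ v)"
    using uvx unfolding w(2)
    by (auto simp: monom_append monom_Cons drop_var.mult drop_var_var drop_var_monom_free)
  then show "drop_var i s \<in> multilin (A - {i})"
    using uvx(3) by (metis free.span_base free.span_zero imageI multilin_def)
qed

lemma left_var_multilin: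
  assumes "g \<in> multilin (A - {i})" "i \<in> A"
  shows "var (Yv i) * g \<in> multilin A"
  using assms(1) unfolding multilin_def
proof (induction rule: free.span_induct_alt)
  case base
  show ?case by (simp add: free.span_zero)
next
  case (step c x y)
  from step(1) obtain w where w: "w \<in> mwords (A - {i})" "x = monom w" by auto
  then have "Yv i # w \<in> mwords A" using assms(2) by (auto simp: mwords_def)
  then have "var (Yv i) * x \<in> free.span (monom ` mwords A)"
    by (auto simp: w(2) intro!: free.span_base simp flip: monom_Cons)
  then show ?case
    using step(2) by (simp add: algebra_simps fscale_mult_right free.span_add free.span_scale)
qed

lemma subspace_proper_multilin: "free.subspace (proper_multilin A U)"
  using subspace_multilin [of A]
  by (auto simp: proper_multilin_def free.subspace_def drop_var.hom_simps)

lemma proper_multilin_fin: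
  assumes "finite A"
  shows "finite (monom ` mwords A)" "proper_multilin A U \<subseteq> free.span (monom ` mwords A)"
  using multilin_fin [OF assms] by (auto simp: proper_multilin_def)

lemma proper_multilin_empty: "proper_multilin A {} = multilin A"
  by (simp add: proper_multilin_def)

section \<open>Codimensions from proper codimensions\<close>

context closed_ideal
begin

text \<open>
  The map \<^term>\<open>drop_var i\<close> from the polynomials on \<open>A\<close> to those on \<open>A - {i}\<close> has the left
  multiplication by the symmetric variable \<open>i\<close> as a section. Both maps preserve \<open>I\<close>, so rank and
  nullity apply inside \<open>I\<close>.
\<close>

lemma dim_proper_multilin_step:
  assumes A: "finite A" and i: "i \<in> A" "i \<notin> U"
  shows "free.dim (proper_multilin A U \<inter> I) =
    free.dim (proper_multilin A (insert i U) \<inter> I) + free.dim (proper_multilin (A - {i}) U \<inter> I)"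
proof -
  let ?V = "proper_multilin A U \<inter> I"
  have "free.subspace ?V"
    by (simp add: free.subspace_inter subspace_proper_multilin subspace)
  moreover have "?V \<subseteq> free.span (monom ` mwords A)"
    using proper_multilin_fin [OF A] by blast
  moreover have "{f \<in> ?V. drop_var i f = 0} = proper_multilin A (insert i U) \<inter> I"
    by (auto simp: proper_multilin_def)
  moreover have "drop_var i ` ?V = proper_multilin (A - {i}) U \<inter> I"
  proof safe
    fix f assume "f \<in> proper_multilin A U" "f \<in> I"
    then show "drop_var i f \<in> proper_multilin (A - {i}) U" "drop_var i f \<in> I"
      using i endo [OF drop_var_star_endo]
      by (auto simp: proper_multilin_def drop_var_multilin drop_var_commute [of _ i] drop_var.zero)
  next
    fix g assume g: "g \<in> proper_multilin (A - {i}) U" "g \<in> I"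
    then have "drop_var i (var (Yv i) * g) = g"
      by (auto simp: drop_var.mult drop_var_var proper_multilin_def
          intro!: drop_var_multilin_free [where A = "A - {i}"])
    moreover have "var (Yv i) * g \<in> ?V"
      using g i left by (auto simp: proper_multilin_def left_var_multilin drop_var.mult)
    ultimately show "g \<in> drop_var i ` ?V" by (metis image_eqI)
  qed
  ultimately show ?thesis
    using dim_kernel_image [OF drop_var.linear, of ?V "monom ` mwords A" i]
      finite_mwords [OF A] by simp
qed

text \<open>
  Iterating the previous step: every index outside \<open>U\<close> is either dropped or made proper.
\<close>

lemma dim_proper_multilin_sum:
  assumes "finite A" "U \<subseteq> A"
  shows "free.dim (proper_multilin A U \<inter> I) =
    (\<Sum>B | U \<subseteq> B \<and> B \<subseteq> A. free.dim (proper_multilin B B \<inter> I))"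
  using assms
proof (induction "card (A - U)" arbitrary: A U rule: less_induct)
  case less
  show ?case
  proof (cases "A \<subseteq> U")
    case True
    then have "{B. U \<subseteq> B \<and> B \<subseteq> A} = {A}" "U = A" using less.prems by auto
    then show ?thesis by simp
  next
    case False
    then obtain i where i: "i \<in> A" "i \<notin> U" by auto
    have "card (A - insert i U) < card (A - U)" "card (A - {i} - U) < card (A - U)"
      by (rule psubset_card_mono; use i less.prems in auto)+
    then have IH: "free.dim (proper_multilin A (insert i U) \<inter> I) =
        (\<Sum>B | insert i U \<subseteq> B \<and> B \<subseteq> A. free.dim (proper_multilin B B \<inter> I))"
      "free.dim (proper_multilin (A - {i}) U \<inter> I) =
        (\<Sum>B | U \<subseteq> B \<and> B \<subseteq> A - {i}. free.dim (proper_multilin B B \<inter> I))"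
      using i less.prems less.hyps [of A "insert i U"] less.hyps [of "A - {i}" U] by auto
    have "{B. U \<subseteq> B \<and> B \<subseteq> A} = {B. insert i U \<subseteq> B \<and> B \<subseteq> A} \<union> {B. U \<subseteq> B \<and> B \<subseteq> A - {i}}"
      by auto
    moreover have "finite {B. insert i U \<subseteq> B \<and> B \<subseteq> A}" "finite {B. U \<subseteq> B \<and> B \<subseteq> A - {i}}"
      using less.prems by (auto intro: finite_subset [OF _ finite_Pow_iff [THEN iffD2]])
    ultimately show ?thesis
      using dim_proper_multilin_step [OF less.prems(1) i] IH
      by (auto intro!: sum.union_disjoint [symmetric])
  qed
qed

end

lemma hyper_act_Yv: "hyper_act a \<sigma> (var (Yv i)) = var (Yv (\<sigma> i))"
  and hyper_act_Zv: "hyper_act a \<sigma> (var (Zv i)) = fscale (a (\<sigma> i)) (var (Zv (\<sigma> i)))"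
  by (simp_all add: hyper_act_def fsubst_var)

lemma hyper_act_star_endo: "star_endo (hyper_act a \<sigma>)"
  unfolding hyper_act_def by (rule star_endo_fsubst) (auto simp: fstar_simps)

interpretation hyper_act: falg_hom "hyper_act a \<sigma>" for a \<sigma>
  by (rule star_endo_hom [OF hyper_act_star_endo])

lemma hyper_act_var: "\<exists>d u'. hyper_act a \<sigma> (var u) = fscale d (var u') \<and> idx u' = \<sigma> (idx u)"
proof (cases u)
  case (Yv i)
  then show ?thesis by (intro exI [of _ 1] exI [of _ "Yv (\<sigma> i)"]) (simp add: hyper_act_Yv)
next
  case (Zv i)
  then show ?thesis
    by (intro exI [of _ "a (\<sigma> i)"] exI [of _ "Zv (\<sigma> i)"]) (simp add: hyper_act_Zv)
qed

lemma hyper_act_monom: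
  "\<exists>d v. hyper_act a \<sigma> (monom w) = fscale d (monom v) \<and> map idx v = map \<sigma> (map idx w)"
proof (induction w)
  case Nil
  show ?case by (intro exI [of _ 1] exI [of _ "[]"]) (simp add: monom_Nil hyper_act.one)
next
  case (Cons x w)
  then obtain d v where v: "hyper_act a \<sigma> (monom w) = fscale d (monom v)"
    "map idx v = map \<sigma> (map idx w)"
    by blast
  obtain e x' where "hyper_act a \<sigma> (var x) = fscale e (var x')" "idx x' = \<sigma> (idx x)"
    using hyper_act_var by blast
  then show ?case
    using v by (intro exI [of _ "d * e"] exI [of _ "x' # v"])
      (simp add: monom_Cons hyper_act.mult fscale_mult_left fscale_mult_right mult.commute)
qed

lemma hyper_act_multilin:
  assumes "f \<in> multilin A" "inj_on \<sigma> A"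
  shows "hyper_act a \<sigma> f \<in> multilin (\<sigma> ` A)"
proof (rule hyper_act.image_span_subset [OF subspace_multilin])
  show "f \<in> free.span (monom ` mwords A)" using assms by (simp add: multilin_def)
  fix s :: "'a fpoly" assume "s \<in> monom ` mwords A"
  then obtain w where w: "w \<in> mwords A" "s = monom w" by auto
  obtain d v where v: "hyper_act a \<sigma> (monom w) = fscale d (monom v)"
    "map idx v = map \<sigma> (map idx w)"
    using hyper_act_monom by blast
  have "set (map idx v) = \<sigma> ` A" "distinct (map idx v)"
    unfolding v(2) using w(1) assms(2) by (auto simp: mwords_def distinct_map image_image comp_inj_on)
  then have "v \<in> mwords (\<sigma> ` A)" by (simp add: mwords_def)
  then show "hyper_act a \<sigma> s \<in> multilin (\<sigma> ` A)"
    unfolding w(2) v(1) multilin_def by (intro free.span_scale free.span_base imageI)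
qed

definition relabel :: "(nat \<Rightarrow> nat) \<Rightarrow> 'k::field fpoly \<Rightarrow> 'k fpoly"
  where "relabel = hyper_act (\<lambda>_. 1)"

lemma relabel_star_endo: "star_endo (relabel \<pi>)"
  unfolding relabel_def by (rule hyper_act_star_endo)

interpretation relabel: falg_hom "relabel \<pi>" for \<pi>
  by (rule star_endo_hom [OF relabel_star_endo])

lemma relabel_Yv: "relabel \<pi> (var (Yv i)) = var (Yv (\<pi> i))"
  and relabel_Zv: "relabel \<pi> (var (Zv i)) = var (Zv (\<pi> i))"
  by (simp_all add: relabel_def hyper_act_Yv hyper_act_Zv)

lemma relabel_inverse:
  assumes "\<And>i. \<pi> (\<rho> i) = i"
  shows "relabel \<pi> (relabel \<rho> f) = f"
proof -
  have "relabel \<pi> (relabel \<rho> (var x)) = var x" for x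
    using assms by (cases x) (simp_all add: relabel_Yv relabel_Zv)
  then have "(\<lambda>f. relabel \<pi> (relabel \<rho> f)) = (\<lambda>f. f)"
    by (intro falg_hom_ext) (unfold_locales, auto simp: relabel.hom_simps)
  then show ?thesis by metis
qed

lemma drop_var_relabel:
  assumes "bij \<pi>"
  shows "drop_var (\<pi> i) (relabel \<pi> f) = relabel \<pi> (drop_var i f)"
proof -
  have "drop_var (\<pi> i) (relabel \<pi> (var x)) = relabel \<pi> (drop_var i (var x))" for x
    using assms
    by (cases x) (auto simp: relabel_Yv relabel_Zv drop_var_var relabel.hom_simps
        dest: bij_is_inj [THEN injD])
  then have "(\<lambda>f. drop_var (\<pi> i) (relabel \<pi> f)) = (\<lambda>f. relabel \<pi> (drop_var i f))"
    by (intro falg_hom_ext) (unfold_locales, auto simp: relabel.hom_simps drop_var.hom_simps)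
  then show ?thesis by metis
qed

lemma relabel_proper_multilin:
  assumes "f \<in> proper_multilin A U" "bij \<pi>"
  shows "relabel \<pi> f \<in> proper_multilin (\<pi> ` A) (\<pi> ` U)"
  using assms hyper_act_multilin [of f A \<pi> "\<lambda>_. 1"] inj_on_subset [OF bij_is_inj]
  by (auto simp: proper_multilin_def drop_var_relabel relabel.zero relabel_def [symmetric])

definition proper_dim :: "'k::field fpoly set \<Rightarrow> nat \<Rightarrow> nat"
  where "proper_dim I k = free.dim (proper_multilin {..<k} {..<k} \<inter> I)"

context closed_ideal
begin

text \<open>
  The ideal is invariant under renaming of variables. The renaming is extended to a bijection of
  all indices because only then it commutes with \<^const>\<open>drop_var\<close>.
\<close>

lemma dim_proper_multilin_card:
  assumes "finite B"
  shows "free.dim (proper_multilin B B \<inter> I) = proper_dim I (card B)"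
proof -
  let ?k = "card B"
  let ?V = "proper_multilin {..<?k} {..<?k} \<inter> I"
  obtain \<pi> where \<pi>: "bij \<pi>" "\<pi> ` {..<?k} = B"
  proof -
    obtain f where f: "bij_betw f {..<?k} B"
      using assms finite_same_card_bij [of "{..<?k}" B] by auto
    have "infinite (- {..<?k})" "infinite (- B)"
      using assms by (simp_all add: Compl_eq_Diff_UNIV Diff_infinite_finite)
    then obtain g where g: "bij_betw g (- {..<?k}) (- B)"
      using bij_betw_trans [OF bij_betw_inv_into [OF bij_enumerate] bij_enumerate] by blast
    let ?p = "\<lambda>i. if i \<in> {..<?k} then f i else g i"
    have "bij_betw ?p ({..<?k} \<union> - {..<?k}) (B \<union> - B)"
      using f g by (rule bij_betw_disjoint_Un) auto
    then have "bij ?p" unfolding Compl_partition .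
    moreover have "?p ` {..<?k} = B" using f by (simp add: bij_betw_def)
    ultimately show ?thesis using that by blast
  qed
  let ?\<rho> = "inv_into UNIV \<pi>"
  have inv: "bij ?\<rho>" "\<And>i. \<pi> (?\<rho> i) = i" "\<And>i. ?\<rho> (\<pi> i) = i"
    using \<pi>(1) by (simp_all add: bij_imp_bij_inv bij_is_surj surj_f_inv_f bij_is_inj)
  have "?\<rho> ` B = ?\<rho> ` \<pi> ` {..<?k}" by (simp only: \<pi>(2))
  also have "\<dots> = {..<?k}" unfolding image_image inv(3) by simp
  finally have inv': "?\<rho> ` B = {..<?k}" .
  have "relabel \<pi> ` ?V = proper_multilin B B \<inter> I"
  proof safe
    fix f assume "f \<in> proper_multilin {..<?k} {..<?k}" "f \<in> I"
    then show "relabel \<pi> f \<in> proper_multilin B B" "relabel \<pi> f \<in> I"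
      using relabel_proper_multilin [OF _ \<pi>(1), of f "{..<?k}" "{..<?k}", unfolded \<pi>(2)]
        endo [OF relabel_star_endo] by auto
  next
    fix f assume "f \<in> proper_multilin B B" "f \<in> I"
    then have "relabel ?\<rho> f \<in> ?V"
      using relabel_proper_multilin [OF _ inv(1), of f B B, unfolded inv']
        endo [OF relabel_star_endo] by auto
    moreover have "relabel \<pi> (relabel ?\<rho> f) = f"
      using inv(2) by (rule relabel_inverse)
    ultimately show "f \<in> relabel \<pi> ` ?V" by (metis image_eqI)
  qed
  moreover have "{f \<in> ?V. relabel \<pi> f = 0} = {0}"
  proof -
    have "f = 0" if "relabel \<pi> f = 0" for f :: "'k fpoly"
      using relabel_inverse [where \<pi> = ?\<rho> and \<rho> = \<pi> and f = f] inv(3) that by (simp add: relabel.zero)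
    moreover have "0 \<in> ?V"
      by (simp add: free.subspace_0 subspace subspace_proper_multilin)
    ultimately show ?thesis by (auto simp: relabel.zero)
  qed
  moreover have "free.dim ?V = free.dim {f \<in> ?V. relabel \<pi> f = 0} + free.dim (relabel \<pi> ` ?V)"
    using proper_multilin_fin [of "{..<?k}"]
    by (intro dim_kernel_image [OF relabel.linear, where S = "monom ` mwords {..<?k}"])
      (auto intro!: free.subspace_inter subspace_proper_multilin subspace)
  moreover have "free.dim {0 :: 'k fpoly} = 0"
    by (metis card.empty free.dim_eq_card_independent free.dim_span free.independent_empty free.span_empty)
  ultimately show ?thesis by (simp add: proper_dim_def)
qed

lemma dim_multilin:
  "free.dim (multilin {..<n} \<inter> I) = (\<Sum>k\<le>n. (n choose k) * proper_dim I k)"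
proof -
  have "free.dim (multilin {..<n} \<inter> I) =
      (\<Sum>B | B \<subseteq> {..<n}. free.dim (proper_multilin B B \<inter> I))"
    using dim_proper_multilin_sum [of "{..<n}" "{}"] by (simp add: proper_multilin_empty)
  also have "\<dots> = (\<Sum>B | B \<subseteq> {..<n}. proper_dim I (card B))"
    by (rule sum.cong) (auto intro!: dim_proper_multilin_card intro: finite_subset)
  also have "\<dots> = (\<Sum>k\<le>n. \<Sum>B | B \<in> {B. B \<subseteq> {..<n}} \<and> card B = k. proper_dim I (card B))"
    by (rule sum.group [symmetric]) (auto dest: card_mono [rotated])
  also have "\<dots> = (\<Sum>k\<le>n. (n choose k) * proper_dim I k)"
    by (rule sum.cong) (auto simp: n_subsets)
  finally show ?thesis .
qed

end

section \<open>The dimensions of the spaces of proper multilinear polynomials\<close>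

lemma card_mwords: "finite A \<Longrightarrow> card (mwords A) = fact (card A) * 2 ^ card A"
proof (induction "card A" arbitrary: A)
  case 0
  then have "mwords A = {[]}" by (auto simp: mwords_def)
  then show ?case using 0 by simp
next
  case (Suc n)
  let ?C = "\<lambda>a. (#) (Yv a) ` mwords (A - {a}) \<union> (#) (Zv a) ` mwords (A - {a})"
  have "mwords A = (\<Union>a\<in>A. ?C a)"
  proof (intro equalityI subsetI)
    fix w assume w: "w \<in> mwords A"
    have "A \<noteq> {}" using Suc by auto
    then obtain x v where xv: "w = x # v" using w by (cases w) (auto simp: mwords_def)
    then have "idx x \<in> A" "v \<in> mwords (A - {idx x})"
      using w by (auto simp: mwords_def, (metis imageI)+)
    then show "w \<in> (\<Union>a\<in>A. ?C a)" using xv by (cases x) auto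
  next
    fix w assume "w \<in> (\<Union>a\<in>A. ?C a)"
    then obtain a v x where "a \<in> A" "w = x # v" "idx x = a" "v \<in> mwords (A - {a})"
      by fastforce
    then show "w \<in> mwords A" unfolding mwords_def by auto
  qed
  also have "card \<dots> = (\<Sum>a\<in>A. card (?C a))"
    using Suc.prems by (intro card_UN_disjoint) (auto simp: finite_mwords)
  also have "\<dots> = (\<Sum>a\<in>A. 2 * (fact n * 2 ^ n))"
  proof (rule sum.cong)
    fix a assume a: "a \<in> A"
    have "card (mwords (A - {a})) = fact n * 2 ^ n"
    proof -
      have "card (A - {a}) = n" using Suc.hyps(2) Suc.prems a by simp
      then show ?thesis using Suc.hyps(1) [of "A - {a}"] Suc.prems by simp
    qed
    moreover have "card (?C a) = 2 * card (mwords (A - {a}))"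
      using Suc.prems by (subst card_Un_disjoint) (auto simp: finite_mwords card_image)
    ultimately show "card (?C a) = 2 * (fact n * 2 ^ n)" by simp
  qed simp
  finally show ?case using Suc.hyps(2) [symmetric] by (simp add: algebra_simps)
qed

lemma monom_eq_iff: "monom u = (monom v :: 'k::field fpoly) \<longleftrightarrow> u = v"
  by (metis coeff_monom zero_neq_one)

lemma independent_monom: "free.independent (monom ` S)"
  unfolding free.independent_explicit_module
proof (intro allI impI)
  fix F :: "'a fpoly set" and u v
  assume F: "finite F" "F \<subseteq> monom ` S" and s: "(\<Sum>v\<in>F. fscale (u v) v) = 0" and v: "v \<in> F"
  obtain w where w: "v = monom w" using F v by auto
  have "0 = coeff (\<Sum>v\<in>F. fscale (u v) v) w" using s by simp
  also have "\<dots> = (\<Sum>x\<in>F. if x = v then u v else 0)"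
    unfolding lookup_sum lookup_fscale
  proof (rule sum.cong [OF refl])
    fix x assume "x \<in> F"
    then obtain w' where "x = monom w'" using F by blast
    then show "u x * coeff x w = (if x = v then u v else 0)" using w by (auto simp: coeff_monom monom_eq_iff)
  qed
  finally show "u v = 0" using F v by simp
qed

lemma dim_multilin_card:
  assumes "finite A"
  shows "free.dim (multilin A :: 'k::field fpoly set) = fact (card A) * 2 ^ card A"
proof -
  have "inj_on monom (mwords A)"
    by (simp add: inj_on_def monom_eq_iff)
  then have "card (monom ` mwords A) = card (mwords A)" by (rule card_image)
  then show ?thesis
    unfolding multilin_def free.dim_span_eq_card_independent [OF independent_monom]
    by (simp add: card_mwords [OF assms])
qed

text \<open>
  For the unit ideal the formula reads \<open>n! * 2 ^ n = (\<Sum>k\<le>n. (n choose k) * g k)\<close>, which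
  determines the dimensions recursively.
\<close>

lemma proper_dim_UNIV:
  "proper_dim (UNIV :: 'k::field_char_0 fpoly set) 0 = 1"
  "proper_dim (UNIV :: 'k fpoly set) (Suc 0) = 1"
  "proper_dim (UNIV :: 'k fpoly set) 2 = 5"
  "proper_dim (UNIV :: 'k fpoly set) 3 = 29"
proof -
  let ?g = "proper_dim (UNIV :: 'k fpoly set)"
  have *: "fact n * 2 ^ n = (\<Sum>k\<le>n. (n choose k) * ?g k)" for n
  proof -
    have "free.dim (multilin {..<n} \<inter> (UNIV :: 'k fpoly set)) = (\<Sum>k\<le>n. (n choose k) * ?g k)"
      by (rule closed_ideal.dim_multilin [OF closed_ideal_UNIV])
    moreover have "free.dim (multilin {..<n} :: 'k fpoly set) = fact n * 2 ^ n"
      by (simp add: dim_multilin_card)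
    ultimately show ?thesis by simp
  qed
  show 0: "?g 0 = 1" using * [of 0] by simp
  show 1: "?g (Suc 0) = 1" using * [of 1] 0 by simp
  show 2: "?g 2 = 5" using * [of 2] 0 1 by (simp add: numeral_2_eq_2)
  show "?g 3 = 29" using * [of 3] 0 1 2
    by (simp add: numeral_3_eq_3 numeral_2_eq_2)
qed

section \<open>Proper polynomials are killed by substituting one\<close>

lemma Vstar_conv_multilin: "Vstar n = (multilin {..<n} :: 'k::field fpoly set)"
proof -
  let ?G = "{monom (map (\<lambda>i. v (\<sigma> i)) [0..<n]) :: 'k fpoly | \<sigma> v.
    \<sigma> permutes {..<n} \<and> (\<forall>i<n. v i \<in> {Yv i, Zv i})}"
  have "?G = monom ` mwords {..<n}"
  proof (intro equalityI subsetI)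
    fix p assume "p \<in> ?G"
    then obtain \<sigma> v where p: "p = monom (map (\<lambda>i. v (\<sigma> i)) [0..<n])"
      and \<sigma>: "\<sigma> permutes {..<n}" and v: "\<forall>i<n. v i \<in> {Yv i, Zv i}" by blast
    have "idx (v (\<sigma> i)) = \<sigma> i" if "i < n" for i
      using v permutes_in_image [OF \<sigma>, of i] that by fastforce
    then have m: "map idx (map (\<lambda>i. v (\<sigma> i)) [0..<n]) = map \<sigma> [0..<n]" by simp
    have "set (map \<sigma> [0..<n]) = {..<n}"
      using permutes_image [OF \<sigma>] by (simp add: atLeast0LessThan)
    moreover have "distinct (map \<sigma> [0..<n])"
      using permutes_inj_on [OF \<sigma>] by (simp add: distinct_map)
    ultimately have "map (\<lambda>i. v (\<sigma> i)) [0..<n] \<in> mwords {..<n}"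
      unfolding mwords_def by (metis (mono_tags, lifting) m mem_Collect_eq set_map)
    then show "p \<in> monom ` mwords {..<n}" using p by blast
  next
    fix p :: "'k fpoly" assume "p \<in> monom ` mwords {..<n}"
    then obtain w where w: "w \<in> mwords {..<n}" and p: "p = monom w" by blast
    have len: "length w = n" using length_mwords [OF w] by simp
    have dist: "distinct (map idx w)" and im: "idx ` set w = {..<n}" using w by (auto simp: mwords_def)
    define \<sigma> where "\<sigma> i = (if i < n then idx (w ! i) else i)" for i
    define v where "v j = (THE x. x \<in> set w \<and> idx x = j)" for j
    have inj: "x = y" if "x \<in> set w" "y \<in> set w" "idx x = idx y" for x y
      using dist that unfolding distinct_map inj_on_def by blast
    have v: "v (idx x) = x" if "x \<in> set w" for x
      unfolding v_def by (rule the_equality) (use that inj in blast)+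
    have "\<sigma> permutes {..<n}"
    proof (rule bij_imp_permutes)
      have "\<sigma> ` {..<n} = (\<lambda>i. idx (w ! i)) ` {..<n}" by (simp add: \<sigma>_def)
      also have "\<dots> = idx ` set w" using len by (auto simp: set_conv_nth)
      finally have "\<sigma> ` {..<n} = {..<n}" using im by simp
      then show "bij_betw \<sigma> {..<n} {..<n}"
        by (simp add: bij_betw_def finite_surj_inj)
    qed (simp add: \<sigma>_def)
    moreover have "v j \<in> {Yv j, Zv j}" if "j < n" for j
    proof -
      have "j \<in> idx ` set w" using that by (simp add: im)
      then obtain x where "x \<in> set w" "idx x = j" by blast
      then show ?thesis using v [of x] by (induction x) auto
    qed
    moreover have "w = map (\<lambda>i. v (\<sigma> i)) [0..<n]"
      by (rule nth_equalityI) (use len v in \<open>auto simp: \<sigma>_def\<close>)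
    ultimately show "p \<in> ?G" using p by blast
  qed
  then show ?thesis by (simp add: Vstar_def multilin_def)
qed

text \<open>
  The Taylor formula; it stops after the linear term because \<open>f\<close> has degree one in the index \<open>i\<close>.
\<close>

lemma fsubst_shift:
  assumes "f \<in> multilin A" "i \<in> A" and \<psi>: "\<psi> = \<phi>(Yv i := \<phi> (Yv i) + fscale c 1)"
  shows "fsubst \<psi> f = fsubst \<phi> f + fscale c (fsubst \<phi> (drop_var i (f :: 'k::field fpoly)))"
  using assms(1) unfolding multilin_def
proof (induction rule: free.span_induct_alt)
  case base
  show ?case by (simp add: fsubst.zero drop_var.zero)
next
  case (step d x y)
  from step(1) obtain w where w: "w \<in> mwords A" "x = monom w" by auto
  obtain u v l where uvl: "w = u @ l # v" "l = Yv i \<or> l = Zv i"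
    "i \<notin> idx ` set u" "i \<notin> idx ` set v"
    using mwords_split [OF w(1) assms(2)] by metis
  have same: "map \<psi> t = map \<phi> t" if "i \<notin> idx ` set t" for t
    using that by (force simp: \<psi>)
  have "fsubst \<psi> x = fsubst \<phi> x + fscale c (fsubst \<phi> (drop_var i x))"
    using uvl(2)
  proof
    assume "l = Yv i"
    then have "drop_var i x = monom (u @ v)" "fsubst \<psi> x =
        prod_list (map \<phi> u) * (\<phi> (Yv i) + fscale c 1) * prod_list (map \<phi> v)"
      using uvl(3,4) by (simp_all add: w(2) uvl(1) monom_append monom_Cons drop_var.mult
          drop_var_var drop_var_monom_free fsubst_monom fsubst.mult fsubst_var same)
        (simp_all add: \<psi> mult.assoc)
    then show ?thesis
      using \<open>l = Yv i\<close>
      by (simp add: w(2) uvl(1) fsubst_monom algebra_simps fscale_mult_left fscale_mult_right)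
  next
    assume "l = Zv i"
    then have "drop_var i x = 0"
      by (simp add: w(2) uvl(1) monom_append monom_Cons drop_var.mult drop_var_var)
    moreover have "fsubst \<psi> x = fsubst \<phi> x"
      using \<open>l = Zv i\<close> uvl(3,4) by (simp add: w(2) uvl(1) fsubst_monom same) (simp add: \<psi>)
    ultimately show ?thesis by (simp add: fsubst.zero)
  qed
  then show ?case
    using step(2)
    by (simp add: fsubst.hom_simps drop_var.hom_simps free.scale_right_distrib mult.commute)
qed

lemma fsubst_var_id: "fsubst var p = (p :: 'k::field fpoly)"
  by (subst (2) fpoly_expansion) (simp add: fsubst_def monom_conv_prod_list)

lemma comm_const: "comm p (fscale c 1) = 0" "comm (fscale c 1) p = (0 :: 'k::field fpoly)"
  by (simp_all add: comm_def fscale_mult_left fscale_mult_right)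

lemma comm_add: "comm (p + q) r = comm p r + comm q r" "comm p (q + r) = comm p q + comm p r"
  by (simp_all add: comm_def algebra_simps)

lemma proper_polys_shift:
  assumes "p \<in> proper_polys" "\<And>i. \<psi> (Zv i) = var (Zv i)" "\<And>x. \<exists>c. \<psi> x = var x + fscale c 1"
  shows "fsubst \<psi> p = (p :: 'k::field fpoly)"
  using assms(1) unfolding proper_polys_def
proof (induction rule: unital_subalgebra_gen.induct)
  case (gen p)
  have "fsubst \<psi> c = c" if "c \<in> iter_comms" for c
    using that
  proof (induction rule: iter_comms.induct)
    case (1 x y)
    obtain c d where "\<psi> x = var x + fscale c 1" "\<psi> y = var y + fscale d 1" using assms(3) by meson
    then show ?case by (simp add: fsubst.comm fsubst_var comm_add comm_const)
  next
    case (2 p x)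
    obtain c where "\<psi> x = var x + fscale c 1" using assms(3) by meson
    then show ?case using 2 by (simp add: fsubst.comm fsubst_var comm_add comm_const)
  qed
  then show ?case using gen assms(2) by (auto simp: fsubst_var)
qed (simp_all add: fsubst.hom_simps)

text \<open>
  Commutators ignore scalars, so a proper polynomial is invariant under the shift of a symmetric
  variable by one, and the Taylor formula then shows that its derivative vanishes.
\<close>

lemma Gam_subset_proper_multilin: "Gam n \<subseteq> (proper_multilin {..<n} {..<n} :: 'k::field fpoly set)"
proof
  fix f :: "'k fpoly" assume "f \<in> Gam n"
  then have f: "f \<in> proper_polys" "f \<in> multilin {..<n}" by (simp_all add: Gam_def Vstar_conv_multilin)
  have "drop_var i f = 0" if "i < n" for i
  proof -
    have "fsubst (var(Yv i := var (Yv i) + fscale 1 1)) f = f"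
      using f(1) by (rule proper_polys_shift) (auto intro: exI [of _ 0] exI [of _ 1])
    moreover have "fsubst (var(Yv i := var (Yv i) + fscale 1 1)) f =
        fsubst var f + fscale 1 (fsubst var (drop_var i f))"
      by (rule fsubst_shift [OF f(2)]) (use that in auto)
    ultimately show ?thesis by (simp add: fsubst_var_id)
  qed
  then show "f \<in> proper_multilin {..<n} {..<n}" using f(2) by (simp add: proper_multilin_def)
qed

text \<open>
  For a proper polynomial the derivative in the Taylor formula vanishes, so the constant terms of
  the substituted elements can be removed one index at a time.
\<close>

lemma fsubst_drop_constants:
  assumes f: "f \<in> proper_multilin A A" and "finite B" "B \<subseteq> A"
  shows "fsubst \<phi> (f :: 'k::field fpoly) =
    fsubst (\<lambda>x. if x \<in> Yv ` B then \<phi> x - fscale (coeff (\<phi> x) []) 1 else \<phi> x) f"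
  using assms(2,3)
proof (induction B)
  case (insert i B)
  let ?\<phi> = "\<lambda>B x. if x \<in> Yv ` B then \<phi> x - fscale (coeff (\<phi> x) []) 1 else \<phi> x"
  let ?c = "coeff (\<phi> (Yv i)) []"
  have "?\<phi> B = (?\<phi> (insert i B))(Yv i := ?\<phi> (insert i B) (Yv i) + fscale ?c 1)"
    using insert.hyps(2) by (intro ext) auto
  then have "fsubst (?\<phi> B) f = fsubst (?\<phi> (insert i B)) f +
      fscale ?c (fsubst (?\<phi> (insert i B)) (drop_var i f))"
    using f insert.prems by (intro fsubst_shift [of _ A]) (auto simp: proper_multilin_def)
  also have "drop_var i f = 0"
    using f insert.prems by (auto simp: proper_multilin_def)
  finally show ?case using insert.IH insert.prems by (simp add: fsubst.zero)
qed simp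

section \<open>Identities of an algebra with involution\<close>

lemma fpoly_induct [case_names zero step]:
  assumes "P 0" and "\<And>c w p. P p \<Longrightarrow> P (fscale c (monom w) + p)"
  shows "P (p :: 'k::field fpoly)"
proof -
  have "p \<in> free.span (range monom)"
    by (subst fpoly_expansion) (intro free.span_sum free.span_scale free.span_base rangeI)
  then show ?thesis
    by (induction rule: free.span_induct_alt) (use assms in auto)
qed

context star_algebra
begin

lemma scalar_ring_simps [simp]:
  "carrier (scalar_ring :: 'k ring) = UNIV" "a \<oplus>\<^bsub>scalar_ring\<^esub> b = a + (b :: 'k)"
  "a \<otimes>\<^bsub>scalar_ring\<^esub> b = a * (b :: 'k)" "\<one>\<^bsub>scalar_ring\<^esub> = (1 :: 'k)" "\<zero>\<^bsub>scalar_ring\<^esub> = (0 :: 'k)"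
  by (simp_all add: scalar_ring_def)

lemma ring_A: "ring A"
  using star_algebra_axioms by (simp add: star_algebra_def)

lemmas A_simps = ring.ring_simprules [OF ring_A]
lemmas A_abelian_monoid = abelian_group.axioms(1) [OF ring.is_abelian_group [OF ring_A]]

lemma smult_in_carrier [simp]: "x \<in> carrier A \<Longrightarrow> (c :: 'k) \<odot> x \<in> carrier A"
  by (rule smult_closed) simp_all

lemma smult_add_scalar: "x \<in> carrier A \<Longrightarrow> ((c :: 'k) + d) \<odot> x = c \<odot> x \<oplus> d \<odot> x"
  using smult_l_distr [of c d x] by simp

lemma smult_add_vector:
  "x \<in> carrier A \<Longrightarrow> y \<in> carrier A \<Longrightarrow> (c :: 'k) \<odot> (x \<oplus> y) = c \<odot> x \<oplus> c \<odot> y"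
  using smult_r_distr [of c x y] by simp

lemma smult_smult: "x \<in> carrier A \<Longrightarrow> (c * d :: 'k) \<odot> x = c \<odot> (d \<odot> x)"
  using smult_assoc1 [of c d x] by simp

lemma smult_1 [simp]: "x \<in> carrier A \<Longrightarrow> (1 :: 'k) \<odot> x = x"
  using smult_one [of x] by simp

lemma smult_0 [simp]: "x \<in> carrier A \<Longrightarrow> (0 :: 'k) \<odot> x = \<zero>"
  using smult_l_null [of x] by simp

lemma smult_zero_right [simp]: "(c :: 'k) \<odot> \<zero> = \<zero>"
  using smult_r_null [of c] by simp

lemma smult_minus_1: "x \<in> carrier A \<Longrightarrow> (- 1 :: 'k) \<odot> x = \<ominus> x"
  using smult_add_scalar [of x "- 1" 1]
  by (intro abelian_group.minus_equality [OF ring.is_abelian_group [OF ring_A], symmetric]) simp_all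

lemma smult_finsum:
  assumes "finite K" "g \<in> K \<rightarrow> carrier A"
  shows "(c :: 'k) \<odot> finsum A g K = (\<Oplus>x\<in>K. c \<odot> g x)"
  using assms
  by (induction K) (auto simp: smult_add_vector Pi_def abelian_monoid.finsum_empty [OF A_abelian_monoid]
      abelian_monoid.finsum_insert [OF A_abelian_monoid] abelian_monoid.finsum_closed [OF A_abelian_monoid])

lemma star_zero: "star \<zero> = \<zero>"
  using star_add [of \<zero> \<zero>] star_closed [of \<zero>] by (simp add: local.add.l_cancel_one)

lemma star_one: "star \<one> = \<one>"
  using star_mult [of "star \<one>" \<one>] star_closed [of \<one>] star_star [of \<one>] by simp

context
  fixes \<phi> :: "letter \<Rightarrow> 'a"
  assumes \<phi>: "\<And>x. \<phi> x \<in> carrier A"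
begin

lemma word_value_closed [simp]: "word_value A \<phi> w \<in> carrier A"
  by (induction w) (simp_all add: word_value_def \<phi>)

lemma word_value_append: "word_value A \<phi> (u @ v) = word_value A \<phi> u \<otimes> word_value A \<phi> v"
proof (induction u)
  case (Cons x u)
  then show ?case
    using word_value_closed [of u] word_value_closed [of v]
    by (simp add: word_value_def \<phi> A_simps)
qed (use word_value_closed [of v] in \<open>simp add: word_value_def\<close>)

lemma poly_value_superset:
  assumes "finite K" "Poly_Mapping.keys p \<subseteq> K"
  shows "poly_value A \<phi> p = (\<Oplus>w\<in>K. coeff p w \<odot> word_value A \<phi> w)"
  unfolding poly_value_def using assms
  unfolding finsum_def
  by (intro comm_monoid.finprod_mono_neutral_cong_left [OF abelian_monoid.a_comm_monoid]
      A_abelian_monoid) (auto simp: in_keys_iff)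

lemma poly_value_closed [simp]: "poly_value A \<phi> p \<in> carrier A"
  unfolding poly_value_def by (intro abelian_monoid.finsum_closed [OF A_abelian_monoid]) auto

lemma poly_value_zero [simp]: "poly_value A \<phi> 0 = \<zero>"
  by (simp add: poly_value_def)

lemma poly_value_add: "poly_value A \<phi> (p + q) = poly_value A \<phi> p \<oplus> poly_value A \<phi> q"
proof -
  let ?K = "Poly_Mapping.keys p \<union> Poly_Mapping.keys q"
  have "poly_value A \<phi> r = (\<Oplus>w\<in>?K. coeff r w \<odot> word_value A \<phi> w)" if "r \<in> {p, q, p + q}" for r
    by (rule poly_value_superset) (use that keys_add [of p q] in auto)
  then show ?thesis
    by (simp add: lookup_add smult_add_scalar abelian_monoid.finsum_addf [OF A_abelian_monoid])
qed

lemma poly_value_fscale: "poly_value A \<phi> (fscale c p) = c \<odot> poly_value A \<phi> p"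
proof -
  have "poly_value A \<phi> (fscale c p) =
      (\<Oplus>w\<in>Poly_Mapping.keys p. coeff (fscale c p) w \<odot> word_value A \<phi> w)"
    by (rule poly_value_superset) (auto simp: in_keys_iff lookup_fscale)
  also have "\<dots> = (\<Oplus>w\<in>Poly_Mapping.keys p. c \<odot> (coeff p w \<odot> word_value A \<phi> w))"
    by (intro abelian_monoid.finsum_cong' [OF A_abelian_monoid]) (auto simp: lookup_fscale smult_smult)
  finally show ?thesis by (simp add: poly_value_def smult_finsum)
qed

lemma poly_value_monom [simp]: "poly_value A \<phi> (monom w) = word_value A \<phi> w"
  by (simp add: poly_value_def monom_def)

lemma poly_value_mult: "poly_value A \<phi> (p * q) = poly_value A \<phi> p \<otimes> poly_value A \<phi> q"
proof (induction p rule: fpoly_induct)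
  case (step c u p)
  have "poly_value A \<phi> (monom u * q) = word_value A \<phi> u \<otimes> poly_value A \<phi> q"
  proof (induction q rule: fpoly_induct)
    case (step d v q)
    have "monom u * (fscale d (monom v) + q) = fscale d (monom (u @ v)) + monom u * q"
      by (simp add: algebra_simps fscale_mult_right monom_append)
    then show ?case
      using step by (simp add: poly_value_add poly_value_fscale word_value_append A_simps
          smult_mult_right)
  qed simp
  then show ?case
    using step by (simp add: distrib_right fscale_mult_left poly_value_add poly_value_fscale A_simps
        smult_mult_left)
qed simp

lemma poly_value_one: "poly_value A \<phi> 1 = \<one>"
  using poly_value_monom [of "[]"] by (simp add: monom_Nil word_value_def)

lemma poly_value_var: "poly_value A \<phi> (var x) = \<phi> x"
  using poly_value_monom [of "[x]"] \<phi> by (simp add: var_def word_value_def)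

lemma poly_value_minus: "poly_value A \<phi> (- p) = \<ominus> poly_value A \<phi> p"
proof -
  have "- p = fscale (- 1) p" by simp
  then show ?thesis by (metis poly_value_fscale poly_value_closed smult_minus_1)
qed

lemma poly_value_fstar:
  assumes "\<And>i. star (\<phi> (Yv i)) = \<phi> (Yv i)" "\<And>i. star (\<phi> (Zv i)) = \<ominus> \<phi> (Zv i)"
  shows "poly_value A \<phi> (fstar p) = star (poly_value A \<phi> p)"
proof (induction p rule: fpoly_induct)
  case zero
  show ?case by (simp add: fstar_zero star_zero)
next
  case (step c w p)
  have x: "poly_value A \<phi> (fstar (var x)) = star (\<phi> x)" for x
    by (cases x) (simp_all add: fstar_simps poly_value_var poly_value_minus assms)
  have "poly_value A \<phi> (fstar (monom w)) = star (word_value A \<phi> w)"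
  proof (induction w)
    case (Cons x w)
    have "word_value A \<phi> (x # w) = \<phi> x \<otimes> word_value A \<phi> w" by (simp add: word_value_def)
    then show ?case using Cons by (simp add: monom_Cons fstar_mult poly_value_mult x star_mult \<phi>)
  qed (simp add: monom_Nil fstar_one poly_value_one word_value_def star_one)
  then show ?case
    using step by (simp add: fstar_simps poly_value_add poly_value_fscale star_add star_smult)
qed

end

lemma poly_value_hom:
  assumes "falg_hom h" and \<phi>: "\<And>x. \<phi> x \<in> carrier A"
  shows "poly_value A \<phi> (h p) = poly_value A (\<lambda>x. poly_value A \<phi> (h (var x))) p"
proof (induction p rule: fpoly_induct)
  case zero
  show ?case by (simp add: \<phi> falg_hom.zero [OF assms(1)] poly_value_zero)
next
  case (step c w p)
  interpret h: falg_hom h by fact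
  let ?\<psi> = "\<lambda>x. poly_value A \<phi> (h (var x))"
  have \<psi>: "?\<psi> x \<in> carrier A" for x using \<phi> by (rule poly_value_closed)
  have "poly_value A \<phi> (h (monom w)) = word_value A ?\<psi> w"
    by (induction w) (simp_all add: \<phi> word_value_def monom_Nil monom_Cons h.one h.mult
        poly_value_one poly_value_mult)
  then show ?case
    using step
    by (simp add: \<phi> \<psi> h.add h.scale poly_value_add poly_value_fscale poly_value_monom)
qed

lemma Id_starI:
  assumes "\<And>\<phi>. (\<And>x. \<phi> x \<in> carrier A) \<Longrightarrow> (\<And>i. star (\<phi> (Yv i)) = \<phi> (Yv i)) \<Longrightarrow>
    (\<And>i. star (\<phi> (Zv i)) = \<ominus> \<phi> (Zv i)) \<Longrightarrow> poly_value A \<phi> f = \<zero>"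
  shows "f \<in> Id_star A star"
  unfolding Id_star_def
proof (intro CollectI allI impI, elim conjE)
  fix \<phi> assume Y: "\<forall>i. \<phi> (Yv i) \<in> sym_part A star" and Z: "\<forall>i. \<phi> (Zv i) \<in> skew_part A star"
  have "\<phi> x \<in> carrier A" for x
    by (cases x) (use Y Z in \<open>auto simp: sym_part_def skew_part_def\<close>)
  then show "poly_value A \<phi> f = \<zero>"
    using Y Z by (intro assms) (auto simp: sym_part_def skew_part_def)
qed

lemma Id_starD:
  assumes "f \<in> Id_star A star" "\<And>x. \<phi> x \<in> carrier A" "\<And>i. star (\<phi> (Yv i)) = \<phi> (Yv i)"
    "\<And>i. star (\<phi> (Zv i)) = \<ominus> \<phi> (Zv i)"
  shows "poly_value A \<phi> f = \<zero>"
  using assms unfolding Id_star_def sym_part_def skew_part_def by blast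

text \<open>
  An endomorphism that commutes with the involution, followed by an evaluation at symmetric and
  skew elements, is again such an evaluation.
\<close>

lemma closed_ideal_Id_star: "closed_ideal (Id_star A star)"
proof
  show "fstar f \<in> Id_star A star" if "f \<in> Id_star A star" for f
    by (rule Id_starI) (simp add: poly_value_fstar Id_starD [OF that] star_zero)
  show "Tstar_ideal (Id_star A star)"
    unfolding Tstar_ideal_def
  proof (intro conjI ballI allI impI subsetI)
    show "free.subspace (Id_star A star)"
      unfolding free.subspace_def
      by (auto intro!: Id_starI simp: poly_value_zero poly_value_add poly_value_fscale Id_starD)
  next
    fix f p assume "f \<in> Id_star A star"
    then show "p * f \<in> Id_star A star" "f * p \<in> Id_star A star"
      by (auto intro!: Id_starI simp: poly_value_mult Id_starD)
  next
    fix h :: "'k fpoly \<Rightarrow> 'k fpoly" and g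
    assume h: "star_endo h" and "g \<in> h ` Id_star A star"
    then obtain f where f: "f \<in> Id_star A star" "g = h f" by blast
    show "g \<in> Id_star A star"
      unfolding f(2)
    proof (rule Id_starI)
      fix \<phi> assume \<phi>: "\<And>x. \<phi> x \<in> carrier A" "\<And>i. star (\<phi> (Yv i)) = \<phi> (Yv i)"
        "\<And>i. star (\<phi> (Zv i)) = \<ominus> \<phi> (Zv i)"
      have "poly_value A (\<lambda>x. poly_value A \<phi> (h (var x))) f = \<zero>"
      proof (rule Id_starD [OF f(1)])
        show "star (poly_value A \<phi> (h (var (Yv i)))) = poly_value A \<phi> (h (var (Yv i)))" for i
        proof -
          have "star (poly_value A \<phi> (h (var (Yv i)))) = poly_value A \<phi> (fstar (h (var (Yv i))))"
            by (rule poly_value_fstar [OF \<phi>, symmetric])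
          then show ?thesis unfolding star_endo_image_Yv [OF h] .
        qed
        show "star (poly_value A \<phi> (h (var (Zv i)))) = \<ominus> poly_value A \<phi> (h (var (Zv i)))" for i
        proof -
          have "star (poly_value A \<phi> (h (var (Zv i)))) = poly_value A \<phi> (fstar (h (var (Zv i))))"
            by (rule poly_value_fstar [OF \<phi>, symmetric])
          also have "\<dots> = \<ominus> poly_value A \<phi> (h (var (Zv i)))"
            unfolding star_endo_image_Zv [OF h] by (rule poly_value_minus [OF \<phi>(1)])
          finally show ?thesis .
        qed
      qed (simp add: \<phi>(1))
      then show "poly_value A \<phi> (h f) = \<zero>"
        by (subst poly_value_hom [OF star_endo_hom [OF h] \<phi>(1)])
    qed
  qed
qed

end

definition proper_codim :: "'k::field_char_0 fpoly set \<Rightarrow> nat \<Rightarrow> nat"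
  where "proper_codim I k = proper_dim (UNIV :: 'k fpoly set) k - proper_dim I k"

lemma (in closed_ideal) proper_dim_le: "proper_dim I k \<le> proper_dim (UNIV :: 'k fpoly set) k"
  unfolding proper_dim_def
  using proper_multilin_fin [of "{..<k}"]
  by (intro dim_subspace_mono [where S = "monom ` mwords {..<k}"])
    (auto intro!: free.subspace_inter subspace_proper_multilin subspace)

text \<open>
  The dimension formula for \<open>I\<close> subtracted from the one for the unit ideal.
\<close>

theorem (in closed_ideal) quot_dim_proper_codim:
  "quot_dim (Vstar n) (Vstar n \<inter> I) = (\<Sum>k\<le>n. (n choose k) * proper_codim I k)"
proof -
  have "quot_dim (Vstar n) (Vstar n \<inter> I) = free.dim (Vstar n :: 'k fpoly set) - free.dim (Vstar n \<inter> I)"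
    unfolding Vstar_conv_multilin using multilin_fin [of "{..<n}"]
    by (intro quot_dim_eq [where S = "monom ` mwords {..<n}"])
      (auto intro!: free.subspace_inter subspace_multilin subspace)
  moreover have "free.dim (Vstar n \<inter> I) = (\<Sum>k\<le>n. (n choose k) * proper_dim I k)"
    by (simp add: Vstar_conv_multilin dim_multilin)
  moreover have "free.dim (Vstar n :: 'k fpoly set) =
      (\<Sum>k\<le>n. (n choose k) * proper_dim (UNIV :: 'k fpoly set) k)"
    using closed_ideal.dim_multilin [OF closed_ideal_UNIV, of n] by (simp add: Vstar_conv_multilin)
  moreover have "(\<Sum>k\<le>n. (n choose k) * proper_codim I k) + (\<Sum>k\<le>n. (n choose k) * proper_dim I k) =
      (\<Sum>k\<le>n. (n choose k) * proper_dim (UNIV :: 'k fpoly set) k)"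
    using proper_dim_le
    by (simp add: proper_codim_def sum.distrib [symmetric] distrib_left [symmetric])
  ultimately show ?thesis by simp
qed

section \<open>Counting with a separated family\<close>

text \<open>
  A simultaneous form of linear independence modulo all closed ideals, the zero ideal included. It
  holds for generators of pairwise non-isomorphic irreducible components, since projections onto
  the components are built from operations that preserve every closed ideal.
\<close>

definition separated :: "'i set \<Rightarrow> ('i \<Rightarrow> 'k::field_char_0 fpoly) \<Rightarrow> bool"
  where "separated K e \<longleftrightarrow> (\<forall>J c. closed_ideal J \<longrightarrow> (\<Sum>k\<in>K. fscale (c k) (e k)) \<in> J \<longrightarrow>
    (\<forall>k\<in>K. fscale (c k) (e k) \<in> J))"

lemma separatedD:
  "separated K e \<Longrightarrow> closed_ideal J \<Longrightarrow> (\<Sum>k\<in>K. fscale (c k) (e k)) \<in> J \<Longrightarrow> k \<in> K \<Longrightarrow>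
    fscale (c k) (e k) \<in> J"
  unfolding separated_def by blast

lemma separated_inj_on:
  assumes "finite K" "separated K e" "\<And>k. k \<in> K \<Longrightarrow> e k \<noteq> 0"
  shows "inj_on e K"
proof (rule inj_onI, rule ccontr)
  fix k l assume kl: "k \<in> K" "l \<in> K" "e k = e l" "k \<noteq> l"
  let ?c = "\<lambda>i. if i = k then 1 else if i = l then - 1 else 0"
  have "(\<Sum>i\<in>K. fscale (?c i) (e i)) = (\<Sum>i\<in>{k, l}. fscale (?c i) (e i))"
    by (rule sum.mono_neutral_right) (use assms(1) kl in auto)
  then have "(\<Sum>i\<in>K. fscale (?c i) (e i)) \<in> {0}" using kl by simp
  then have "fscale (?c k) (e k) \<in> {0}"
    by (rule separatedD [OF assms(2) closed_ideal_zero _ kl(1)])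
  then show False using assms(3) kl by simp
qed

lemma separated_independent:
  assumes "finite K" "separated K e" "\<And>k. k \<in> K \<Longrightarrow> e k \<noteq> 0"
  shows "free.independent (e ` K)"
  unfolding free.independent_explicit_finite_subsets
proof (intro allI impI ballI)
  fix S u v
  assume S: "S \<subseteq> e ` K" "finite S" "(\<Sum>v\<in>S. fscale (u v) v) = 0" "v \<in> S"
  note inj = separated_inj_on [OF assms]
  let ?L = "{k \<in> K. e k \<in> S}"
  have "inj_on e ?L" using inj by (rule inj_on_subset) auto
  moreover have "e ` ?L = S" using S(1) by auto
  ultimately have "(\<Sum>v\<in>S. fscale (u v) v) = (\<Sum>k\<in>?L. fscale (u (e k)) (e k))"
    by (subst sum.reindex_cong [of e ?L]) simp_all
  also have "\<dots> = (\<Sum>k\<in>K. fscale (if e k \<in> S then u (e k) else 0) (e k))"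
    using assms(1) by (intro sum.mono_neutral_cong_left) auto
  finally have "(\<Sum>k\<in>K. fscale (if e k \<in> S then u (e k) else 0) (e k)) \<in> {0}"
    using S(3) by simp
  moreover obtain k where k: "k \<in> K" "v = e k" using S(1,4) by blast
  ultimately have "fscale (if e k \<in> S then u (e k) else 0) (e k) \<in> {0}"
    using separatedD [OF assms(2) closed_ideal_zero, of "\<lambda>k. if e k \<in> S then u (e k) else 0"] by blast
  then show "u v = 0" using assms(3) S(4) k by simp
qed

text \<open>
  A separated family of non-zero elements is independent (take the zero ideal), so if it has the
  right number of members it is a basis.
\<close>

lemma separated_span:
  assumes K: "finite K" "separated K e" "\<And>k. k \<in> K \<Longrightarrow> e k \<noteq> (0 :: 'k::field_char_0 fpoly)"
    and P: "e ` K \<subseteq> proper_multilin {..<n} {..<n}" "card K = proper_dim (UNIV :: 'k fpoly set) n"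
  shows "free.span (e ` K) = proper_multilin {..<n} {..<n}"
proof (rule dim_subspace_eq [where S = "monom ` mwords {..<n}"])
  show "free.span (e ` K) \<subseteq> proper_multilin {..<n} {..<n}"
    using P(1) subspace_proper_multilin by (rule free.span_minimal)
  show "free.dim (free.span (e ` K)) = free.dim (proper_multilin {..<n} {..<n} :: 'k fpoly set)"
    using P(2) card_image [OF separated_inj_on [OF K]]
    by (simp add: free.dim_span_eq_card_independent [OF separated_independent [OF K]]
        proper_dim_def del: free.dim_span)
qed (use proper_multilin_fin [of "{..<n}"] in \<open>auto simp: subspace_proper_multilin\<close>)

text \<open>
  By separation, the part of the space inside \<open>I\<close> is spanned by the members of the basis that
  lie in \<open>I\<close>.
\<close>

lemma separated_proper_codim:
  assumes K: "finite K" "separated K e" "\<And>k. k \<in> K \<Longrightarrow> e k \<noteq> (0 :: 'k::field_char_0 fpoly)"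
    and P: "e ` K \<subseteq> proper_multilin {..<n} {..<n}" "card K = proper_dim (UNIV :: 'k fpoly set) n"
    and I: "closed_ideal I"
  shows "proper_codim I n = card {k \<in> K. e k \<notin> I}"
proof -
  interpret closed_ideal I by fact
  let ?L = "{k \<in> K. e k \<in> I}"
  note span = separated_span [OF K P] and inj = separated_inj_on [OF K]
  have "proper_multilin {..<n} {..<n} \<inter> I = free.span (e ` ?L)"
  proof (intro equalityI subsetI)
    fix f assume f: "f \<in> proper_multilin {..<n} {..<n} \<inter> I"
    then have "f \<in> free.span (e ` K)" using span by blast
    then obtain u where "f = (\<Sum>v\<in>e ` K. fscale (u v) v)"
      using free.span_finite [of "e ` K"] K(1) by auto
    also have "\<dots> = (\<Sum>k\<in>K. fscale (u (e k)) (e k))"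
      using inj by (simp add: sum.reindex)
    finally have fe: "f = (\<Sum>k\<in>K. fscale (u (e k)) (e k))" .
    then have "fscale (u (e k)) (e k) \<in> I" if "k \<in> K" for k
      using separatedD [OF K(2) I, of "\<lambda>k. u (e k)"] f that by auto
    then have "fscale (u (e k)) (e k) \<in> free.span (e ` ?L)" if "k \<in> K" for k
    proof (cases "u (e k) = 0")
      case False
      then have "e k \<in> e ` ?L" using that \<open>k \<in> K \<Longrightarrow> fscale (u (e k)) (e k) \<in> I\<close> scale_iff by blast
      then show ?thesis by (intro free.span_scale free.span_base)
    qed (simp add: free.span_zero)
    then show "f \<in> free.span (e ` ?L)" unfolding fe by (rule free.span_sum)
  next
    have "free.span (e ` ?L) \<subseteq> I" using subspace by (intro free.span_minimal) auto
    moreover have "free.span (e ` ?L) \<subseteq> free.span (e ` K)" by (rule free.span_mono) auto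
    ultimately show "f \<in> proper_multilin {..<n} {..<n} \<inter> I" if "f \<in> free.span (e ` ?L)" for f
      using that span by blast
  qed
  moreover have "free.independent (e ` ?L)"
    using separated_independent [OF K] by (rule free.independent_mono) auto
  moreover have "card (e ` ?L) = card ?L"
    using inj by (intro card_image) (auto intro: inj_on_subset)
  ultimately have "proper_dim I n = card ?L"
    by (simp add: proper_dim_def free.dim_span_eq_card_independent del: free.dim_span)
  moreover have "card K = card ?L + card {k \<in> K. e k \<notin> I}"
    using K(1) by (subst card_Un_disjoint [symmetric]) (auto intro: arg_cong [where f = card])
  ultimately show ?thesis using P(2) by (simp add: proper_codim_def)
qed

context closed_ideal
begin

text \<open>
  The endomorphism \<open>h\<close> splits off the last summand, and the involution tells the first two apart.
\<close>

lemma separate_3: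
  assumes f: "fscale a p + fscale b q + fscale c r \<in> I" and h: "star_endo h"
    and "h p = - p" "h q = - q" "h r = r" "fstar p = p" "fstar q = - q"
  shows "fscale a p \<in> I \<and> fscale b q \<in> I \<and> fscale c r \<in> I"
proof -
  interpret h: falg_hom h using h by (rule star_endo_hom)
  have "- h (fscale a p + fscale b q + fscale c r) \<in> I" using endo [OF h f] by (rule minus)
  then have "(fscale a p + fscale b q) - fscale c r \<in> I"
    using assms(3-5) by (simp add: h.add h.scale algebra_simps)
  then have *: "fscale a p + fscale b q \<in> I \<and> fscale c r \<in> I" using f by (intro split)
  then have "fstar (fscale a p + fscale b q) \<in> I" by (intro star) simp
  then have "fscale a p - fscale b q \<in> I" using assms(6,7) by (simp add: fstar_simps)
  then show ?thesis using * split by blast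
qed

lemma separate_4:
  assumes f: "fscale a p + fscale b q + fscale c r + fscale d s \<in> I" and h: "star_endo h"
    and "h p = p" "h q = - q" "h r = - r" "h s = s"
    and "fstar p = - p" "fstar q = q" "fstar r = - r" "fstar s = s"
  shows "fscale a p \<in> I \<and> fscale b q \<in> I \<and> fscale c r \<in> I \<and> fscale d s \<in> I"
proof -
  interpret h: falg_hom h using h by (rule star_endo_hom)
  have "h (fscale a p + fscale b q + fscale c r + fscale d s) \<in> I" using endo [OF h f] .
  then have "(fscale a p + fscale d s) - (fscale b q + fscale c r) \<in> I"
    using assms(3-6) by (simp add: h.add h.scale algebra_simps)
  moreover have "(fscale a p + fscale d s) + (fscale b q + fscale c r) \<in> I"
    using f by (simp add: algebra_simps)
  ultimately have *: "fscale a p + fscale d s \<in> I \<and> fscale b q + fscale c r \<in> I"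
    by (intro split)
  then have "- fstar (fscale a p + fscale d s) \<in> I" "fstar (fscale b q + fscale c r) \<in> I"
    by (auto intro!: star minus)
  then have "fscale a p - fscale d s \<in> I" "fscale b q - fscale c r \<in> I"
    using assms(7-10) by (simp_all add: fstar_simps)
  then show ?thesis using * split by blast
qed

text \<open>
  Summing over the powers of the rotation \<open>h\<close> triples \<open>p\<close> and kills \<open>q\<close> and \<open>r\<close>.
\<close>

lemma separate_fixed:
  assumes f: "fscale a p + (fscale b q + fscale c r) \<in> I" and h: "star_endo h"
    and "h p = p" "h q = r" "h r = - q - r"
  shows "fscale a p \<in> I \<and> fscale b q + fscale c r \<in> I"
proof -
  interpret h: falg_hom h using h by (rule star_endo_hom)
  let ?f = "fscale a p + (fscale b q + fscale c r)"
  have "?f + h ?f + h (h ?f) \<in> I"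
    by (rule add [OF add [OF f endo [OF h f]] endo [OF h endo [OF h f]]])
  moreover have "?f + h ?f + h (h ?f) = fscale 3 (fscale a p)"
    by (rule poly_mapping_eqI)
      (simp add: h.add h.scale h.minus h.diff assms(3-5) coeff_simps algebra_simps)
  ultimately have "fscale 3 (fscale a p) \<in> I" by simp
  then have "fscale a p \<in> I" using scale_iff [of 3 "fscale a p"] by simp
  then show ?thesis using diff [OF f] by fastforce
qed

text \<open>
  Here \<open>q\<close> and \<open>r\<close> span the two-dimensional irreducible representation of the symmetric group of
  degree three, up to a sign: \<open>h\<close> is a rotation and \<open>t\<close> a transposition. By irreducibility any
  non-zero combination in the ideal brings both vectors along.
\<close>

lemma separate_standard:
  assumes f: "fscale b q + fscale c r \<in> I" and h: "star_endo h" and t: "star_endo t"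
    and hq: "h q = r" "h r = - q - r"
    and tq: "t q = fscale e r" "t r = fscale e q" "e = 1 \<or> e = - 1"
  shows "fscale b q \<in> I \<and> fscale c r \<in> I"
proof -
  interpret h: falg_hom h using h by (rule star_endo_hom)
  interpret t: falg_hom t using t by (rule star_endo_hom)
  have "fscale e (t (fscale b q + fscale c r)) \<in> I" using endo [OF t f] by (rule scale)
  moreover have "fscale e (t (fscale b q + fscale c r)) = fscale b r + fscale c q"
    using tq by (auto simp: t.add t.scale)
  ultimately have s: "fscale b r + fscale c q \<in> I" by simp
  show ?thesis
  proof (cases "b = c")
    case True
    have "h (h (fscale b q + fscale c r)) \<in> I" "h (fscale b q + fscale c r) \<in> I"
      using endo [OF h] f by blast+
    moreover have "h (h (fscale b q + fscale c r)) = - fscale b r"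
      "h (fscale b q + fscale c r) = - fscale b q"
      by (rule poly_mapping_eqI,
          simp add: True hq h.add h.scale h.minus h.diff coeff_simps algebra_simps)+
    ultimately show ?thesis using True by (simp add: minus_iff)
  next
    case False
    have "(fscale b q + fscale c r) - (fscale b r + fscale c q) = fscale (b - c) (q - r)"
      by (rule poly_mapping_eqI) (simp add: coeff_simps algebra_simps)
    then have qr: "q - r \<in> I" using diff [OF f s] False by (simp add: scale_iff)
    have "h (q - r) \<in> I" using endo [OF h qr] .
    then have "h (q - r) - (q - r) \<in> I" using qr by (rule diff)
    moreover have "h (q - r) - (q - r) = fscale 3 r"
      by (rule poly_mapping_eqI) (simp add: hq h.diff coeff_simps algebra_simps)
    ultimately have "r \<in> I" by (simp add: scale_iff)
    moreover from this have "q \<in> I" using add [OF qr, of r] by simp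
    ultimately show ?thesis by (simp add: scale)
  qed
qed

end

section \<open>Generators of the irreducible components in degrees two and three\<close>

abbreviation y :: "nat \<Rightarrow> 'k::field fpoly" where "y i \<equiv> var (Yv i)"
abbreviation z :: "nat \<Rightarrow> 'k::field fpoly" where "z i \<equiv> var (Zv i)"

definition jord :: "'k::field fpoly \<Rightarrow> 'k fpoly \<Rightarrow> 'k fpoly"
  where "jord p q = p * q + q * p"

lemma (in falg_hom) jord: "h (jord p q) = jord (h p) (h q)"
  by (simp add: jord_def add mult)

lemma fstar_jord: "fstar (jord p q) = jord (fstar p) (fstar q)"
  by (simp add: jord_def fstar_add fstar_mult add.commute)

text \<open>
  The irreducible components of the proper multilinear polynomials of degrees two and three under
  the hyperoctahedral group together with the involution. Within each degree they are pairwise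
  non-isomorphic. The letters of a name tell the kinds of the variables; \<open>deg2\<close> and \<open>deg3\<close> are the
  dimensions of the components, and a basis of a component consists of the rotations of its
  generator by fewer steps than its dimension.
\<close>

datatype irr2 = YY | YZ | ZZ_plus | ZZ_minus

fun gen2 :: "irr2 \<Rightarrow> 'k::field fpoly" where
  "gen2 YY = comm (y 0) (y 1)"
| "gen2 YZ = comm (y 0) (z 1)"
| "gen2 ZZ_plus = jord (z 0) (z 1)"
| "gen2 ZZ_minus = comm (z 0) (z 1)"

fun deg2 :: "irr2 \<Rightarrow> nat" where
  "deg2 YZ = 2" | "deg2 _ = 1"

datatype irr3 = YYY | YYZ1 | YYZ2 | YYZ3 | YZZ1 | YZZ2 | YZZ3 | YZZ4
  | ZZZ_sym | ZZZ_alt | ZZZ_plus | ZZZ_minus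

fun gen3 :: "irr3 \<Rightarrow> 'k::field fpoly" where
  "gen3 YYY = comm (comm (y 1) (y 2)) (y 0)"
| "gen3 YYZ1 = jord (comm (y 1) (y 2)) (z 0)"
| "gen3 YYZ2 = comm (comm (y 1) (y 2)) (z 0)"
| "gen3 YYZ3 = comm (comm (y 1) (z 0)) (y 2) + comm (comm (y 2) (z 0)) (y 1)"
| "gen3 YZZ1 = jord (comm (y 0) (z 1)) (z 2) + jord (comm (y 0) (z 2)) (z 1)"
| "gen3 YZZ2 = comm (comm (y 0) (z 1)) (z 2) - comm (comm (y 0) (z 2)) (z 1)"
| "gen3 YZZ3 = jord (comm (y 0) (z 1)) (z 2) - jord (comm (y 0) (z 2)) (z 1)"
| "gen3 YZZ4 = comm (comm (y 0) (z 1)) (z 2) + comm (comm (y 0) (z 2)) (z 1)"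
| "gen3 ZZZ_sym = jord (z 0) (z 1) * z 2 + jord (z 1) (z 2) * z 0 + jord (z 2) (z 0) * z 1"
| "gen3 ZZZ_alt = comm (z 0) (z 1) * z 2 + comm (z 1) (z 2) * z 0 + comm (z 2) (z 0) * z 1"
| "gen3 ZZZ_plus = comm (jord (z 1) (z 2)) (z 0)"
| "gen3 ZZZ_minus = comm (comm (z 1) (z 2)) (z 0)"

fun deg3 :: "irr3 \<Rightarrow> nat" where
  "deg3 YYY = 2" | "deg3 ZZZ_sym = 1" | "deg3 ZZZ_alt = 1" | "deg3 ZZZ_plus = 2"
| "deg3 ZZZ_minus = 2" | "deg3 _ = 3"

definition rot :: "nat \<Rightarrow> nat \<Rightarrow> 'k::field fpoly \<Rightarrow> 'k fpoly"
  where "rot n r = relabel (\<lambda>i. (i + r) mod n)"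

lemma rot_star_endo: "star_endo (rot n r)"
  by (simp add: rot_def relabel_star_endo)

interpretation rot: falg_hom "rot n r" for n r
  by (rule star_endo_hom [OF rot_star_endo])

lemma rot_Yv: "rot n r (y i) = y ((i + r) mod n)"
  and rot_Zv: "rot n r (z i) = z ((i + r) mod n)"
  by (simp_all add: rot_def relabel_Yv relabel_Zv)

lemma rot_rot: "rot n s (rot n r p) = rot n (r + s) p"
proof -
  have "rot n s (rot n r (var x)) = rot n (r + s) (var x)" for x
    by (cases x) (simp_all add: rot_Yv rot_Zv mod_add_left_eq add.assoc)
  then have "(\<lambda>p. rot n s (rot n r p)) = rot n (r + s)"
    by (intro falg_hom_ext) (unfold_locales, auto simp: rot.hom_simps)
  then show ?thesis by metis
qed

lemmas rot_simps = rot.hom_simps rot.jord rot_Yv rot_Zv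
lemmas relabel_simps = relabel.hom_simps relabel.jord relabel_Yv relabel_Zv

definition elem :: "nat \<Rightarrow> ('b \<Rightarrow> 'k::field fpoly) \<Rightarrow> 'b \<times> nat \<Rightarrow> 'k fpoly"
  where "elem n g = (\<lambda>(b, r). rot n r (g b))"

definition index :: "('b \<Rightarrow> nat) \<Rightarrow> ('b \<times> nat) set"
  where "index d = (SIGMA b:UNIV. {..<d b})"

lemma UNIV_irr2: "UNIV = {YY, YZ, ZZ_plus, ZZ_minus}"
  by (auto intro: irr2.exhaust)

lemma UNIV_irr3: "UNIV = {YYY, YYZ1, YYZ2, YYZ3, YZZ1, YZZ2, YZZ3, YZZ4,
    ZZZ_sym, ZZZ_alt, ZZZ_plus, ZZZ_minus}"
  by (auto intro: irr3.exhaust)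

lemma finite_irr2 [simp]: "finite (A :: irr2 set)"
  by (rule finite_subset [OF subset_UNIV]) (simp add: UNIV_irr2)

lemma finite_irr3 [simp]: "finite (A :: irr3 set)"
  by (rule finite_subset [OF subset_UNIV]) (simp add: UNIV_irr3)

text \<open>
  A rotation by \<open>n - r\<close> steps undoes a rotation by \<open>r\<close> steps.
\<close>

lemma elem_ideal_iff:
  assumes "closed_ideal I" "rot n n (g b) = g b" "r < n"
  shows "elem n g (b, r) \<in> I \<longleftrightarrow> g b \<in> I"
proof -
  interpret closed_ideal I by fact
  have "rot n (n - r) (elem n g (b, r)) = g b"
    using assms(2,3) by (simp add: elem_def rot_rot)
  then show ?thesis
    using endo [OF rot_star_endo, of "elem n g (b, r)" n "n - r"] endo [OF rot_star_endo, of "g b" n r]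
    by (auto simp: elem_def)
qed

lemma gen2_rot_full: "rot 2 2 (gen2 b) = gen2 b"
  by (cases b) (simp_all add: rot_simps)

lemma gen3_rot_full: "rot 3 3 (gen3 b) = gen3 b"
  by (cases b) (simp_all add: rot_simps)

text \<open>The bilinear form for which the words are orthonormal.\<close>

definition pairing :: "'k::field fpoly \<Rightarrow> 'k fpoly \<Rightarrow> 'k"
  where "pairing g f = (\<Sum>w\<in>Poly_Mapping.keys g. coeff g w * coeff f w)"

lemma pairing_superset:
  assumes "finite K" "Poly_Mapping.keys g \<subseteq> K"
  shows "pairing g f = (\<Sum>w\<in>K. coeff g w * coeff f w)"
  unfolding pairing_def
  by (rule sum.mono_neutral_left) (use assms in \<open>auto simp: in_keys_iff\<close>)

lemma pairing_monom: "pairing (monom w) f = coeff f w"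
  by (simp add: pairing_def monom_def)

lemma pairing_add: "pairing (g + h) f = pairing g f + pairing h f"
proof -
  let ?K = "Poly_Mapping.keys g \<union> Poly_Mapping.keys h"
  have "pairing r f = (\<Sum>w\<in>?K. coeff r w * coeff f w)" if "r \<in> {g, h, g + h}" for r
    by (rule pairing_superset) (use that keys_add [of g h] in auto)
  then show ?thesis by (simp add: lookup_add distrib_right sum.distrib)
qed

lemma pairing_minus: "pairing (- g) f = - pairing g f"
  by (simp add: pairing_def sum_negf)

lemma pairing_diff: "pairing (g - h) f = pairing g f - pairing h f"
  using pairing_add [of g "- h" f] by (simp add: pairing_minus)

lemma pairing_right:
  "pairing g (p + q) = pairing g p + pairing g q"
  "pairing g (fscale c p) = c * pairing g p" "pairing g 0 = 0"
  by (simp_all add: pairing_def lookup_add lookup_fscale distrib_left sum.distrib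
      sum_distrib_left ac_simps)

lemmas expand_words = comm_def jord_def var_def algebra_simps monom_append [symmetric]

lemmas pairing_words = pairing_add pairing_diff pairing_minus pairing_monom

lemma pairing_gen2: "pairing (gen2 b) (gen2 b) \<noteq> (0 :: 'k::field_char_0)"
  by (cases b) (simp_all add: expand_words pairing_words coeff_simps coeff_monom)

lemma pairing_gen3: "pairing (gen3 b) (gen3 b) \<noteq> (0 :: 'k::field_char_0)"
  by (cases b) (simp_all add: expand_words pairing_words coeff_simps coeff_monom)

section \<open>The hyperoctahedral action preserves proper multilinear polynomials\<close>

lemma hyper_act_proper:
  fixes p :: "'k::field fpoly"
  assumes "p \<in> proper_polys"
  shows "hyper_act a \<sigma> p \<in> proper_polys"
proof -
  have comm: "comm (fscale d p) (fscale e q) = fscale (d * e) (comm p q)" for d e and p q :: "'k fpoly"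
    by (simp add: comm_def fscale_mult_left fscale_mult_right free.scale_right_diff_distrib mult.commute)
  have c: "\<exists>d. \<exists>c'\<in>iter_comms. hyper_act a \<sigma> c = fscale d c'"
    if "c \<in> iter_comms" for c :: "'k fpoly"
    using that
  proof (induction rule: iter_comms.induct)
    case (1 u v)
    obtain d e u' v' where "hyper_act a \<sigma> (var u) = (fscale d (var u') :: 'k fpoly)"
      "hyper_act a \<sigma> (var v) = (fscale e (var v') :: 'k fpoly)"
      using hyper_act_var by metis
    then show ?case by (auto simp: hyper_act.comm comm intro: iter_comms.intros)
  next
    case (2 c u)
    then obtain d c' where "c' \<in> iter_comms" "hyper_act a \<sigma> c = fscale d c'" by blast
    moreover obtain e u' where "hyper_act a \<sigma> (var u) = (fscale e (var u') :: 'k fpoly)"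
      using hyper_act_var by blast
    ultimately show ?case by (auto simp: hyper_act.comm comm intro: iter_comms.intros)
  qed
  show ?thesis
    using assms unfolding proper_polys_def
  proof (induction rule: unital_subalgebra_gen.induct)
    case (gen p)
    then show ?case
    proof
      assume "p \<in> iter_comms"
      then show ?thesis
        using c by (metis UnCI unital_subalgebra_gen.gen unital_subalgebra_gen.scale)
    next
      assume "p \<in> range z"
      then obtain i where "p = z i" by blast
      moreover have "(z (\<sigma> i) :: 'k fpoly) \<in> unital_subalgebra_gen (range z \<union> iter_comms)"
        by (rule unital_subalgebra_gen.gen) simp
      ultimately show ?thesis by (simp add: hyper_act_Zv unital_subalgebra_gen.scale)
    qed
  qed (auto simp: hyper_act.hom_simps intro: unital_subalgebra_gen.intros)
qed

lemma hyper_act_Gam: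
  assumes "f \<in> Gam n" "bij_betw \<sigma> {..<n} {..<n}"
  shows "hyper_act a \<sigma> f \<in> Gam n"
  using assms hyper_act_multilin [of f "{..<n}" \<sigma> a]
  by (auto simp: Gam_def Vstar_conv_multilin hyper_act_proper bij_betw_def)

lemma rot_Gam:
  assumes "f \<in> Gam n"
  shows "rot n r f \<in> Gam n"
proof (cases "n = 0")
  case False
  have "inj_on (\<lambda>i. (i + r) mod n) {..<n}"
  proof (rule inj_on_inverseI)
    fix i assume i: "i \<in> {..<n}"
    have "r + (n - r mod n) = n * (r div n + 1)"
    proof -
      have "r = n * (r div n) + r mod n" "r mod n < n" using False by simp_all
      then show ?thesis by (metis add.assoc add_diff_inverse_nat distrib_left mult.right_neutral
          order_less_imp_not_less)
    qed
    then have "((i + r) mod n + (n - r mod n)) mod n = (i + n * (r div n + 1)) mod n"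
      by (metis add.assoc mod_add_left_eq)
    also have "\<dots> = i" using i by (simp only: mod_mult_self2) simp
    finally show "((i + r) mod n + (n - r mod n)) mod n = i" .
  qed
  moreover have "(\<lambda>i. (i + r) mod n) ` {..<n} \<subseteq> {..<n}" using False by auto
  ultimately have "bij_betw (\<lambda>i. (i + r) mod n) {..<n} {..<n}"
    by (simp add: bij_betw_def endo_inj_surj)
  then show ?thesis
    using hyper_act_Gam [OF assms] by (simp add: rot_def relabel_def)
next
  case True
  have "f \<in> multilin {}" using assms True by (simp add: Gam_def Vstar_conv_multilin)
  then have "rot n r f \<in> multilin {}"
    using hyper_act_multilin [of f "{}"] by (simp add: rot_def relabel_def)
  then show ?thesis
    using assms True
    by (simp add: Gam_def Vstar_conv_multilin rot_def relabel_def hyper_act_proper)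
qed

section \<open>Bases of the proper multilinear polynomials of degree two and three\<close>

lemma proper_polys_add: "p \<in> proper_polys \<Longrightarrow> q \<in> proper_polys \<Longrightarrow> p + q \<in> proper_polys"
  and proper_polys_mult: "p \<in> proper_polys \<Longrightarrow> q \<in> proper_polys \<Longrightarrow> p * q \<in> proper_polys"
  by (simp_all add: proper_polys_def unital_subalgebra_gen.intros)

lemma proper_polys_diff: "p \<in> proper_polys \<Longrightarrow> q \<in> proper_polys \<Longrightarrow> p - q \<in> proper_polys"
proof -
  assume "p \<in> proper_polys" "q \<in> proper_polys"
  then have "p + fscale (- 1) q \<in> proper_polys"
    unfolding proper_polys_def by (intro unital_subalgebra_gen.add unital_subalgebra_gen.scale)
  then show ?thesis by simp
qed

lemma proper_polys_jord: "p \<in> proper_polys \<Longrightarrow> q \<in> proper_polys \<Longrightarrow> jord p q \<in> proper_polys"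
  and proper_polys_comm: "p \<in> proper_polys \<Longrightarrow> q \<in> proper_polys \<Longrightarrow> comm p q \<in> proper_polys"
  by (simp_all add: jord_def comm_def proper_polys_add proper_polys_mult proper_polys_diff)

lemma proper_polys_gens:
  "z i \<in> proper_polys" "comm (var u) (var v) \<in> proper_polys"
  "comm (comm (var u) (var v)) (var x) \<in> proper_polys"
  unfolding proper_polys_def
  by (rule unital_subalgebra_gen.gen, auto intro: iter_comms.intros)+

lemmas proper_polys_intros = proper_polys_gens proper_polys_jord proper_polys_comm
  proper_polys_add proper_polys_diff proper_polys_mult

lemma multilin_monom: "w \<in> mwords A \<Longrightarrow> monom w \<in> multilin A"
  by (simp add: multilin_def free.span_base)

lemma multilin_closed:
  "p \<in> multilin A \<Longrightarrow> q \<in> multilin A \<Longrightarrow> p + q \<in> multilin A"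
  "p \<in> multilin A \<Longrightarrow> q \<in> multilin A \<Longrightarrow> p - q \<in> multilin A"
  "p \<in> multilin A \<Longrightarrow> - p \<in> multilin A"
  using subspace_multilin [of A]
  by (auto intro: free.subspace_add free.subspace_diff free.subspace_neg)

lemma gen2_Gam: "gen2 b \<in> Gam 2"
proof -
  have "{..<2} = {0, 1 :: nat}" by auto
  then have "gen2 b \<in> multilin {..<2}"
    by (cases b; simp add: expand_words; intro multilin_closed multilin_monom; auto simp: mwords_def)
  moreover have "gen2 b \<in> proper_polys"
    by (cases b; simp; intro proper_polys_intros)
  ultimately show ?thesis by (simp add: Gam_def Vstar_conv_multilin)
qed

lemma gen3_Gam: "gen3 b \<in> Gam 3"
proof -
  have "{..<3} = {0, 1, 2 :: nat}" by auto
  then have "gen3 b \<in> multilin {..<3}"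
    by (cases b; simp add: expand_words; intro multilin_closed multilin_monom; auto simp: mwords_def)
  moreover have "gen3 b \<in> proper_polys"
    by (cases b; simp; intro proper_polys_intros)
  ultimately show ?thesis by (simp add: Gam_def Vstar_conv_multilin)
qed

lemma gen2_nonzero: "gen2 b \<noteq> (0 :: 'k::field_char_0 fpoly)"
  using pairing_gen2 [of b, where 'k = 'k] pairing_right(3) by metis

lemma gen3_nonzero: "gen3 b \<noteq> (0 :: 'k::field_char_0 fpoly)"
  using pairing_gen3 [of b, where 'k = 'k] pairing_right(3) by metis

text \<open>
  On multilinear polynomials this is the projection onto the span of the words whose skew variables
  are those with index in \<open>S\<close>.
\<close>

definition skew_proj :: "nat set \<Rightarrow> 'k::field fpoly \<Rightarrow> 'k fpoly"
  where "skew_proj S = fsubst (\<lambda>x. case x of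
    Yv i \<Rightarrow> if i \<in> S then 0 else y i | Zv i \<Rightarrow> if i \<in> S then z i else 0)"

lemma skew_proj_star_endo: "star_endo (skew_proj S)"
  unfolding skew_proj_def by (rule star_endo_fsubst) (auto simp: fstar_simps)

interpretation skew_proj: falg_hom "skew_proj S" for S
  by (rule star_endo_hom [OF skew_proj_star_endo])

lemma skew_proj_Yv: "skew_proj S (y i) = (if i \<in> S then 0 else y i)"
  and skew_proj_Zv: "skew_proj S (z i) = (if i \<in> S then z i else 0)"
  by (simp_all add: skew_proj_def fsubst_var)

lemmas skew_proj_simps = skew_proj.hom_simps skew_proj.jord skew_proj_Yv skew_proj_Zv

lemma zero_products [simp]: "comm p 0 = 0" "comm 0 p = 0" "jord p 0 = 0" "jord 0 p = 0"
  by (simp_all add: comm_def jord_def)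

lemma skew_proj_rot:
  "skew_proj S (rot n r p) = rot n r (skew_proj {i. (i + r) mod n \<in> S} p)"
proof -
  have "skew_proj S (rot n r (var x)) = rot n r (skew_proj {i. (i + r) mod n \<in> S} (var x))" for x
    by (cases x) (auto simp: rot_simps skew_proj_simps)
  then have "(\<lambda>p. skew_proj S (rot n r p)) = (\<lambda>p. rot n r (skew_proj {i. (i + r) mod n \<in> S} p))"
    by (intro falg_hom_ext) (unfold_locales, auto simp: rot.hom_simps skew_proj.hom_simps)
  then show ?thesis by metis
qed

fun skew_type2 :: "irr2 \<Rightarrow> bool \<times> bool" where
  "skew_type2 YY = (False, False)" | "skew_type2 YZ = (False, True)" | "skew_type2 _ = (True, True)"

fun skew_type3 :: "irr3 \<Rightarrow> bool \<times> bool \<times> bool" where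
  "skew_type3 YYY = (False, False, False)"
| "skew_type3 YYZ1 = (True, False, False)" | "skew_type3 YYZ2 = (True, False, False)"
| "skew_type3 YYZ3 = (True, False, False)"
| "skew_type3 YZZ1 = (False, True, True)" | "skew_type3 YZZ2 = (False, True, True)"
| "skew_type3 YZZ3 = (False, True, True)" | "skew_type3 YZZ4 = (False, True, True)"
| "skew_type3 _ = (True, True, True)"

lemma skew_proj_gen2:
  "skew_proj S (gen2 b) = (if (0 \<in> S, 1 \<in> S) = skew_type2 b then gen2 b else 0)"
  by (cases b) (auto simp: skew_proj_simps)

lemma skew_proj_gen3:
  "skew_proj S (gen3 b) = (if (0 \<in> S, 1 \<in> S, 2 \<in> S) = skew_type3 b then gen3 b else 0)"
  by (cases b) (auto simp: skew_proj_simps)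

lemma skew_proj_elem2:
  "skew_proj S (elem 2 gen2 (b, r)) =
    (if (r mod 2 \<in> S, (1 + r) mod 2 \<in> S) = skew_type2 b then elem 2 gen2 (b, r) else 0)"
  by (simp add: elem_def skew_proj_rot skew_proj_gen2 rot.zero)

lemma skew_proj_elem3:
  "skew_proj S (elem 3 gen3 (b, r)) =
    (if (r mod 3 \<in> S, (1 + r) mod 3 \<in> S, (2 + r) mod 3 \<in> S) = skew_type3 b then elem 3 gen3 (b, r) else 0)"
  by (simp add: elem_def skew_proj_rot skew_proj_gen3 rot.zero)

lemma fstar_rot: "fstar (rot n r p) = rot n r (fstar p)"
  by (rule star_endo_fstar [OF rot_star_endo, symmetric])

lemma sum_index2:
  "(\<Sum>k\<in>index deg2. f k) = f (YY, 0) + (f (YZ, 0) + f (YZ, 1)) + f (ZZ_plus, 0) + f (ZZ_minus, 0)"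
  for f :: "irr2 \<times> nat \<Rightarrow> 'a::ab_group_add"
proof -
  have "(\<Sum>k\<in>index deg2. f k) = (\<Sum>b\<in>UNIV. \<Sum>r<deg2 b. f (b, r))"
    by (simp add: index_def sum.Sigma)
  then show ?thesis by (simp add: UNIV_irr2 numeral_2_eq_2 add_ac)
qed

lemma sum_index3:
  "(\<Sum>k\<in>index deg3. f k) = f (YYY, 0) + f (YYY, 1)
    + (f (YYZ1, 0) + f (YYZ2, 0) + f (YYZ3, 0))
    + (f (YYZ1, 1) + f (YYZ2, 1) + f (YYZ3, 1))
    + (f (YYZ1, 2) + f (YYZ2, 2) + f (YYZ3, 2))
    + (f (YZZ1, 0) + f (YZZ2, 0) + f (YZZ3, 0) + f (YZZ4, 0))
    + (f (YZZ1, 1) + f (YZZ2, 1) + f (YZZ3, 1) + f (YZZ4, 1))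
    + (f (YZZ1, 2) + f (YZZ2, 2) + f (YZZ3, 2) + f (YZZ4, 2))
    + ((f (ZZZ_alt, 0) + (f (ZZZ_plus, 0) + f (ZZZ_plus, 1)))
      + (f (ZZZ_sym, 0) + (f (ZZZ_minus, 0) + f (ZZZ_minus, 1))))"
  for f :: "irr3 \<times> nat \<Rightarrow> 'a::ab_group_add"
proof -
  have "(\<Sum>k\<in>index deg3. f k) = (\<Sum>b\<in>UNIV. \<Sum>r<deg3 b. f (b, r))"
    by (simp add: index_def sum.Sigma)
  then show ?thesis by (simp add: UNIV_irr3 numeral_3_eq_3 numeral_2_eq_2 add_ac)
qed

definition swap12 :: "'k::field fpoly \<Rightarrow> 'k fpoly"
  where "swap12 = relabel (Transposition.transpose 1 2)"

lemma gen3_swap12: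
  "swap12 (gen3 YYZ1) = - gen3 YYZ1" "swap12 (gen3 YYZ2) = - gen3 YYZ2" "swap12 (gen3 YYZ3) = gen3 YYZ3"
  "swap12 (gen3 YZZ1) = gen3 YZZ1" "swap12 (gen3 YZZ2) = - gen3 YZZ2"
  "swap12 (gen3 YZZ3) = - gen3 YZZ3" "swap12 (gen3 YZZ4) = gen3 YZZ4"
  by (simp_all add: swap12_def relabel_simps, simp_all add: comm_def jord_def numeral_2_eq_2 algebra_simps)

lemma gen3_fstar:
  "fstar (gen3 YYZ1) = gen3 YYZ1" "fstar (gen3 YYZ2) = - gen3 YYZ2" "fstar (gen3 YYZ3) = - gen3 YYZ3"
  "fstar (gen3 YZZ1) = - gen3 YZZ1" "fstar (gen3 YZZ2) = gen3 YZZ2"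
  "fstar (gen3 YZZ3) = - gen3 YZZ3" "fstar (gen3 YZZ4) = gen3 YZZ4"
  "fstar (gen3 ZZZ_sym) = - gen3 ZZZ_sym" "fstar (gen3 ZZZ_alt) = gen3 ZZZ_alt"
  "fstar (gen3 ZZZ_plus) = gen3 ZZZ_plus" "fstar (gen3 ZZZ_minus) = - gen3 ZZZ_minus"
  "fstar (gen3 YYY) = gen3 YYY"
  by (simp_all add: fstar_simps fstar_jord, simp_all add: comm_def jord_def numeral_2_eq_2 algebra_simps)

lemma gen3_rot:
  "rot 3 1 (gen3 ZZZ_sym) = (gen3 ZZZ_sym :: 'k::field fpoly)" "rot 3 1 (gen3 ZZZ_alt) = (gen3 ZZZ_alt :: 'k fpoly)"
  "b \<in> {YYY, ZZZ_plus, ZZZ_minus} \<Longrightarrow>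
    rot 3 2 (gen3 b) = - gen3 b - (rot 3 1 (gen3 b) :: 'k fpoly)"
  by (auto simp: rot_simps, simp_all add: comm_def jord_def numeral_2_eq_2 algebra_simps)

lemma gen3_swap01:
  fixes b defines "e \<equiv> (if b = ZZZ_plus then 1 else - 1)"
  assumes "b \<in> {YYY, ZZZ_plus, ZZZ_minus}"
  shows "relabel (Transposition.transpose 0 1) (gen3 b) = fscale e (rot 3 1 (gen3 b) :: 'k::field fpoly)"
    "relabel (Transposition.transpose 0 1) (rot 3 1 (gen3 b)) = fscale e (gen3 b :: 'k fpoly)"
  using assms(2) unfolding e_def
  by (auto simp: rot_simps relabel_simps, simp_all add: comm_def jord_def numeral_2_eq_2 algebra_simps)

text \<open>
  A conjugate of \<^const>\<open>swap12\<close>: it exchanges the two indices different from \<open>r\<close>.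
\<close>

definition swap_rot :: "nat \<Rightarrow> 'k::field fpoly \<Rightarrow> 'k fpoly"
  where "swap_rot r p = rot 3 r (swap12 (rot 3 (3 - r) p))"

lemma swap_rot_star_endo: "star_endo (swap_rot r)"
proof -
  have "star_endo (\<lambda>p. swap12 (rot 3 (3 - r) p))"
    unfolding swap12_def by (rule star_endo_comp [OF relabel_star_endo rot_star_endo])
  then show ?thesis
    unfolding swap_rot_def [abs_def] by (rule star_endo_comp [OF rot_star_endo])
qed

lemma swap_rot_elem3:
  assumes "r < 3"
  shows "swap_rot r (elem 3 gen3 (b, r)) = (rot 3 r (swap12 (gen3 b)) :: 'k::field fpoly)"
proof -
  have "rot 3 3 (gen3 b) = (gen3 b :: 'k fpoly)" by (cases b) (simp_all add: rot_simps)
  then show ?thesis using assms by (simp add: swap_rot_def elem_def rot_rot)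
qed

lemma elem3_0: "elem 3 gen3 (b, 0) = gen3 b"
  and elem3_1: "elem 3 gen3 (b, Suc 0) = rot 3 1 (gen3 b)"
  by (cases b) (simp_all add: elem_def rot_simps numeral_2_eq_2)

lemma rot_elem3:
  assumes "b \<in> {YYY, ZZZ_plus, ZZZ_minus}"
  shows "rot 3 1 (elem 3 gen3 (b, 0)) = (elem 3 gen3 (b, 1) :: 'k::field fpoly)"
    "rot 3 1 (elem 3 gen3 (b, 1)) = - elem 3 gen3 (b, 0) - (elem 3 gen3 (b, 1) :: 'k fpoly)"
  using gen3_rot(3) [OF assms, where 'k = 'k]
  by (simp_all add: elem3_0 elem3_1 rot_rot numeral_2_eq_2 del: gen3.simps)

text \<open>
  The projections \<^const>\<open>skew_proj\<close> first split a combination by the positions of the skew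
  variables. With one or two skew variables, the exchange of the two variables of equal kind and
  the involution distinguish the generators by their signs. With three skew variables the involution
  splits off two halves, in each of which the rotation separates the one-dimensional component from
  the standard one.
\<close>

lemma separated_elem3: "separated (index deg3) (elem 3 gen3 :: _ \<Rightarrow> 'k::field_char_0 fpoly)"
  unfolding separated_def
proof (intro allI impI)
  fix J :: "'k fpoly set" and c
  assume "closed_ideal J" and J: "(\<Sum>k\<in>index deg3. fscale (c k) (elem 3 gen3 k)) \<in> J"
  then interpret closed_ideal J by simp
  let ?t = "\<lambda>b r. fscale (c (b, r)) (elem 3 gen3 (b, r))"
  have proj: "skew_proj S (\<Sum>k\<in>index deg3. fscale (c k) (elem 3 gen3 k)) \<in> J" for S
    using J endo skew_proj_star_endo by blast
  note proj' = proj [unfolded sum_index3 skew_proj.add skew_proj.scale skew_proj_elem3, simplified]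
  have yyz: "?t YYZ1 r \<in> J \<and> ?t YYZ2 r \<in> J \<and> ?t YYZ3 r \<in> J" if "r < 3" for r
  proof (rule separate_3)
    have "r = 0 \<or> r = 1 \<or> r = 2" using that by auto
    then show "?t YYZ1 r + ?t YYZ2 r + ?t YYZ3 r \<in> J"
      using proj' [of "{0}"] proj' [of "{1}"] proj' [of "{2}"] by auto
    show "star_endo (swap_rot r)" by (rule swap_rot_star_endo)
  qed (use that in \<open>simp_all add: swap_rot_elem3 gen3_swap12 rot.minus del: gen3.simps\<close>,
      simp_all add: elem_def fstar_rot gen3_fstar rot.minus del: gen3.simps)
  have yzz: "?t YZZ1 r \<in> J \<and> ?t YZZ2 r \<in> J \<and> ?t YZZ3 r \<in> J \<and> ?t YZZ4 r \<in> J"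
    if "r < 3" for r
  proof (rule separate_4)
    have "r = 0 \<or> r = 1 \<or> r = 2" using that by auto
    then show "?t YZZ1 r + ?t YZZ2 r + ?t YZZ3 r + ?t YZZ4 r \<in> J"
      using proj' [of "{1, 2}"] proj' [of "{0, 2}"] proj' [of "{0, 1}"] by auto
    show "star_endo (swap_rot r)" by (rule swap_rot_star_endo)
  qed (use that in \<open>simp_all add: swap_rot_elem3 gen3_swap12 rot.minus del: gen3.simps\<close>,
      simp_all add: elem_def fstar_rot gen3_fstar rot.minus del: gen3.simps)
  have standard: "?t b 0 \<in> J \<and> ?t b 1 \<in> J"
    if "?t b 0 + ?t b 1 \<in> J" and b: "b \<in> {YYY, ZZZ_plus, ZZZ_minus}" for b
  proof (rule separate_standard [OF that(1) rot_star_endo relabel_star_endo])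
    show "rot 3 1 (elem 3 gen3 (b, 0)) = (elem 3 gen3 (b, 1) :: 'k fpoly)"
      "rot 3 1 (elem 3 gen3 (b, 1)) = - elem 3 gen3 (b, 0) - (elem 3 gen3 (b, 1) :: 'k fpoly)"
      using b by (rule rot_elem3)+
    show "relabel (Transposition.transpose 0 1) (elem 3 gen3 (b, 0)) =
        fscale (if b = ZZZ_plus then 1 else - 1) (elem 3 gen3 (b, 1) :: 'k fpoly)"
      "relabel (Transposition.transpose 0 1) (elem 3 gen3 (b, 1)) =
        fscale (if b = ZZZ_plus then 1 else - 1) (elem 3 gen3 (b, 0) :: 'k fpoly)"
      using gen3_swap01 [OF b, where 'k = 'k] by (simp_all add: elem3_0 elem3_1 del: gen3.simps)
  qed simp
  have zzz: "(?t ZZZ_alt 0 + (?t ZZZ_plus 0 + ?t ZZZ_plus 1))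
      + (?t ZZZ_sym 0 + (?t ZZZ_minus 0 + ?t ZZZ_minus 1)) \<in> J" (is "?p + ?m \<in> J")
    using proj' [of "{0, 1, 2}"] by simp
  then have "fstar (?p + ?m) \<in> J" by (rule star)
  then have "?p - ?m \<in> J"
    by (simp add: fstar_simps elem_def fstar_rot gen3_fstar rot.minus algebra_simps
        del: gen3.simps)
  then have pm: "?p \<in> J" "?m \<in> J" using split [OF zzz] by simp_all
  have fixed: "rot 3 1 (elem 3 gen3 (b, 0)) = (elem 3 gen3 (b, 0) :: 'k fpoly)" if "b \<in> {ZZZ_sym, ZZZ_alt}" for b
    using that gen3_rot(1,2) [where 'k = 'k] by (auto simp: elem3_0 simp del: gen3.simps)
  have alt: "?t ZZZ_alt 0 \<in> J \<and> ?t ZZZ_plus 0 + ?t ZZZ_plus 1 \<in> J"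
    by (rule separate_fixed [OF pm(1) rot_star_endo [of 3 1] fixed rot_elem3 [of ZZZ_plus]]) simp_all
  have sym: "?t ZZZ_sym 0 \<in> J \<and> ?t ZZZ_minus 0 + ?t ZZZ_minus 1 \<in> J"
    by (rule separate_fixed [OF pm(2) rot_star_endo [of 3 1] fixed rot_elem3 [of ZZZ_minus]]) simp_all
  have YYY: "?t YYY 0 + ?t YYY 1 \<in> J" using proj' [of "{}"] by simp
  show "\<forall>k\<in>index deg3. fscale (c k) (elem 3 gen3 k) \<in> J"
  proof
    fix k :: "irr3 \<times> nat" assume "k \<in> index deg3"
    then obtain b r where k: "k = (b, r)" "r < deg3 b" by (auto simp: index_def)
    have "r \<in> {0, 1}" if "b \<in> {YYY, ZZZ_plus, ZZZ_minus}"
      using that k(2) by auto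
    then show "fscale (c k) (elem 3 gen3 k) \<in> J"
      using k(2) yyz [of r] yzz [of r] standard [of YYY] standard [of ZZZ_plus]
        standard [of ZZZ_minus] alt sym YYY
      unfolding k(1) by (cases b) auto
  qed
qed

lemma separated_elem2: "separated (index deg2) (elem 2 gen2 :: _ \<Rightarrow> 'k::field_char_0 fpoly)"
  unfolding separated_def
proof (intro allI impI)
  fix J :: "'k fpoly set" and c
  assume "closed_ideal J" and J: "(\<Sum>k\<in>index deg2. fscale (c k) (elem 2 gen2 k)) \<in> J"
  then interpret closed_ideal J by simp
  let ?t = "\<lambda>b r. fscale (c (b, r)) (elem 2 gen2 (b, r))"
  have proj: "skew_proj S (\<Sum>k\<in>index deg2. fscale (c k) (elem 2 gen2 k)) \<in> J" for S
    using J endo skew_proj_star_endo by blast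
  note proj' = proj [unfolded sum_index2 skew_proj.add skew_proj.scale skew_proj_elem2, simplified]
  have "?t YY 0 \<in> J" "?t YZ 0 \<in> J" "?t YZ 1 \<in> J" and zz: "?t ZZ_plus 0 + ?t ZZ_minus 0 \<in> J"
    using proj' [of "{}"] proj' [of "{1}"] proj' [of "{0}"] proj' [of "{0, 1}"] by simp_all
  moreover have "?t ZZ_plus 0 \<in> J \<and> ?t ZZ_minus 0 \<in> J"
  proof (rule split [OF zz])
    have "fstar (elem 2 gen2 (ZZ_plus, 0)) = (elem 2 gen2 (ZZ_plus, 0) :: 'k fpoly)"
      "fstar (elem 2 gen2 (ZZ_minus, 0)) = - (elem 2 gen2 (ZZ_minus, 0) :: 'k fpoly)"
      by (simp_all add: elem_def rot_simps fstar_simps fstar_jord, simp_all add: comm_def jord_def)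
    then show "?t ZZ_plus 0 - ?t ZZ_minus 0 \<in> J"
      using star [OF zz] by (simp add: fstar_add fstar_fscale)
  qed
  ultimately show "\<forall>k\<in>index deg2. fscale (c k) (elem 2 gen2 k) \<in> J"
    by (auto simp: index_def UNIV_irr2 less_Suc_eq numeral_2_eq_2 elim: deg2.elims)
qed

section \<open>Proper codimensions in low degree\<close>

lemma subspace_Gam: "free.subspace (Gam n)"
proof -
  have "0 \<in> proper_polys"
    unfolding proper_polys_def
    using unital_subalgebra_gen.scale [OF unital_subalgebra_gen.one, where c = 0]
    by (simp only: free.scale_zero_left)
  then have "free.subspace proper_polys"
    by (simp add: free.subspace_def proper_polys_add)
      (simp add: proper_polys_def unital_subalgebra_gen.scale)
  then show ?thesis
    unfolding Gam_def Vstar_conv_multilin using subspace_multilin by (rule free.subspace_inter)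
qed

lemma card_index:
  assumes "finite (UNIV :: 'b set)"
  shows "card {k \<in> index d. P (fst k)} = (\<Sum>b\<in>(UNIV :: 'b set). if P b then d b else 0)"
proof -
  have "{k \<in> index d. P (fst k)} = (SIGMA b:{b. P b}. {..<d b})"
    by (auto simp: index_def)
  then have "card {k \<in> index d. P (fst k)} = (\<Sum>b | P b. d b)"
    using assms finite_subset [OF subset_UNIV assms] by simp
  then show ?thesis using assms by (simp add: sum.inter_filter [symmetric])
qed

text \<open>
  The rotated generators have the right number, so they form a basis, and membership of a basis
  element in \<open>I\<close> depends only on the component it belongs to.
\<close>

lemma components:
  fixes g :: "'b \<Rightarrow> 'k::field_char_0 fpoly" and d :: "'b \<Rightarrow> nat"
  assumes fin: "finite (UNIV :: 'b set)" and sep: "separated (index d) (elem n g)"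
    and Gam: "\<And>b. g b \<in> Gam n" and nonzero: "\<And>b. g b \<noteq> 0"
    and rot: "\<And>b. rot n n (g b) = g b" and d: "\<And>b. d b \<le> n"
    and dim: "sum d UNIV = proper_dim (UNIV :: 'k fpoly set) n"
  shows "proper_multilin {..<n} {..<n} = (Gam n :: 'k fpoly set)" (is ?Gam)
    and "closed_ideal I \<Longrightarrow> proper_codim I n = (\<Sum>b\<in>UNIV. if g b \<notin> I then d b else 0)"
proof -
  have iff: "elem n g k \<in> J \<longleftrightarrow> g (fst k) \<in> J" if "k \<in> index d" "closed_ideal J" for k J
  proof -
    have "snd k < n" using that(1) d [of "fst k"] by (auto simp: index_def)
    then have "elem n g (fst k, snd k) \<in> J \<longleftrightarrow> g (fst k) \<in> J"
      by (intro elem_ideal_iff that rot)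
    then show ?thesis by simp
  qed
  have elem: "elem n g k \<in> Gam n" for k
    by (cases k) (simp add: elem_def rot_Gam Gam)
  then have sub: "elem n g ` index d \<subseteq> proper_multilin {..<n} {..<n}"
    using Gam_subset_proper_multilin by blast
  have "finite (index d)" using fin by (simp add: index_def)
  moreover have "elem n g k \<noteq> 0" if "k \<in> index d" for k
    using iff [OF that closed_ideal_zero] nonzero by simp
  moreover have "card (index d) = proper_dim (UNIV :: 'k fpoly set) n"
    using card_index [OF fin, of d "\<lambda>_. True"] dim by simp
  ultimately have span: "free.span (elem n g ` index d) = proper_multilin {..<n} {..<n}"
    and codim: "closed_ideal I \<Longrightarrow> proper_codim I n = card {k \<in> index d. elem n g k \<notin> I}" for I
    using sep sub by (intro separated_span separated_proper_codim; simp)+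
  have "free.span (elem n g ` index d) \<subseteq> Gam n"
    using elem subspace_Gam by (intro free.span_minimal) auto
  then show ?Gam using span Gam_subset_proper_multilin by blast
  assume I: "closed_ideal I"
  have "{k \<in> index d. elem n g k \<notin> I} = {k \<in> index d. g (fst k) \<notin> I}"
    using iff [OF _ I] by blast
  then have "proper_codim I n = card {k \<in> index d. g (fst k) \<notin> I}"
    by (simp add: codim [OF I])
  also have "\<dots> = (\<Sum>b\<in>UNIV. if g b \<notin> I then d b else 0)"
    by (rule card_index [OF fin])
  finally show "proper_codim I n = (\<Sum>b\<in>UNIV. if g b \<notin> I then d b else 0)" .
qed

lemma sum_deg2: "sum deg2 UNIV = proper_dim (UNIV :: 'k::field_char_0 fpoly set) 2"
  by (simp add: UNIV_irr2 proper_dim_UNIV)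

lemma sum_deg3: "sum deg3 UNIV = proper_dim (UNIV :: 'k::field_char_0 fpoly set) 3"
  by (simp add: UNIV_irr3 proper_dim_UNIV)

lemma deg2_le: "deg2 b \<le> 2"
  by (cases b) simp_all

lemma deg3_le: "deg3 b \<le> 3"
  by (cases b) simp_all

lemmas proper_multilin_2 = components(1) [OF finite_irr2 separated_elem2 gen2_Gam gen2_nonzero
    gen2_rot_full deg2_le sum_deg2]
lemmas proper_codim_2 = components(2) [OF finite_irr2 separated_elem2 gen2_Gam gen2_nonzero
    gen2_rot_full deg2_le sum_deg2]
lemmas proper_multilin_3 = components(1) [OF finite_irr3 separated_elem3 gen3_Gam gen3_nonzero
    gen3_rot_full deg3_le sum_deg3]
lemmas proper_codim_3 = components(2) [OF finite_irr3 separated_elem3 gen3_Gam gen3_nonzero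
    gen3_rot_full deg3_le sum_deg3]

section \<open>Consequences in degree three of identities of degree two\<close>

lemma star_products:
  "fstar (comm (y i) (y j)) = - comm (y i) (y j)" "fstar (comm (y i) (z j)) = comm (y i) (z j)"
  "fstar (comm (z i) (z j)) = - comm (z i) (z j)" "fstar (jord (z i) (z j)) = jord (z i) (z j)"
  "fstar (jord (y i) (z j)) = - jord (y i) (z j)"
  by (simp_all add: fstar_simps fstar_jord, simp_all add: comm_def jord_def)

lemma YZZ1_eq: "gen3 YZZ1 = comm (y 0) (jord (z 1) (z 2))"
  and YZZ2_eq: "gen3 YZZ2 = comm (y 0) (comm (z 1) (z 2))"
  by (simp_all add: comm_def jord_def algebra_simps)

context closed_ideal
begin

text \<open>
  Each of the four identities of degree two may be applied to arbitrary symmetric or skew elements,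
  in particular to products of variables such as \<open>[y, z]\<close>, \<open>[y, y]\<close> or \<open>y \<circ> z\<close>; this produces the
  consequences of degree three.
\<close>

lemma subst_letters:
  assumes "f \<in> I" "\<And>i. fstar (ys i) = ys i" "\<And>i. fstar (zs i) = - zs i"
  shows "fsubst (case_letter ys zs) f \<in> I"
  by (rule endo [OF star_endo_fsubst assms(1)]) (simp_all add: assms(2,3))

lemma subst_YY:
  assumes "gen2 YY \<in> I" "fstar p = p" "fstar q = q"
  shows "comm p q \<in> I"
  using subst_letters [OF assms(1), of "\<lambda>i. if i = 0 then p else q" "\<lambda>_. 0"] assms(2,3)
  by (simp add: fsubst.comm fsubst_var fstar_zero)

lemma subst_YZ:
  assumes "gen2 YZ \<in> I" "fstar p = p" "fstar q = - q"
  shows "comm p q \<in> I"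
  using subst_letters [OF assms(1), of "\<lambda>_. p" "\<lambda>_. q"] assms(2,3)
  by (simp add: fsubst.comm fsubst_var)

lemma subst_ZZ_plus:
  assumes "gen2 ZZ_plus \<in> I" "fstar p = - p" "fstar q = - q"
  shows "jord p q \<in> I"
  using subst_letters [OF assms(1), of "\<lambda>_. 0" "\<lambda>i. if i = 0 then p else q"] assms(2,3)
  by (simp add: fsubst.jord fsubst_var fstar_zero)

lemma subst_ZZ_minus:
  assumes "gen2 ZZ_minus \<in> I" "fstar p = - p" "fstar q = - q"
  shows "comm p q \<in> I"
  using subst_letters [OF assms(1), of "\<lambda>_. 0" "\<lambda>i. if i = 0 then p else q"] assms(2,3)
  by (simp add: fsubst.comm fsubst_var fstar_zero)

lemma jord_left: "f \<in> I \<Longrightarrow> jord f p \<in> I"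
  and jord_right: "f \<in> I \<Longrightarrow> jord p f \<in> I"
  by (simp_all add: jord_def add left right)

lemma YY_consequences:
  assumes "gen2 YY \<in> I" "b \<in> {YYY, YYZ1, YYZ2, YYZ3, YZZ1}"
  shows "gen3 b \<in> I"
proof -
  note YY = subst_YY [OF assms(1)]
  have c: "comm (y i) (y j) \<in> I" for i j by (rule YY) (simp_all add: fstar_Yv)
  have d: "comm (comm (y i) (z j)) (y k) \<in> I" for i j k
    by (rule YY) (simp_all add: fstar_Yv star_products)
  have "comm (y 0) (jord (z 1) (z 2)) \<in> I"
    by (rule YY) (simp_all add: fstar_Yv star_products)
  then have "gen3 YZZ1 \<in> I" by (simp only: YZZ1_eq)
  moreover have "gen3 b \<in> I" if "b \<in> {YYY, YYZ1, YYZ2, YYZ3}"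
    using that by (elim insertE emptyE) (simp_all only: gen3.simps add comm_left jord_left c d)
  ultimately show ?thesis using assms(2) by blast
qed

text \<open>
  Modulo the ideal skew elements anticommute. Hence \<open>r\<close> anticommutes with the skew element
  \<open>[p, q]\<close>, which is twice \<open>p * q\<close>; but moving \<open>r\<close> past both factors changes the sign twice.
\<close>

lemma skew_product_in_ideal:
  assumes "gen2 ZZ_plus \<in> I" "fstar p = - p" "fstar q = - q" "fstar r = - r"
  shows "p * q * r \<in> I"
proof -
  note jord = subst_ZZ_plus [OF assms(1)]
  have "fstar (comm p q) = - comm p q"
    using assms by (simp add: fstar_comm) (simp add: comm_def)
  then have c: "jord (comm p q) r \<in> I" using assms by (intro jord)
  have pq: "jord p q \<in> I" and rp: "jord r p \<in> I" and rq: "jord r q \<in> I"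
    using assms by (auto intro: jord)
  let ?s = "jord (comm p q) r + jord p q * r + r * jord p q - (jord r p * q + jord r p * q)
    + (p * jord r q + p * jord r q)"
  have "?s \<in> I" by (intro add diff left right c pq rp rq)
  moreover have "?s = (p * q * r + p * q * r) + (p * q * r + p * q * r)"
    by (simp add: comm_def jord_def algebra_simps)
  ultimately show ?thesis using half by metis
qed

lemma ZZ_plus_consequences:
  assumes "gen2 ZZ_plus \<in> I"
    and "b \<in> {ZZZ_sym, ZZZ_alt, ZZZ_plus, ZZZ_minus, YYZ1, YZZ1, YZZ2, YZZ4}"
  shows "gen3 b \<in> I"
proof -
  note jord = subst_ZZ_plus [OF assms(1)]
  have zzz: "z i * z j * z k \<in> I" for i j k
    by (rule skew_product_in_ideal [OF assms(1)]) (simp_all add: fstar_Zv)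
  then have zzz': "z i * (z j * z k) \<in> I" for i j k by (simp add: mult.assoc)
  have zz: "jord (z i) (z j) \<in> I" for i j by (rule jord) (simp_all add: fstar_Zv)
  have YYZ1: "gen3 YYZ1 \<in> I"
    using jord by (simp add: fstar_Zv star_products)
  have YZZ1: "gen3 YZZ1 \<in> I" unfolding YZZ1_eq by (intro comm_right zz)
  let ?A = "jord (z 1) (jord (y 0) (z 2))" and ?B = "jord (z 2) (jord (y 0) (z 1))"
  have AB: "?A \<in> I" "?B \<in> I" by (rule jord; simp add: fstar_Zv star_products)+
  have "(gen3 YZZ2 :: 'k fpoly) = ?B - ?A" by (simp add: comm_def jord_def algebra_simps)
  then have YZZ2: "gen3 YZZ2 \<in> I" using AB diff by presburger
  have "(gen3 YZZ4 :: 'k fpoly) = jord (y 0) (jord (z 1) (z 2)) + jord (y 0) (jord (z 1) (z 2)) - (?A + ?B)"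
    by (simp add: comm_def jord_def algebra_simps)
  moreover have "jord (y 0) (jord (z 1) (z 2)) \<in> I" by (intro jord_right zz)
  ultimately have YZZ4: "gen3 YZZ4 \<in> I" using AB by (simp only: add diff)
  have "gen3 b \<in> I" if "b \<in> {ZZZ_sym, ZZZ_alt, ZZZ_plus, ZZZ_minus}"
    using that
    by (elim insertE emptyE)
      (simp_all add: comm_def jord_def algebra_simps, (intro add diff minus zzz')+)
  then show ?thesis using assms(2) YYZ1 YZZ1 YZZ2 YZZ4 by blast
qed

lemma ZZ_minus_consequences:
  assumes "gen2 ZZ_minus \<in> I"
    and "b \<in> {ZZZ_alt, ZZZ_plus, ZZZ_minus, YYZ2, YZZ1, YZZ2, YZZ3}"
  shows "gen3 b \<in> I"
proof -
  note comm = subst_ZZ_minus [OF assms(1)]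
  have zz: "comm (z i) (z j) \<in> I" for i j by (rule comm) (simp_all add: fstar_Zv)
  have "(gen3 ZZZ_plus :: 'k fpoly) = comm (z 1) (z 0) * z 2 + z 1 * comm (z 2) (z 0)
      + comm (z 2) (z 0) * z 1 + z 2 * comm (z 1) (z 0)"
    by (simp add: comm_def jord_def algebra_simps)
  then have plus: "gen3 ZZZ_plus \<in> I" by (simp only: add left right zz)
  have YYZ2: "gen3 YYZ2 \<in> I"
    using comm by (simp add: fstar_Zv star_products)
  have YZZ2: "gen3 YZZ2 \<in> I" unfolding YZZ2_eq by (intro comm_right zz)
  let ?A = "comm (z 1) (jord (y 0) (z 2))" and ?B = "comm (z 2) (jord (y 0) (z 1))"
  have AB: "?A \<in> I" "?B \<in> I" by (rule comm; simp add: fstar_Zv star_products)+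
  have "(gen3 YZZ1 :: 'k fpoly) = - (?A + ?B)" by (simp add: comm_def jord_def algebra_simps)
  then have YZZ1: "gen3 YZZ1 \<in> I" using AB by (simp only: add minus)
  have "(gen3 YZZ3 :: 'k fpoly) = jord (y 0) (comm (z 1) (z 2)) + jord (y 0) (comm (z 1) (z 2)) - (?A - ?B)"
    by (simp add: comm_def jord_def algebra_simps)
  moreover have "jord (y 0) (comm (z 1) (z 2)) \<in> I" by (intro jord_right zz)
  ultimately have YZZ3: "gen3 YZZ3 \<in> I" using AB by (simp only: add diff)
  have "gen3 ZZZ_alt \<in> I" "gen3 ZZZ_minus \<in> I"
    unfolding gen3.simps by (intro add right comm_left zz)+
  then show ?thesis using assms(2) plus YYZ2 YZZ1 YZZ2 YZZ3 by blast
qed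

lemma YZ_consequences:
  assumes "gen2 YZ \<in> I"
    and "b \<in> {YYY, YYZ1, YYZ2, YYZ3, YZZ1, YZZ2, YZZ3, YZZ4, ZZZ_plus}"
  shows "gen3 b \<in> I"
proof -
  note comm = subst_YZ [OF assms(1)]
  have yz: "comm (y i) (z j) \<in> I" for i j by (rule comm) (simp_all add: fstar_Yv fstar_Zv)
  have "comm (y 0) (comm (y 1) (y 2)) \<in> I" by (rule comm) (simp_all add: fstar_Yv star_products)
  moreover have "(gen3 YYY :: 'k fpoly) = - comm (y 0) (comm (y 1) (y 2))" by (simp add: comm_def)
  ultimately have YYY: "gen3 YYY \<in> I" by (simp only: minus)
  have "comm (y 1) (jord (y 2) (z 0)) \<in> I" by (rule comm) (simp_all add: fstar_Yv star_products)
  moreover have "(gen3 YYZ1 :: 'k fpoly) = comm (y 1) (jord (y 2) (z 0)) - jord (y 2) (comm (y 1) (z 0))"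
    by (simp add: comm_def jord_def algebra_simps)
  moreover have "jord (y 2) (comm (y 1) (z 0)) \<in> I" by (intro jord_right yz)
  ultimately have YYZ1: "gen3 YYZ1 \<in> I" by (simp only: diff)
  have "(gen3 YYZ2 :: 'k fpoly) = comm (y 1) (comm (y 2) (z 0)) - comm (y 2) (comm (y 1) (z 0))"
    by (simp add: comm_def algebra_simps)
  moreover have "\<dots> \<in> I" by (intro diff comm_right yz)
  ultimately have YYZ2: "gen3 YYZ2 \<in> I" by (simp only:)
  have plus: "gen3 ZZZ_plus \<in> I"
    unfolding gen3.simps by (rule comm) (simp_all add: fstar_Zv star_products)
  have "gen3 b \<in> I" if "b \<in> {YYZ3, YZZ1, YZZ2, YZZ3, YZZ4}"
    using that by (elim insertE emptyE) (simp_all only: gen3.simps add diff comm_left jord_left yz)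
  then show ?thesis using assms(2) YYY YYZ1 YYZ2 plus by blast
qed

lemma z_consequences:
  assumes "z 0 \<in> I"
  shows "gen2 YZ \<in> I" "gen2 ZZ_plus \<in> I"
proof -
  have "rot 2 1 (z 0) \<in> I" by (rule endo [OF rot_star_endo assms])
  then have "z 1 \<in> I" by (simp add: rot_Zv)
  then show "gen2 YZ \<in> I" "gen2 ZZ_plus \<in> I" by (simp_all add: comm_right jord_right)
qed

text \<open>
  If symmetric and skew elements commute and skew elements anticommute, nothing of degree three
  is left. In particular this happens if all skew elements vanish.
\<close>

lemma all_gen3_in_ideal:
  assumes "gen2 YZ \<in> I" "gen2 ZZ_plus \<in> I"
  shows "gen3 b \<in> I"
  using YZ_consequences [OF assms(1), of b] ZZ_plus_consequences [OF assms(2), of b]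
  by (cases b) (simp_all del: gen3.simps)

text \<open>
  Sixteen cases, according to which of the four components of degree two consist of identities; the
  tables of consequences tell which components of degree three they force into the ideal.
\<close>

theorem proper_codim_bounds:
  assumes "proper_codim I 3 \<noteq> 0"
  shows "proper_codim I 2 = 5 \<and> proper_codim I 3 \<le> 29 \<or>
    proper_codim I 2 = 4 \<and> proper_codim I 3 \<le> 15 \<or>
    proper_codim I 2 = 3 \<and> proper_codim I 3 \<le> 5 \<or>
    proper_codim I 2 = 2 \<and> proper_codim I 3 \<le> 4 \<or>
    proper_codim I 2 = 1 \<and> proper_codim I 3 \<le> 1"
proof -
  define t where "t b = (if gen3 b \<notin> I then deg3 b else 0)" for b
  have c3: "proper_codim I 3 = t YYY + t YYZ1 + t YYZ2 + t YYZ3 + t YZZ1 + t YZZ2 + t YZZ3 + t YZZ4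
      + t ZZZ_sym + t ZZZ_alt + t ZZZ_plus + t ZZZ_minus"
    by (simp add: proper_codim_3 [OF closed_ideal_axioms] UNIV_irr3 t_def del: gen3.simps)
  have c2: "proper_codim I 2 = (if gen2 YY \<notin> I then 1 else 0) + (if gen2 YZ \<notin> I then 2 else 0)
      + (if gen2 ZZ_plus \<notin> I then 1 else 0) + (if gen2 ZZ_minus \<notin> I then 1 else 0)"
    by (simp add: proper_codim_2 [OF closed_ideal_axioms] UNIV_irr2 del: gen2.simps)
  have le: "t YYY \<le> 2" "t YYZ1 \<le> 3" "t YYZ2 \<le> 3" "t YYZ3 \<le> 3" "t YZZ1 \<le> 3" "t YZZ2 \<le> 3"
    "t YZZ3 \<le> 3" "t YZZ4 \<le> 3" "t ZZZ_sym \<le> 1" "t ZZZ_alt \<le> 1" "t ZZZ_plus \<le> 2" "t ZZZ_minus \<le> 2"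
    by (simp_all add: t_def)
  have YY: "t b = 0" if "gen2 YY \<in> I" "b \<in> {YYY, YYZ1, YYZ2, YYZ3, YZZ1}" for b
    using YY_consequences [OF that] by (simp add: t_def)
  have YZ: "t b = 0"
    if "gen2 YZ \<in> I" "b \<in> {YYY, YYZ1, YYZ2, YYZ3, YZZ1, YZZ2, YZZ3, YZZ4, ZZZ_plus}" for b
    using YZ_consequences [OF that] by (simp add: t_def)
  have plus: "t b = 0" if "gen2 ZZ_plus \<in> I"
    "b \<in> {ZZZ_sym, ZZZ_alt, ZZZ_plus, ZZZ_minus, YYZ1, YZZ1, YZZ2, YZZ4}" for b
    using ZZ_plus_consequences [OF that] by (simp add: t_def)
  have minus: "t b = 0" if "gen2 ZZ_minus \<in> I"
    "b \<in> {ZZZ_alt, ZZZ_plus, ZZZ_minus, YYZ2, YZZ1, YZZ2, YZZ3}" for b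
    using ZZ_minus_consequences [OF that] by (simp add: t_def)
  show ?thesis
    by (cases "gen2 YY \<in> I"; cases "gen2 YZ \<in> I"; cases "gen2 ZZ_plus \<in> I"; cases "gen2 ZZ_minus \<in> I")
      (use assms le in \<open>simp_all add: c2 c3 YY YZ plus minus del: gen2.simps\<close>)
qed

lemma proper_codim_0:
  assumes "1 \<notin> I"
  shows "proper_codim I 0 = 1"
proof -
  have "proper_codim I 0 = card {k \<in> {()}. (1 :: 'k fpoly) \<notin> I}"
  proof (rule separated_proper_codim [where e = "\<lambda>_. 1"])
    have "monom [] \<in> multilin {}" by (rule multilin_monom) (simp add: mwords_def)
    then show "(\<lambda>_. 1 :: 'k fpoly) ` {()} \<subseteq> proper_multilin {..<0} {..<0}"
      by (simp add: proper_multilin_def monom_Nil)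
  qed (simp_all add: separated_def proper_dim_UNIV closed_ideal_axioms)
  then show ?thesis using assms by simp
qed

lemma proper_codim_1:
  assumes "z 0 \<notin> I"
  shows "proper_codim I (Suc 0) = 1"
proof -
  have "z 0 \<noteq> (0 :: 'k fpoly)" using assms zero by auto
  have "proper_codim I (Suc 0) = card {k \<in> {()}. (z 0 :: 'k fpoly) \<notin> I}"
  proof (rule separated_proper_codim [where e = "\<lambda>_. z 0"])
    have "z 0 \<in> multilin {0}" unfolding var_def by (rule multilin_monom) (simp add: mwords_def)
    then show "(\<lambda>_. z 0 :: 'k fpoly) ` {()} \<subseteq> proper_multilin {..<Suc 0} {..<Suc 0}"
      by (simp add: proper_multilin_def lessThan_Suc drop_var_var)
  qed (use \<open>z 0 \<noteq> (0 :: 'k fpoly)\<close> in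
      \<open>simp_all add: separated_def proper_dim_UNIV closed_ideal_axioms\<close>)
  then show ?thesis using assms by simp
qed

lemma proper_codim_0_1:
  assumes "proper_codim I 3 \<noteq> 0"
  shows "proper_codim I 0 = 1" "proper_codim I (Suc 0) = 1"
proof -
  have "\<exists>b. gen3 b \<notin> I"
  proof (rule ccontr)
    assume "\<nexists>b. gen3 b \<notin> I"
    then show False using assms by (simp add: proper_codim_3 [OF closed_ideal_axioms] del: gen3.simps)
  qed
  then obtain b where b: "gen3 b \<notin> I" ..
  then show "proper_codim I (Suc 0) = 1"
    using z_consequences all_gen3_in_ideal by (intro proper_codim_1) blast
  show "proper_codim I 0 = 1"
    using b left [of 1 "gen3 b"] by (intro proper_codim_0) auto
qed

end

section \<open>Values of proper polynomials\<close>

definition order_ge :: "nat \<Rightarrow> 'k::field fpoly \<Rightarrow> bool"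
  where "order_ge n p \<longleftrightarrow> (\<forall>w. length w < n \<longrightarrow> coeff p w = 0)"

lemma order_ge_mult:
  assumes "order_ge m p" "order_ge n q"
  shows "order_ge (m + n) (p * q)"
  unfolding order_ge_def
proof (intro allI impI)
  fix w :: "letter list" assume w: "length w < m + n"
  have "coeff p (take i w) * coeff q (drop i w) = 0" if "i \<le> length w" for i
  proof (cases "i < m")
    case True
    then have "coeff p (take i w) = 0" using assms(1) that by (simp add: order_ge_def)
    then show ?thesis by simp
  next
    case False
    then have "coeff q (drop i w) = 0" using assms(2) that w by (simp add: order_ge_def)
    then show ?thesis by simp
  qed
  then show "coeff (p * q) w = 0" unfolding coeff_mult by (intro sum.neutral) simp
qed

lemma order_ge_0: "order_ge 0 p"
  by (simp add: order_ge_def)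

lemma order_ge_sandwich: "order_ge n x \<Longrightarrow> order_ge n (p * x * q)"
  using order_ge_mult [OF order_ge_mult [OF order_ge_0 [of p]] order_ge_0 [of q]] by simp

lemma coeff_sandwich:
  assumes "order_ge n x" "length w = n"
  shows "coeff (p * x * q) w = coeff p [] * coeff q [] * coeff x w"
proof -
  have "coeff (p * x) w = coeff p [] * coeff x w"
  proof -
    have "coeff (p * x) w = (\<Sum>i\<le>n. if i = 0 then coeff p [] * coeff x w else 0)"
      unfolding coeff_mult assms(2)
      by (rule sum.cong) (use assms in \<open>auto simp: order_ge_def\<close>)
    then show ?thesis by simp
  qed
  moreover have "coeff (p * x * q) w = coeff (p * x) w * coeff q []"
  proof -
    have "order_ge n (p * x)" using order_ge_sandwich [OF assms(1), of p 1] by simp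
    then have "coeff (p * x * q) w = (\<Sum>i\<le>n. if i = n then coeff (p * x) w * coeff q [] else 0)"
      unfolding coeff_mult [of "p * x"] assms(2)
      by (intro sum.cong) (use assms(2) in \<open>auto simp: order_ge_def\<close>)
    then show ?thesis by simp
  qed
  ultimately show ?thesis by simp
qed

text \<open>
  On proper multilinear polynomials of degree \<open>n\<close> every endomorphism that commutes with the
  involution acts like such a substitution, so only these have to be checked.
\<close>

definition reduced_subst :: "nat \<Rightarrow> (letter \<Rightarrow> 'k::field fpoly) \<Rightarrow> bool"
  where "reduced_subst n \<phi> \<longleftrightarrow> (\<forall>i. fstar (\<phi> (Yv i)) = \<phi> (Yv i)) \<and>
    (\<forall>i. fstar (\<phi> (Zv i)) = - \<phi> (Zv i)) \<and> (\<forall>x. idx x < n \<longrightarrow> coeff (\<phi> x) [] = 0)"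

lemma skew_constant_term:
  assumes "fstar p = - p"
  shows "coeff p [] = (0 :: 'k::field_char_0)"
proof -
  have "coeff p [] = - coeff p []"
    using arg_cong [OF assms, of "\<lambda>q. coeff q []"] by (simp add: lookup_fstar word_sign_def)
  then show ?thesis by simp
qed

lemma endo_reduced_subst:
  fixes f :: "'k::field_char_0 fpoly"
  assumes "star_endo h" "f \<in> proper_multilin {..<n} {..<n}"
  obtains \<phi> where "reduced_subst n \<phi>" "h f = fsubst \<phi> f"
proof
  let ?\<phi> = "\<lambda>x. if x \<in> Yv ` {..<n} then h (var x) - fscale (coeff (h (var x)) []) 1 else h (var x)"
  have "h f = fsubst (\<lambda>x. h (var x)) f"
    using falg_hom.conv_fsubst [OF star_endo_hom [OF assms(1)]] by metis
  also have "\<dots> = fsubst ?\<phi> f"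
    by (rule fsubst_drop_constants [OF assms(2)]) simp_all
  finally show "h f = fsubst ?\<phi> f" .
  have Z: "coeff (h (z i)) [] = 0" for i
    by (rule skew_constant_term [OF star_endo_image_Zv [OF assms(1)]])
  have "coeff (?\<phi> x) [] = 0" if "idx x < n" for x
    by (cases x) (use that Z in \<open>auto simp: coeff_simps coeff_one\<close>)
  then show "reduced_subst n ?\<phi>"
    by (auto simp: reduced_subst_def star_endo_image_Yv [OF assms(1)]
        star_endo_image_Zv [OF assms(1)] fstar_diff fstar_fscale fstar_one)
qed

lemma reduced_subst_order_ge:
  assumes \<phi>: "reduced_subst n \<phi>" and f: "f \<in> multilin {..<n}"
  shows "order_ge n (fsubst \<phi> f)"
  using f unfolding multilin_def
proof (induction rule: free.span_induct_alt)
  case base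
  show ?case by (simp add: fsubst.zero order_ge_def)
next
  case (step c x y)
  then obtain w where w: "w \<in> mwords {..<n}" "x = monom w" by auto
  have "order_ge (length u) (prod_list (map \<phi> u))" if "idx ` set u \<subseteq> {..<n}" for u
    using that
  proof (induction u)
    case Nil
    show ?case by (simp add: order_ge_def)
  next
    case (Cons l u)
    have "order_ge 1 (\<phi> l)" using \<phi> Cons.prems by (auto simp: order_ge_def reduced_subst_def)
    then show ?case using order_ge_mult [of 1 "\<phi> l" "length u"] Cons by simp
  qed
  moreover have "idx ` set w \<subseteq> {..<n}" "length w = n"
    using w(1) length_mwords [OF w(1)] by (simp_all add: mwords_def)
  ultimately have "order_ge n (fsubst \<phi> x)" by (auto simp: w(2) fsubst_monom)
  then show ?case using step(2) by (simp add: fsubst.add fsubst.scale order_ge_def coeff_simps)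
qed

lemma endo_order_ge:
  fixes f :: "'k::field_char_0 fpoly"
  assumes "star_endo h" "f \<in> proper_multilin {..<n} {..<n}"
  shows "order_ge n (h f)"
proof -
  obtain \<phi> where "reduced_subst n \<phi>" "h f = fsubst \<phi> f"
    using endo_reduced_subst [OF assms] .
  moreover have "f \<in> multilin {..<n}" using assms(2) by (simp add: proper_multilin_def)
  ultimately show ?thesis using reduced_subst_order_ge by metis
qed

section \<open>Ideals defined by pairings\<close>

text \<open>
  The largest closed ideal annihilated by the pairing with all members of \<open>G\<close>, if \<open>G\<close> consists of
  symmetric and skew elements.
\<close>

definition pairing_ideal :: "'k::field fpoly set \<Rightarrow> 'k fpoly set"
  where "pairing_ideal G =
    {f. \<forall>h p q g. star_endo h \<longrightarrow> g \<in> G \<longrightarrow> pairing g (p * h f * q) = 0}"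

lemma pairing_left:
  "pairing (fscale c g) f = c * pairing g f" "pairing 0 f = 0"
proof -
  have "pairing (fscale c g) f = (\<Sum>w\<in>Poly_Mapping.keys g. coeff (fscale c g) w * coeff f w)"
    by (rule pairing_superset) (auto simp: in_keys_iff lookup_fscale)
  then show "pairing (fscale c g) f = c * pairing g f"
    by (simp add: pairing_def lookup_fscale sum_distrib_left mult.assoc)
qed (simp add: pairing_def)

lemma pairing_fstar: "pairing g (fstar f) = pairing (fstar g) (f :: 'k::field fpoly)"
proof (induction g rule: fpoly_induct)
  case (step c w p)
  have "fstar (monom w) = fscale (word_sign w) (monom (rev w) :: 'k fpoly)"
    by (rule poly_mapping_eqI) (auto simp: lookup_fstar lookup_fscale coeff_monom word_sign_rev)
  then show ?case using step
    by (simp add: pairing_add pairing_left fstar_simps pairing_monom lookup_fstar)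
qed (simp add: pairing_left fstar_zero)

lemma closed_ideal_pairing_ideal:
  assumes "\<And>g. g \<in> G \<Longrightarrow> fstar g = g \<or> fstar g = - (g :: 'k::field_char_0 fpoly)"
  shows "closed_ideal (pairing_ideal G)"
proof
  show "Tstar_ideal (pairing_ideal G)"
    unfolding Tstar_ideal_def
  proof (intro conjI ballI allI impI)
    show "free.subspace (pairing_ideal G)"
      unfolding free.subspace_def pairing_ideal_def
      by (auto simp: falg_hom.add [OF star_endo_hom] falg_hom.scale [OF star_endo_hom]
          falg_hom.zero [OF star_endo_hom] pairing_right distrib_left distrib_right
          fscale_mult_left fscale_mult_right)
  next
    fix f r assume f: "f \<in> pairing_ideal G"
    have "pairing g (p * h (r * f) * q) = 0" "pairing g (p * h (f * r) * q) = 0"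
      if "star_endo h" "g \<in> G" for h p q g
    proof -
      have "p * h (r * f) * q = (p * h r) * h f * q" "p * h (f * r) * q = p * h f * (h r * q)"
        by (simp_all add: falg_hom.mult [OF star_endo_hom [OF that(1)]] mult.assoc)
      then show "pairing g (p * h (r * f) * q) = 0" "pairing g (p * h (f * r) * q) = 0"
        using f that unfolding pairing_ideal_def by simp_all
    qed
    then show "r * f \<in> pairing_ideal G" "f * r \<in> pairing_ideal G"
      unfolding pairing_ideal_def by blast+
  next
    fix h :: "'k fpoly \<Rightarrow> 'k fpoly" assume h: "star_endo h"
    show "h ` pairing_ideal G \<subseteq> pairing_ideal G"
      unfolding pairing_ideal_def
    proof (safe)
      fix f p q g :: "'k fpoly" and h' :: "'k fpoly \<Rightarrow> 'k fpoly"
      assume "\<forall>h p q g. star_endo h \<longrightarrow> g \<in> G \<longrightarrow> pairing g (p * h f * q) = 0"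
        "star_endo h'" "g \<in> G"
      then show "pairing g (p * h' (h f) * q) = 0"
        using star_endo_comp [OF _ h, of h'] by blast
    qed
  qed
next
  fix f assume f: "f \<in> pairing_ideal G"
  show "fstar f \<in> pairing_ideal G"
    unfolding pairing_ideal_def
  proof (intro CollectI allI impI)
    fix h :: "'k fpoly \<Rightarrow> 'k fpoly" and p q g assume h: "star_endo h" and g: "g \<in> G"
    have "p * h (fstar f) * q = fstar (fstar q * h f * fstar p)"
      by (simp add: star_endo_fstar [OF h] fstar_simps mult.assoc)
    moreover have "pairing g (fstar q * h f * fstar p) = 0"
      using f h g unfolding pairing_ideal_def by blast
    ultimately show "pairing g (p * h (fstar f) * q) = 0"
      using assms [OF g] by (auto simp: pairing_fstar pairing_minus)
  qed
qed

lemma pairing_order_ge: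
  assumes "order_ge n f" "\<And>w. w \<in> Poly_Mapping.keys g \<Longrightarrow> length w < n"
  shows "pairing g f = 0"
  using assms by (simp add: pairing_def order_ge_def)

section \<open>Orthogonality of the components\<close>

lemma reduced_subst_coeffs:
  fixes \<phi> :: "letter \<Rightarrow> 'k::field_char_0 fpoly"
  assumes "reduced_subst n \<phi>"
  shows "coeff (\<phi> (Yv i)) [Zv j] = 0" "coeff (\<phi> (Zv i)) [Yv j] = 0"
    "i < n \<Longrightarrow> coeff (\<phi> (Yv i)) [] = 0" "coeff (\<phi> (Zv i)) [] = 0"
proof -
  have Y: "fstar (\<phi> (Yv i)) = \<phi> (Yv i)" and Z: "fstar (\<phi> (Zv i)) = - \<phi> (Zv i)"
    using assms by (simp_all add: reduced_subst_def)
  have "coeff (\<phi> (Yv i)) [Zv j] = - coeff (\<phi> (Yv i)) [Zv j]"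
    using arg_cong [OF Y, of "\<lambda>q. coeff q [Zv j]"] by (simp add: lookup_fstar word_sign_def)
  then show "coeff (\<phi> (Yv i)) [Zv j] = 0" by simp
  have "coeff (\<phi> (Zv i)) [Yv j] = - coeff (\<phi> (Zv i)) [Yv j]"
    using arg_cong [OF Z, of "\<lambda>q. coeff q [Yv j]"] by (simp add: lookup_fstar word_sign_def)
  then show "coeff (\<phi> (Zv i)) [Yv j] = 0" by simp
  show "coeff (\<phi> (Zv i)) [] = 0" by (rule skew_constant_term [OF Z])
  show "i < n \<Longrightarrow> coeff (\<phi> (Yv i)) [] = 0" using assms by (simp add: reduced_subst_def)
qed

lemmas coeff_expand = coeff_simps coeff_mult_short comm_def jord_def

lemma keys_multilin: "f \<in> multilin A \<Longrightarrow> Poly_Mapping.keys f \<subseteq> mwords A"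
  unfolding multilin_def
proof (induction rule: free.span_induct_alt)
  case (step c x y)
  have "Poly_Mapping.keys (fscale c x + y) \<subseteq> Poly_Mapping.keys x \<union> Poly_Mapping.keys y"
    by (auto simp: in_keys_iff coeff_simps)
  moreover have "Poly_Mapping.keys x \<subseteq> mwords A" using step(1) by (auto simp: monom_def)
  ultimately show ?case using step(2) by blast
qed simp

lemma length_multilin: "f \<in> multilin {..<n} \<Longrightarrow> w \<in> Poly_Mapping.keys f \<Longrightarrow> length w = n"
  using keys_multilin length_mwords by fastforce

lemma pairing_sandwich:
  assumes "g \<in> multilin {..<n}" "order_ge n x"
  shows "pairing g (p * x * q) = coeff p [] * coeff q [] * pairing g x"
  unfolding pairing_def sum_distrib_left
  by (rule sum.cong [OF refl])
    (simp add: coeff_sandwich [OF assms(2)] length_multilin [OF assms(1)] mult.left_commute)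

lemmas fsubst_gens = gen2.simps gen3.simps fsubst.add fsubst.diff fsubst.mult fsubst.comm
  fsubst.jord fsubst_var

lemma pairing_gen2_eq:
  "pairing (gen2 YY) f = coeff f [Yv 0, Yv 1] - coeff f [Yv 1, Yv 0]"
  "pairing (gen2 YZ) f = coeff f [Yv 0, Zv 1] - coeff f [Zv 1, Yv 0]"
  "pairing (gen2 ZZ_plus) f = coeff f [Zv 0, Zv 1] + coeff f [Zv 1, Zv 0]"
  "pairing (gen2 ZZ_minus) f = coeff f [Zv 0, Zv 1] - coeff f [Zv 1, Zv 0]"
  by (simp_all add: expand_words pairing_words)

text \<open>
  Distinct components are non-isomorphic representations, and the group and the involution preserve
  the pairing; so distinct components are orthogonal. Only the linear parts of the substituted
  elements contribute, and expanding the coefficients verifies the claim.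
\<close>

lemma gen2_orthogonal:
  fixes \<phi> :: "letter \<Rightarrow> 'k::field_char_0 fpoly"
  assumes "b \<noteq> b'" "reduced_subst 2 \<phi>"
  shows "pairing (gen2 b) (fsubst \<phi> (gen2 b')) = 0"
  using assms(1)
  by (cases b; cases b'; simp only: pairing_gen2_eq)
    (simp_all add: fsubst_gens coeff_expand reduced_subst_coeffs [OF assms(2)]
      algebra_simps del: One_nat_def)

lemma pairing_gen3_eq:
  "pairing (gen3 b) f = (case b of
     YYY \<Rightarrow> coeff f [Yv 1, Yv 2, Yv 0] - coeff f [Yv 2, Yv 1, Yv 0]
       - coeff f [Yv 0, Yv 1, Yv 2] + coeff f [Yv 0, Yv 2, Yv 1]
   | YYZ1 \<Rightarrow> coeff f [Yv 1, Yv 2, Zv 0] - coeff f [Yv 2, Yv 1, Zv 0]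
       + coeff f [Zv 0, Yv 1, Yv 2] - coeff f [Zv 0, Yv 2, Yv 1]
   | YYZ2 \<Rightarrow> coeff f [Yv 1, Yv 2, Zv 0] - coeff f [Yv 2, Yv 1, Zv 0]
       - coeff f [Zv 0, Yv 1, Yv 2] + coeff f [Zv 0, Yv 2, Yv 1]
   | YYZ3 \<Rightarrow> 2 * coeff f [Yv 1, Zv 0, Yv 2] - coeff f [Zv 0, Yv 1, Yv 2] - coeff f [Zv 0, Yv 2, Yv 1]
       - coeff f [Yv 2, Yv 1, Zv 0] - coeff f [Yv 1, Yv 2, Zv 0] + 2 * coeff f [Yv 2, Zv 0, Yv 1]
   | YZZ1 \<Rightarrow> coeff f [Yv 0, Zv 1, Zv 2] + coeff f [Yv 0, Zv 2, Zv 1]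
       - coeff f [Zv 1, Zv 2, Yv 0] - coeff f [Zv 2, Zv 1, Yv 0]
   | YZZ2 \<Rightarrow> coeff f [Yv 0, Zv 1, Zv 2] - coeff f [Yv 0, Zv 2, Zv 1]
       - coeff f [Zv 1, Zv 2, Yv 0] + coeff f [Zv 2, Zv 1, Yv 0]
   | YZZ3 \<Rightarrow> coeff f [Yv 0, Zv 1, Zv 2] - coeff f [Yv 0, Zv 2, Zv 1]
       + coeff f [Zv 1, Zv 2, Yv 0] - coeff f [Zv 2, Zv 1, Yv 0]
       - 2 * coeff f [Zv 1, Yv 0, Zv 2] + 2 * coeff f [Zv 2, Yv 0, Zv 1]
   | YZZ4 \<Rightarrow> coeff f [Yv 0, Zv 1, Zv 2] + coeff f [Yv 0, Zv 2, Zv 1]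
       + coeff f [Zv 1, Zv 2, Yv 0] + coeff f [Zv 2, Zv 1, Yv 0]
       - 2 * coeff f [Zv 1, Yv 0, Zv 2] - 2 * coeff f [Zv 2, Yv 0, Zv 1]
   | ZZZ_sym \<Rightarrow> coeff f [Zv 0, Zv 1, Zv 2] + coeff f [Zv 1, Zv 2, Zv 0] + coeff f [Zv 2, Zv 0, Zv 1]
       + coeff f [Zv 1, Zv 0, Zv 2] + coeff f [Zv 0, Zv 2, Zv 1] + coeff f [Zv 2, Zv 1, Zv 0]
   | ZZZ_alt \<Rightarrow> coeff f [Zv 0, Zv 1, Zv 2] + coeff f [Zv 1, Zv 2, Zv 0] + coeff f [Zv 2, Zv 0, Zv 1]
       - coeff f [Zv 1, Zv 0, Zv 2] - coeff f [Zv 0, Zv 2, Zv 1] - coeff f [Zv 2, Zv 1, Zv 0]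
   | ZZZ_plus \<Rightarrow> coeff f [Zv 1, Zv 2, Zv 0] + coeff f [Zv 2, Zv 1, Zv 0]
       - coeff f [Zv 0, Zv 1, Zv 2] - coeff f [Zv 0, Zv 2, Zv 1]
   | ZZZ_minus \<Rightarrow> coeff f [Zv 1, Zv 2, Zv 0] - coeff f [Zv 2, Zv 1, Zv 0]
       - coeff f [Zv 0, Zv 1, Zv 2] + coeff f [Zv 0, Zv 2, Zv 1])"
  by (cases b) (simp_all add: expand_words pairing_words)

lemma gen3_orthogonal:
  fixes \<phi> :: "letter \<Rightarrow> 'k::field_char_0 fpoly"
  assumes "b \<noteq> b'" "reduced_subst 3 \<phi>"
  shows "pairing (gen3 b) (fsubst \<phi> (gen3 b')) = 0"
  using assms(1)
  by (cases b'; cases b; simp only: pairing_gen3_eq irr3.case)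
    (simp_all add: fsubst_gens coeff_expand reduced_subst_coeffs [OF assms(2)]
      algebra_simps del: One_nat_def)

section \<open>Which components an identity of degree two leaves alone\<close>

text \<open>
  No consequence of the identity \<^term>\<open>gen2 m\<close> is seen by the pairing with \<^term>\<open>gen3 b\<close>. The
  type argument fixes the field.
\<close>

definition untouched :: "irr3 \<Rightarrow> irr2 \<Rightarrow> 'k::field itself \<Rightarrow> bool"
  where "untouched b m _ \<longleftrightarrow> (\<forall>h p q. star_endo h \<longrightarrow>
    pairing (gen3 b) (p * h (gen2 m) * q) = (0 :: 'k))"

lemma reduced_subst_coeffs2:
  fixes \<phi> :: "letter \<Rightarrow> 'k::field_char_0 fpoly"
  assumes "reduced_subst n \<phi>"
  shows "coeff (\<phi> (Yv k)) [Yv i, Yv j] = coeff (\<phi> (Yv k)) [Yv j, Yv i]"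
    "coeff (\<phi> (Yv k)) [Zv i, Zv j] = coeff (\<phi> (Yv k)) [Zv j, Zv i]"
    "coeff (\<phi> (Yv k)) [Zv i, Yv j] = - coeff (\<phi> (Yv k)) [Yv j, Zv i]"
    "coeff (\<phi> (Zv k)) [Yv i, Yv j] = - coeff (\<phi> (Zv k)) [Yv j, Yv i]"
    "coeff (\<phi> (Zv k)) [Zv i, Zv j] = - coeff (\<phi> (Zv k)) [Zv j, Zv i]"
    "coeff (\<phi> (Zv k)) [Zv i, Yv j] = coeff (\<phi> (Zv k)) [Yv j, Zv i]"
proof -
  have Y: "fstar (\<phi> (Yv k)) = \<phi> (Yv k)" and Z: "fstar (\<phi> (Zv k)) = - \<phi> (Zv k)"
    using assms by (simp_all add: reduced_subst_def)
  have Y': "coeff (\<phi> (Yv k)) w = word_sign w * coeff (\<phi> (Yv k)) (rev w)" for w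
    using arg_cong [OF Y, of "\<lambda>q. coeff q w"] by (simp add: lookup_fstar)
  have Z': "coeff (\<phi> (Zv k)) w = - (word_sign w * coeff (\<phi> (Zv k)) (rev w))" for w
    using arg_cong [OF Z, of "\<lambda>q. coeff q w"] by (simp add: lookup_fstar)
  show "coeff (\<phi> (Yv k)) [Yv i, Yv j] = coeff (\<phi> (Yv k)) [Yv j, Yv i]"
    "coeff (\<phi> (Yv k)) [Zv i, Zv j] = coeff (\<phi> (Yv k)) [Zv j, Zv i]"
    "coeff (\<phi> (Yv k)) [Zv i, Yv j] = - coeff (\<phi> (Yv k)) [Yv j, Zv i]"
    by (subst Y', simp add: word_sign_def)+
  show "coeff (\<phi> (Zv k)) [Yv i, Yv j] = - coeff (\<phi> (Zv k)) [Yv j, Yv i]"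
    "coeff (\<phi> (Zv k)) [Zv i, Zv j] = - coeff (\<phi> (Zv k)) [Zv j, Zv i]"
    "coeff (\<phi> (Zv k)) [Zv i, Yv j] = coeff (\<phi> (Zv k)) [Yv j, Zv i]"
    by (subst Z', simp add: word_sign_def)+
qed

lemma untouchedI:
  assumes "\<And>\<phi> p q. reduced_subst 2 \<phi> \<Longrightarrow> pairing (gen3 b) (p * fsubst \<phi> (gen2 m) * q) = (0 :: 'k::field_char_0)"
  shows "untouched b m TYPE('k)"
  unfolding untouched_def
proof (intro allI impI)
  fix h :: "'k fpoly \<Rightarrow> 'k fpoly" and p q
  assume h: "star_endo h"
  have "gen2 m \<in> (proper_multilin {..<2} {..<2} :: 'k fpoly set)"
    using gen2_Gam Gam_subset_proper_multilin by blast
  then obtain \<phi> where "reduced_subst 2 \<phi>" "h (gen2 m) = fsubst \<phi> (gen2 m)"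
    using endo_reduced_subst [OF h] by metis
  then show "pairing (gen3 b) (p * h (gen2 m) * q) = 0" using assms by metis
qed

text \<open>
  The linear part of a symmetric element contains no skew variables and that of a skew element no
  symmetric ones, while the quadratic parts are symmetric or alternating under reversal of words, up
  to the signs of the letters. Expanding the coefficients of the words in the generators, everything
  cancels.
\<close>

lemma untouched:
  assumes "m = YY \<and> b \<in> {YZZ2, YZZ3, YZZ4, ZZZ_sym, ZZZ_alt, ZZZ_plus, ZZZ_minus} \<or>
    m = YZ \<and> b \<in> {ZZZ_sym, ZZZ_alt, ZZZ_minus} \<or> m = ZZ_plus \<and> b \<in> {YYY, YYZ3} \<or>
    m = ZZ_minus \<and> b \<in> {YYY, YYZ3, ZZZ_sym}"
  shows "untouched b m TYPE('k::field_char_0)"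
proof (rule untouchedI)
  fix \<phi> :: "letter \<Rightarrow> 'k fpoly" and p q
  assume \<phi>: "reduced_subst 2 \<phi>"
  note sym = reduced_subst_coeffs2 [OF \<phi>]
  show "pairing (gen3 b) (p * fsubst \<phi> (gen2 m) * q) = 0"
    using assms
    by (elim disjE conjE insertE emptyE; simp only: pairing_gen3_eq irr3.case)
      (simp_all add: fsubst_gens coeff_expand reduced_subst_coeffs [OF \<phi>]
        sym [of _ 2 1] sym [of _ 2 0] sym [of _ 1 0] algebra_simps del: One_nat_def)
qed

section \<open>The ideals with prescribed components\<close>

text \<open>
  Outside the ideal remain exactly the components in \<open>B\<close> of degree three and, if \<open>B\<close> does not
  force further ones, exactly those in \<open>D\<close> of degree two. All proper polynomials of degree at least
  four belong to the ideal, because the pairings only see words of length two and three.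
\<close>

definition component_ideal :: "irr2 set \<Rightarrow> irr3 set \<Rightarrow> 'k::field fpoly set"
  where "component_ideal D B = pairing_ideal (gen2 ` D \<union> gen3 ` B)"

lemma closed_ideal_component_ideal: "closed_ideal (component_ideal D B)"
  unfolding component_ideal_def
proof (rule closed_ideal_pairing_ideal)
  have "fstar (gen2 b) = gen2 b \<or> fstar (gen2 b) = - (gen2 b :: 'k::field_char_0 fpoly)" for b
    by (cases b) (simp_all add: star_products)
  moreover have "fstar (gen3 b) = gen3 b \<or> fstar (gen3 b) = - (gen3 b :: 'k::field_char_0 fpoly)" for b
    by (cases b) (simp_all add: gen3_fstar del: gen3.simps)
  ultimately show "fstar g = g \<or> fstar g = - g"
    if "g \<in> gen2 ` D \<union> gen3 ` B" for g :: "'a fpoly"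
    using that by auto
qed

lemma component_idealD:
  assumes "f \<in> component_ideal D B" "g \<in> gen2 ` D \<union> gen3 ` B"
  shows "pairing g f = 0"
proof -
  have "pairing g (1 * (\<lambda>p. p) f * 1) = 0"
    using assms star_endo_id unfolding component_ideal_def pairing_ideal_def by blast
  then show ?thesis by simp
qed

lemma gen2_proper: "gen2 m \<in> proper_multilin {..<2} {..<2}" "gen2 m \<in> multilin {..<2}"
  and gen3_proper: "gen3 b \<in> proper_multilin {..<3} {..<3}" "gen3 b \<in> multilin {..<3}"
  using gen2_Gam gen3_Gam Gam_subset_proper_multilin by (auto simp: Gam_def Vstar_conv_multilin)

lemma pairing_component_high:
  assumes "star_endo h" "f \<in> proper_multilin {..<k} {..<k}" "g \<in> multilin {..<n}" "n < k"
  shows "pairing g (p * h f * q) = (0 :: 'k::field_char_0)"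
  using order_ge_sandwich [OF endo_order_ge [OF assms(1,2)], of p q] length_multilin [OF assms(3)]
    assms(4) by (auto intro: pairing_order_ge)

lemma pairing_component_equal:
  assumes f: "f \<in> proper_multilin {..<n} {..<n}" and g: "g \<in> multilin {..<n}"
    and orth: "\<And>\<phi>. reduced_subst n \<phi> \<Longrightarrow> pairing g (fsubst \<phi> f) = 0" and h: "star_endo h"
  shows "pairing g (p * h f * q) = (0 :: 'k::field_char_0)"
proof -
  obtain \<phi> where "reduced_subst n \<phi>" "h f = fsubst \<phi> f"
    using endo_reduced_subst [OF h f] by metis
  then show ?thesis using orth pairing_sandwich [OF g endo_order_ge [OF h f]] by simp
qed

lemma component_idealI:
  fixes f :: "'k::field_char_0 fpoly"
  assumes "\<And>h p q m. star_endo h \<Longrightarrow> m \<in> D \<Longrightarrow> pairing (gen2 m) (p * h f * q) = 0"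
    and "\<And>h p q b. star_endo h \<Longrightarrow> b \<in> B \<Longrightarrow> pairing (gen3 b) (p * h f * q) = 0"
  shows "f \<in> component_ideal D B"
  unfolding component_ideal_def pairing_ideal_def using assms by blast

lemma high_in_component_ideal:
  assumes "f \<in> proper_multilin {..<k} {..<k}" "3 < k"
  shows "f \<in> (component_ideal D B :: 'k::field_char_0 fpoly set)"
  using assms by (intro component_idealI pairing_component_high [OF _ assms(1) gen2_proper(2)]
      pairing_component_high [OF _ assms(1) gen3_proper(2)]) simp_all

lemma gen3_component_ideal_iff:
  "gen3 b \<in> (component_ideal D B :: 'k::field_char_0 fpoly set) \<longleftrightarrow> b \<notin> B"
proof
  assume "gen3 b \<in> (component_ideal D B :: 'k fpoly set)"
  then show "b \<notin> B" using component_idealD pairing_gen3 by blast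
next
  assume b: "b \<notin> B"
  show "gen3 b \<in> (component_ideal D B :: 'k fpoly set)"
  proof (rule component_idealI)
    fix h :: "'k fpoly \<Rightarrow> 'k fpoly" and p q m b'
    assume h: "star_endo h"
    show "pairing (gen2 m) (p * h (gen3 b) * q) = 0"
      by (rule pairing_component_high [OF h gen3_proper(1) gen2_proper(2)]) simp
    assume "b' \<in> B"
    then have "b' \<noteq> b" using b by blast
    then show "pairing (gen3 b') (p * h (gen3 b) * q) = 0"
      by (intro pairing_component_equal [OF gen3_proper gen3_orthogonal h])
  qed
qed

lemma gen2_component_ideal_iff:
  assumes "\<And>m b. m \<notin> D \<Longrightarrow> b \<in> B \<Longrightarrow> untouched b m TYPE('k::field_char_0)"
  shows "gen2 m \<in> (component_ideal D B :: 'k fpoly set) \<longleftrightarrow> m \<notin> D"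
proof
  assume "gen2 m \<in> (component_ideal D B :: 'k fpoly set)"
  then show "m \<notin> D" using component_idealD pairing_gen2 by blast
next
  assume m: "m \<notin> D"
  show "gen2 m \<in> (component_ideal D B :: 'k fpoly set)"
  proof (rule component_idealI)
    fix h :: "'k fpoly \<Rightarrow> 'k fpoly" and p q m' b
    assume h: "star_endo h"
    show "pairing (gen2 m') (p * h (gen2 m) * q) = 0" if "m' \<in> D"
    proof -
      have "m' \<noteq> m" using m that by blast
      then show ?thesis by (intro pairing_component_equal [OF gen2_proper gen2_orthogonal h])
    qed
    show "pairing (gen3 b) (p * h (gen2 m) * q) = 0" if "b \<in> B"
      using assms [OF m that] h unfolding untouched_def by blast
  qed
qed

lemma proper_codim_component_ideal:
  "proper_codim (component_ideal D B :: 'k::field_char_0 fpoly set) 3 = sum deg3 B"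
  "3 < k \<Longrightarrow> proper_codim (component_ideal D B :: 'k fpoly set) k = 0"
proof -
  show "proper_codim (component_ideal D B :: 'k::field_char_0 fpoly set) 3 = sum deg3 B"
    by (simp add: proper_codim_3 [OF closed_ideal_component_ideal] gen3_component_ideal_iff
        sum.inter_restrict [symmetric] del: gen3.simps)
  assume k: "3 < k"
  then have "proper_multilin {..<k} {..<k} \<inter> component_ideal D B =
      (proper_multilin {..<k} {..<k} \<inter> UNIV :: 'k fpoly set)"
    using high_in_component_ideal by blast
  then show "proper_codim (component_ideal D B :: 'k fpoly set) k = 0"
    by (simp add: proper_codim_def proper_dim_def)
qed

lemma proper_codim_2_component_ideal:
  assumes "\<And>m b. m \<notin> D \<Longrightarrow> b \<in> B \<Longrightarrow> untouched b m TYPE('k::field_char_0)"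
  shows "proper_codim (component_ideal D B :: 'k fpoly set) 2 = sum deg2 D"
  by (simp add: proper_codim_2 [OF closed_ideal_component_ideal] gen2_component_ideal_iff [OF assms]
      sum.inter_restrict [symmetric] del: gen2.simps)

section \<open>Relatively free algebras\<close>

context closed_ideal
begin

definition cls :: "'k fpoly \<Rightarrow> 'k fpoly set"
  where "cls p = {q. q - p \<in> I}"

definition rep :: "'k fpoly set \<Rightarrow> 'k fpoly"
  where "rep X = (SOME p. p \<in> X)"

definition rel_free :: "('k, 'k fpoly set) module"
  where "rel_free = \<lparr>carrier = range cls, mult = (\<lambda>X Y. cls (rep X * rep Y)), one = cls 1,
    zero = cls 0, add = (\<lambda>X Y. cls (rep X + rep Y)), smult = (\<lambda>c X. cls (fscale c (rep X)))\<rparr>"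

definition rel_free_star :: "'k fpoly set \<Rightarrow> 'k fpoly set"
  where "rel_free_star X = cls (fstar (rep X))"

lemma cls_eq_iff: "cls p = cls q \<longleftrightarrow> p - q \<in> I"
proof
  assume "cls p = cls q"
  moreover have "p \<in> cls p" by (simp add: cls_def zero)
  ultimately show "p - q \<in> I" by (simp add: cls_def)
next
  assume pq: "p - q \<in> I"
  have "r - q \<in> I" if "r - p \<in> I" for r using add [OF that pq] by simp
  moreover have "r - p \<in> I" if "r - q \<in> I" for r using diff [OF that pq] by simp
  ultimately show "cls p = cls q" by (auto simp: cls_def)
qed

lemma rep_cls: "rep (cls p) - p \<in> I"
proof -
  have "p \<in> cls p" by (simp add: cls_def zero)
  then have "rep (cls p) \<in> cls p" unfolding rep_def by (rule someI)
  then show ?thesis by (simp add: cls_def)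
qed

lemma cls_rep: "cls (rep (cls p)) = cls p"
  by (simp add: cls_eq_iff rep_cls)

lemma rel_free_simps:
  "carrier rel_free = range cls" "\<one>\<^bsub>rel_free\<^esub> = cls 1" "\<zero>\<^bsub>rel_free\<^esub> = cls 0"
  "cls p \<otimes>\<^bsub>rel_free\<^esub> cls q = cls (p * q)" "cls p \<oplus>\<^bsub>rel_free\<^esub> cls q = cls (p + q)"
  "c \<odot>\<^bsub>rel_free\<^esub> cls p = cls (fscale c p)" "rel_free_star (cls p) = cls (fstar p)"
proof -
  have "rep (cls p) * rep (cls q) - p * q = (rep (cls p) - p) * rep (cls q) + p * (rep (cls q) - q)"
    by (simp add: algebra_simps)
  then have "rep (cls p) * rep (cls q) - p * q \<in> I"
    by (simp only: add left right rep_cls)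
  then show "cls p \<otimes>\<^bsub>rel_free\<^esub> cls q = cls (p * q)"
    by (simp add: rel_free_def cls_eq_iff)
  have "rep (cls p) + rep (cls q) - (p + q) = (rep (cls p) - p) + (rep (cls q) - q)" by simp
  then have "rep (cls p) + rep (cls q) - (p + q) \<in> I" by (simp only: add rep_cls)
  then show "cls p \<oplus>\<^bsub>rel_free\<^esub> cls q = cls (p + q)" by (simp add: rel_free_def cls_eq_iff)
  have "fscale c (rep (cls p)) - fscale c p = fscale c (rep (cls p) - p)"
    by (simp add: free.scale_right_diff_distrib)
  then have "fscale c (rep (cls p)) - fscale c p \<in> I" by (simp only: scale rep_cls)
  then show "c \<odot>\<^bsub>rel_free\<^esub> cls p = cls (fscale c p)" by (simp add: rel_free_def cls_eq_iff)
  have "fstar (rep (cls p)) - fstar p \<in> I" using star [OF rep_cls [of p]] by (simp add: fstar_diff)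
  then show "rel_free_star (cls p) = cls (fstar p)" by (simp add: rel_free_star_def cls_eq_iff)
qed (simp_all add: rel_free_def)

lemma cring_scalar_ring: "cring (scalar_ring :: 'k ring)"
proof (rule cringI)
  show "abelian_group (scalar_ring :: 'k ring)"
  proof (rule abelian_groupI)
    fix x :: 'k assume "x \<in> carrier scalar_ring"
    show "\<exists>y\<in>carrier scalar_ring. y \<oplus>\<^bsub>scalar_ring\<^esub> x = \<zero>\<^bsub>scalar_ring\<^esub>"
      by (rule bexI [of _ "- x"]) (simp_all add: scalar_ring_def)
  qed (simp_all add: scalar_ring_def)
  show "comm_monoid (scalar_ring :: 'k ring)"
    by (rule comm_monoidI) (simp_all add: scalar_ring_def)
qed (simp_all add: scalar_ring_def distrib_right)

lemma abelian_group_rel_free: "abelian_group rel_free"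
proof (rule abelian_groupI)
  fix x assume "x \<in> carrier rel_free"
  then obtain p where "x = cls p" by (auto simp: rel_free_simps)
  then show "\<exists>y\<in>carrier rel_free. y \<oplus>\<^bsub>rel_free\<^esub> x = \<zero>\<^bsub>rel_free\<^esub>"
    by (intro bexI [of _ "cls (- p)"]) (simp_all add: rel_free_simps)
qed (auto simp: rel_free_simps add_ac)

lemma star_algebra_rel_free: "star_algebra rel_free rel_free_star"
proof -
  have "ring rel_free"
    by (rule ringI [OF abelian_group_rel_free])
      (auto intro!: monoidI simp: rel_free_simps mult.assoc distrib_left distrib_right)
  moreover have "module scalar_ring rel_free"
  proof (rule moduleI [OF cring_scalar_ring abelian_group_rel_free])
    show "(a \<otimes>\<^bsub>scalar_ring\<^esub> b) \<odot>\<^bsub>rel_free\<^esub> x = a \<odot>\<^bsub>rel_free\<^esub> (b \<odot>\<^bsub>rel_free\<^esub> x)"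
      if "x \<in> carrier rel_free" for a b x
      using that by (auto simp: rel_free_simps scalar_ring_def)
  qed (auto simp: rel_free_simps scalar_ring_def free.scale_left_distrib free.scale_right_distrib)
  moreover have "star_algebra_axioms rel_free rel_free_star"
    by standard (auto simp: rel_free_simps fscale_mult_left fscale_mult_right fstar_simps)
  ultimately show ?thesis by (simp add: star_algebra_def)
qed

lemma poly_value_rel_free: "poly_value rel_free (\<lambda>x. cls (\<psi> x)) p = cls (fsubst \<psi> p)"
proof (induction p rule: fpoly_induct)
  case zero
  interpret A: star_algebra rel_free rel_free_star by (rule star_algebra_rel_free)
  show ?case by (simp add: A.poly_value_zero rel_free_simps fsubst.zero)
next
  case (step c w p)
  interpret A: star_algebra rel_free rel_free_star by (rule star_algebra_rel_free)
  have carrier: "cls (\<psi> x) \<in> carrier rel_free" for x by (simp add: rel_free_simps)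
  have "word_value rel_free (\<lambda>x. cls (\<psi> x)) w = cls (fsubst \<psi> (monom w))"
    by (induction w) (simp_all add: word_value_def rel_free_simps monom_Nil fsubst.one monom_Cons
        fsubst.mult fsubst_var)
  then show ?case
    using step
    by (simp add: A.poly_value_add [OF carrier] A.poly_value_fscale [OF carrier]
        A.poly_value_monom [OF carrier] rel_free_simps fsubst.add fsubst.scale)
qed

text \<open>
  Symmetric and skew classes have symmetric and skew representatives, so evaluations in the quotient
  lift to endomorphisms of the free algebra, under which \<open>I\<close> is invariant.
\<close>

theorem Id_star_rel_free: "Id_star rel_free rel_free_star = I"
proof (intro equalityI subsetI)
  interpret A: star_algebra rel_free rel_free_star by (rule star_algebra_rel_free)
  have neg: "\<ominus>\<^bsub>rel_free\<^esub> cls p = cls (- p)" for p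
    using A.smult_minus_1 [of "cls p"] by (simp add: rel_free_simps)
  {
    fix f assume "f \<in> Id_star rel_free rel_free_star"
    then have "poly_value rel_free (\<lambda>x. cls (var x)) f = \<zero>\<^bsub>rel_free\<^esub>"
      by (rule A.Id_starD) (simp_all add: rel_free_simps fstar_Yv fstar_Zv neg)
    then show "f \<in> I"
      by (simp add: poly_value_rel_free fsubst_var_id rel_free_simps cls_eq_iff)
  }
  fix f assume f: "f \<in> I"
  show "f \<in> Id_star rel_free rel_free_star"
  proof (rule A.Id_starI)
    fix \<phi> assume \<phi>: "\<And>x. \<phi> x \<in> carrier rel_free"
      and Y: "\<And>i. rel_free_star (\<phi> (Yv i)) = \<phi> (Yv i)"
      and Z: "\<And>i. rel_free_star (\<phi> (Zv i)) = \<ominus>\<^bsub>rel_free\<^esub> \<phi> (Zv i)"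
    define r where "r x = rep (\<phi> x)" for x
    have r: "\<phi> x = cls (r x)" for x
    proof -
      obtain p where "\<phi> x = cls p" using \<phi> [of x] unfolding rel_free_simps by blast
      then show ?thesis by (simp add: r_def cls_rep)
    qed
    \<comment> \<open>the symmetric or skew part of an arbitrary representative\<close>
    define \<psi> where "\<psi> x = (case x of
        Yv i \<Rightarrow> fscale (1 / 2) (r x + fstar (r x)) | Zv i \<Rightarrow> fscale (1 / 2) (r x - fstar (r x)))" for x
    have "fsubst \<psi> f \<in> I"
      by (rule endo [OF star_endo_fsubst f])
        (simp_all add: \<psi>_def fstar_simps add.commute free.scale_right_diff_distrib)
    moreover have "\<phi> x = cls (\<psi> x)" for x
    proof (cases x)
      case (Yv i)
      have "fstar (r x) - r x \<in> I" using Y [of i] by (simp add: Yv r rel_free_simps cls_eq_iff)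
      then have "fscale (- 1 / 2) (fstar (r x) - r x) \<in> I" by (rule scale)
      moreover have "fscale (- 1 / 2) (fstar (r x) - r x) = r x - \<psi> x"
        by (rule poly_mapping_eqI) (simp add: \<psi>_def Yv coeff_simps field_simps)
      ultimately show ?thesis by (simp add: r cls_eq_iff)
    next
      case (Zv i)
      have "fstar (r x) - - r x \<in> I" using Z [of i] by (simp add: Zv r rel_free_simps neg cls_eq_iff)
      then have "fscale (1 / 2) (fstar (r x) - - r x) \<in> I" by (rule scale)
      moreover have "fscale (1 / 2) (fstar (r x) - - r x) = r x - \<psi> x"
        by (rule poly_mapping_eqI) (simp add: \<psi>_def Zv coeff_simps field_simps)
      ultimately show ?thesis by (simp add: r cls_eq_iff)
    qed
    then have "\<phi> = (\<lambda>x. cls (\<psi> x))" by blast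
    ultimately show "poly_value rel_free \<phi> f = \<zero>\<^bsub>rel_free\<^esub>"
      by (simp add: poly_value_rel_free rel_free_simps cls_eq_iff)
  qed
qed

end

section \<open>Growth\<close>

lemma choose_2_3:
  "real (n choose 2) = real n * (real n - 1) / 2"
  "real (n choose 3) = real n * (real n - 1) * (real n - 2) / 6"
  by (simp_all add: binomial_gbinomial gbinomial_prod_rev numeral_2_eq_2 numeral_3_eq_3
      lessThan_Suc atLeast0LessThan algebra_simps)

lemma poly_growth_cubic:
  assumes "q \<noteq> 0" "\<And>n. c n = 1 + (n choose 1) + p * (n choose 2) + q * (n choose 3)"
  shows "poly_growth c 3"
  unfolding poly_growth_def
proof (intro exI conjI)
  show "0 < real q / 6" using assms(1) by simp
  show "(\<lambda>n. real (c n) - real q / 6 * real n ^ 3) \<in> O(\<lambda>n. real n powi (int 3 - 1))"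
  proof (rule bigoI)
    have "norm (real (c n) - real q / 6 * real n ^ 3) \<le> (2 + p + q) * norm (real n powi (int 3 - 1))"
      if "n \<ge> 1" for n
    proof -
      have n: "1 \<le> real n" "real n \<le> real n ^ 2" using that by (simp_all add: power2_eq_square)
      have "real (c n) - real q / 6 * real n ^ 3 =
          1 + real n + real p * (real n ^ 2 - real n) / 2 - real q * (3 * real n ^ 2 - 2 * real n) / 6"
        by (simp add: assms(2) choose_2_3 power2_eq_square power3_eq_cube field_simps)
      also have "\<bar>\<dots>\<bar> \<le> 1 + real n + real p * real n ^ 2 + real q * real n ^ 2"
      proof -
        define a b where "a = real p * (real n ^ 2 - real n)"
          and "b = real q * (3 * real n ^ 2 - 2 * real n)"
        have "0 \<le> a" "a \<le> real p * real n ^ 2"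
          unfolding a_def using n by (auto intro!: mult_nonneg_nonneg mult_left_mono)
        moreover have "0 \<le> b"
          unfolding b_def using n by (intro mult_nonneg_nonneg) linarith+
        moreover have "b \<le> 3 * (real q * real n ^ 2)"
          unfolding b_def by (simp add: algebra_simps)
        moreover have "0 \<le> real p * real n ^ 2" "0 \<le> real q * real n ^ 2" by simp_all
        ultimately have "\<bar>1 + real n + a / 2 - b / 6\<bar> \<le>
            1 + real n + real p * real n ^ 2 + real q * real n ^ 2"
          using n by linarith
        then show ?thesis by (simp add: a_def b_def)
      qed
      also have "\<dots> \<le> (2 + p + q) * real n ^ 2"
        using n by (simp only: of_nat_add of_nat_numeral distrib_right)
      finally show ?thesis by simp
    qed
    then show "\<forall>\<^sub>F n in sequentially. norm (real (c n) - real q / 6 * real n ^ 3) \<le>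
        (2 + p + q) * norm (real n powi (int 3 - 1))"
      using eventually_at_top_linorder by blast
  qed
qed

lemma poly_growth_3E:
  assumes "poly_growth c 3"
  obtains q K N where "q > 0" "K > 0"
    "\<And>n. n \<ge> N \<Longrightarrow> \<bar>real (c n) - q * real n ^ 3\<bar> \<le> K * real n ^ 2"
proof -
  obtain q where q: "q > 0" "(\<lambda>n. real (c n) - q * real n ^ 3) \<in> O(\<lambda>n. real n powi (int 3 - 1))"
    using assms unfolding poly_growth_def by blast
  then obtain K where K: "K > 0" "\<forall>\<^sub>F n in sequentially.
      norm (real (c n) - q * real n ^ 3) \<le> K * norm (real n powi (int 3 - 1))"
    by (elim landau_o.bigE)
  then obtain N where N: "\<And>n. n \<ge> N \<Longrightarrow>
      norm (real (c n) - q * real n ^ 3) \<le> K * norm (real n powi (int 3 - 1))"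
    unfolding eventually_at_top_linorder by blast
  show ?thesis
  proof (rule that [OF q(1) K(1)])
    fix n assume "n \<ge> N"
    then show "\<bar>real (c n) - q * real n ^ 3\<bar> \<le> K * real n ^ 2" using N [of n] by simp
  qed
qed

text \<open>
  A non-zero \<open>g k\<close> with \<open>k > 3\<close> would make the sequence grow at least like \<open>n ^ 4\<close>, and without
  \<open>g 3\<close> it would be bounded by a multiple of \<open>n ^ 2\<close>.
\<close>

lemma cubic_growth_coefficients:
  assumes c: "\<And>n. c n = (\<Sum>k\<le>n. (n choose k) * g k)" and growth: "poly_growth c 3"
  shows "k > 3 \<Longrightarrow> g k = 0" and "g 3 \<noteq> 0"
proof -
  obtain q K N where qK: "q > 0" "K > 0"
    and N: "\<And>n. n \<ge> N \<Longrightarrow> \<bar>real (c n) - q * real n ^ 3\<bar> \<le> K * real n ^ 2"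
    by (rule poly_growth_3E [OF growth]) (rule that)
  show high: "g k = 0" if "k > 3" for k
  proof (rule ccontr)
    assume "g k \<noteq> 0"
    \<comment> \<open>beyond the range of the asymptotic estimate and beyond the point where \<open>n ^ 4\<close> wins\<close>
    define n where "n = N + k + nat \<lceil>(q + K) * real k ^ 4\<rceil> + 1"
    have n: "n \<ge> N" "k \<le> n" "1 \<le> n" "(q + K) * real k ^ 4 < real n"
      unfolding n_def by linarith+
    have "(real n / real k) ^ 4 \<le> (real n / real k) ^ k"
      using n that by (intro power_increasing) auto
    also have "\<dots> \<le> real (n choose k)"
      using binomial_ge_n_over_k_pow_k [OF n(2), where 'a = real] by simp
    also have "\<dots> \<le> real (c n)"
    proof -
      have "(n choose k) * 1 \<le> (n choose k) * g k" using \<open>g k \<noteq> 0\<close> by (intro mult_le_mono2) simp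
      also have "\<dots> \<le> c n" unfolding c using n(2) by (intro member_le_sum) auto
      finally show ?thesis by simp
    qed
    also have "\<dots> \<le> q * real n ^ 3 + K * real n ^ 2" using N [OF n(1)] by linarith
    also have "\<dots> \<le> q * real n ^ 3 + K * real n ^ 3"
      using qK n(3) by (intro add_left_mono mult_left_mono power_increasing) auto
    finally have "real n ^ 4 / real k ^ 4 \<le> (q + K) * real n ^ 3"
      by (simp add: power_divide distrib_right)
    then have "real n * real n ^ 3 \<le> ((q + K) * real k ^ 4) * real n ^ 3"
      using that by (simp add: divide_le_eq power4_eq_xxxx power3_eq_cube mult_ac)
    then have "real n \<le> (q + K) * real k ^ 4"
      using n(3) by (subst (asm) mult_le_cancel_right_pos) auto
    then show False using n(4) by simp
  qed
  show "g 3 \<noteq> 0"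
  proof
    assume g3: "g 3 = 0"
    define G where "G = real (g 0 + g 1 + g 2)"
    \<comment> \<open>beyond the range of the asymptotic estimate and beyond the point where \<open>n ^ 3\<close> wins\<close>
    define n where "n = N + nat \<lceil>(G + K) / q\<rceil> + 2"
    have n: "n \<ge> N" "2 \<le> n" "(G + K) / q < real n"
      unfolding n_def by linarith+
    have "c n = (\<Sum>k\<in>{0, 1, 2}. (n choose k) * g k)"
      unfolding c
    proof (rule sum.mono_neutral_right)
      show "\<forall>i\<in>{..n} - {0, 1, 2}. (n choose i) * g i = 0"
      proof
        fix i assume "i \<in> {..n} - {0, 1, 2}"
        then have "i = 3 \<or> i > 3" by auto
        then show "(n choose i) * g i = 0" using g3 high by auto
      qed
    qed (use n in auto)
    then have "real (c n) = g 0 + real n * g 1 + real n * (real n - 1) / 2 * g 2"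
      using choose_2_3(1) [of n] by simp
    also have "\<dots> \<le> real n ^ 2 * g 0 + real n ^ 2 * g 1 + real n ^ 2 * g 2"
    proof -
      have "1 \<le> real n ^ 2" "real n \<le> real n ^ 2" "real n * (real n - 1) / 2 \<le> real n ^ 2"
      proof -
        show one: "1 \<le> real n ^ 2" and le: "real n \<le> real n ^ 2"
          using n(2) by (auto simp: power2_eq_square intro: one_le_power [of _ 2, unfolded power2_eq_square])
        show "real n * (real n - 1) / 2 \<le> real n ^ 2"
          using one le by (simp add: power2_eq_square field_simps)
      qed
      then have "1 * real (g 0) \<le> real n ^ 2 * g 0" "real n * g 1 \<le> real n ^ 2 * g 1"
        "real n * (real n - 1) / 2 * g 2 \<le> real n ^ 2 * g 2"
        by (intro mult_right_mono; simp)+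
      then show ?thesis by simp
    qed
    finally have "real (c n) \<le> G * real n ^ 2" by (simp add: G_def algebra_simps)
    then have "q * real n ^ 3 \<le> (G + K) * real n ^ 2"
      using N [OF n(1)] unfolding distrib_right by linarith
    then have "(q * real n) * real n ^ 2 \<le> (G + K) * real n ^ 2"
      by (simp add: power3_eq_cube power2_eq_square mult_ac)
    then have "q * real n \<le> G + K"
      using n(2) by (subst (asm) mult_le_cancel_right_pos) auto
    then show False using n(3) qK(1) by (simp add: divide_less_eq mult.commute)
  qed
qed

section \<open>The codimension sequence of an algebra of cubic growth\<close>

lemma fstar_multilin: "f \<in> multilin A \<Longrightarrow> fstar f \<in> multilin A"
  unfolding multilin_def
proof (induction rule: free.span_induct_alt)
  case (step c x y)
  then obtain w where w: "w \<in> mwords A" "x = monom w" by auto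
  have "fstar x = fscale (word_sign w) (monom (rev w))"
    unfolding w(2)
    by (rule poly_mapping_eqI) (auto simp: lookup_fstar lookup_fscale coeff_monom word_sign_rev)
  moreover have "rev w \<in> mwords A" using w(1) by (simp add: mwords_def rev_map [symmetric])
  ultimately show ?case
    using step(2) by (simp add: fstar_simps free.span_add free.span_scale free.span_base)
qed (simp add: fstar_zero free.span_zero)

lemma sum_choose_cubic:
  assumes "\<And>k. k > 3 \<Longrightarrow> g k = 0"
  shows "(\<Sum>k\<le>n. (n choose k) * g k) =
    g 0 + (n choose 1) * g 1 + (n choose 2) * g 2 + (n choose 3) * g 3"
proof -
  have "(\<Sum>k\<le>n. (n choose k) * g k) = (\<Sum>k\<le>n + 3. (n choose k) * g k)"
    by (rule sum.mono_neutral_left) auto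
  also have "\<dots> = (\<Sum>k\<le>3. (n choose k) * g k)"
    by (rule sum.mono_neutral_right) (use assms in auto)
  finally show ?thesis by (simp add: numeral_3_eq_3 numeral_2_eq_2)
qed

text \<open>
  The largest proper codimension of degree three that is compatible with the proper codimension \<open>p\<close>
  of degree two.
\<close>

definition cubic_bound :: "nat \<Rightarrow> nat"
  where "cubic_bound p = (if p = 5 then 29 else if p = 4 then 15 else if p = 3 then 5
    else if p = 2 then 4 else 1)"

definition cubic_pairs :: "(nat \<times> nat) set"
  where "cubic_pairs = (SIGMA p:{1..5}. {1..cubic_bound p})"

locale cubic_star_algebra = star_algebra A star
  for A :: "('k::field_char_0, 'a) module" and star +
  assumes cubic: "poly_growth (codim A star) 3"
begin

abbreviation I :: "'k fpoly set" where "I \<equiv> Id_star A star"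

lemma codim_eq: "codim A star n = (\<Sum>k\<le>n. (n choose k) * proper_codim I k)"
  unfolding codim_def by (rule closed_ideal.quot_dim_proper_codim [OF closed_ideal_Id_star])

lemma proper_codim_high: "k > 3 \<Longrightarrow> proper_codim I k = 0"
  and proper_codim_3_nonzero: "proper_codim I 3 \<noteq> 0"
  using cubic_growth_coefficients [OF codim_eq cubic] by blast+

lemmas low = closed_ideal.proper_codim_0_1 [OF closed_ideal_Id_star proper_codim_3_nonzero]

lemma codim_cubic:
  "codim A star n = 1 + (n choose 1) + proper_codim I 2 * (n choose 2) + proper_codim I 3 * (n choose 3)"
  unfolding codim_eq using low
  by (subst sum_choose_cubic) (simp_all add: proper_codim_high mult.commute)

lemma codim_seq_eq: "codim_seq A star = binom_seq (proper_codim I 2) (proper_codim I 3)"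
  unfolding codim_seq_def binom_seq_def codim_cubic [abs_def] ..

lemma proper_codim_pair: "(proper_codim I 2, proper_codim I 3) \<in> cubic_pairs"
  using closed_ideal.proper_codim_bounds [OF closed_ideal_Id_star proper_codim_3_nonzero]
    proper_codim_3_nonzero
  by (auto simp: cubic_pairs_def cubic_bound_def)

section \<open>The associated admissible sequence\<close>

lemma proper_dim_zeroD:
  assumes "proper_dim I k = 0"
  shows "proper_multilin {..<k} {..<k} \<inter> I = {0}"
proof (rule sym, rule dim_subspace_eq [where S = "monom ` mwords {..<k}"])
  interpret closed_ideal I by (rule closed_ideal_Id_star)
  show "free.subspace (proper_multilin {..<k} {..<k} \<inter> I)"
    by (intro free.subspace_inter subspace_proper_multilin subspace)
  show "{0} \<subseteq> proper_multilin {..<k} {..<k} \<inter> I"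
    using free.subspace_0 [OF \<open>free.subspace (proper_multilin {..<k} {..<k} \<inter> I)\<close>] by blast
  show "free.dim {0 :: 'k fpoly} = free.dim (proper_multilin {..<k} {..<k} \<inter> I)"
    using assms unfolding proper_dim_def
    by (metis card.empty free.dim_eq_card_independent free.dim_span free.independent_empty free.span_empty)
qed (use proper_multilin_fin [of "{..<k}"] in \<open>auto simp: free.subspace_single_0\<close>)

lemma Gam_1_Id: "Gam (Suc 0) \<inter> I = {0}"
proof -
  have "proper_dim I (Suc 0) = 0"
    using low(2) closed_ideal.proper_dim_le [OF closed_ideal_Id_star, of "Suc 0"]
    by (simp add: proper_codim_def proper_dim_UNIV)
  then have "Gam (Suc 0) \<inter> I \<subseteq> {0}"
    using proper_dim_zeroD Gam_subset_proper_multilin by blast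
  moreover have "0 \<in> Gam (Suc 0) \<inter> I"
    using closed_ideal.zero [OF closed_ideal_Id_star] free.subspace_0 [OF subspace_Gam] by blast
  ultimately show ?thesis by blast
qed

lemma Gam_2_Id: "Gam 2 \<inter> I = {0} \<longleftrightarrow> proper_codim I 2 = 5"
proof
  assume "Gam 2 \<inter> I = {0}"
  then have "proper_dim I 2 = free.dim {0 :: 'k fpoly}"
    by (simp add: proper_dim_def proper_multilin_2)
  also have "\<dots> = 0"
    by (metis card.empty free.dim_eq_card_independent free.dim_span free.independent_empty free.span_empty)
  finally show "proper_codim I 2 = 5" by (simp add: proper_codim_def proper_dim_UNIV)
next
  assume "proper_codim I 2 = 5"
  then have "proper_dim I 2 = 0"
    by (simp add: proper_codim_def proper_dim_UNIV)
  then show "Gam 2 \<inter> I = {0}" using proper_dim_zeroD [of 2] by (simp add: proper_multilin_2)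
qed

lemma Gam_3_Id: "Gam 3 \<inter> I \<noteq> Gam 3"
proof
  assume "Gam 3 \<inter> I = Gam 3"
  then have "proper_dim I 3 = proper_dim (UNIV :: 'k fpoly set) 3"
    by (simp add: proper_dim_def proper_multilin_3)
  then show False using proper_codim_3_nonzero by (simp add: proper_codim_def)
qed

lemma Gam_high_Id:
  assumes "k > 3"
  shows "Gam k \<inter> I = Gam k"
proof -
  interpret closed_ideal I by (rule closed_ideal_Id_star)
  have "proper_dim I k = proper_dim (UNIV :: 'k fpoly set) k"
    using proper_codim_high [OF assms] proper_dim_le [of k] by (simp add: proper_codim_def)
  then have "proper_multilin {..<k} {..<k} \<inter> I = proper_multilin {..<k} {..<k}"
    using proper_multilin_fin [of "{..<k}"]
    by (intro dim_subspace_eq [where S = "monom ` mwords {..<k}"])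
      (auto simp: proper_dim_def intro!: free.subspace_inter subspace_proper_multilin subspace)
  then show ?thesis using Gam_subset_proper_multilin by blast
qed

lemma hyper_submodule_Gam_Id: "hyper_submodule n (Gam n \<inter> I)"
  unfolding hyper_submodule_def
proof (intro conjI allI impI)
  interpret closed_ideal I by (rule closed_ideal_Id_star)
  show "free.subspace (Gam n \<inter> I)" by (intro free.subspace_inter subspace_Gam subspace)
  fix a :: "nat \<Rightarrow> 'k" and \<sigma> :: "nat \<Rightarrow> nat"
  assume "(\<forall>i<n. a i \<in> {1, - 1}) \<and> \<sigma> permutes {..<n}"
  then have "bij_betw \<sigma> {..<n} {..<n}" by (simp add: permutes_imp_bij)
  then show "hyper_act a \<sigma> ` (Gam n \<inter> I) \<subseteq> Gam n \<inter> I"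
    using hyper_act_Gam endo [OF hyper_act_star_endo] by blast
qed simp

lemma fstar_Gam_Id:
  assumes "n = 2 \<or> n = 3"
  shows "fstar ` (Gam n \<inter> I) \<subseteq> Gam n \<inter> I"
proof -
  have "Gam n = (proper_multilin {..<n} {..<n} :: 'k fpoly set)"
    using assms proper_multilin_2 proper_multilin_3 by metis
  moreover have "fstar f \<in> proper_multilin {..<n} {..<n}" if "f \<in> proper_multilin {..<n} {..<n}"
    for f :: "'k fpoly"
    using that by (auto simp: proper_multilin_def fstar_multilin fstar_zero
        star_endo_fstar [OF drop_var_star_endo])
  ultimately show ?thesis using closed_ideal.star [OF closed_ideal_Id_star] by blast
qed

text \<open>
  There are no identities of degree one, since they would imply all those of degree three; so the
  sequence starts in degree two or three, depending on whether identities of degree two exist.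
\<close>

lemma associated_start:
  assumes "admissible 3 M" "associated 3 A star M"
  shows "M = (if Gam 2 \<inter> I = {0} then [Gam 3 \<inter> I] else [Gam 2 \<inter> I, Gam 3 \<inter> I])"
proof -
  have len: "length M = 1 \<or> length M = 2 \<or> length M = 3"
    using assms(1) by (auto simp: admissible_def)
  have start: "start_index 3 M < 3 \<Longrightarrow> entry 3 M (start_index 3 M) \<noteq> {0}"
    using assms(1) by (simp add: admissible_def)
  have before: "\<And>i. 1 \<le> i \<Longrightarrow> i < start_index 3 M \<Longrightarrow> Gam i \<inter> I = {0}"
    and entries: "\<And>i. start_index 3 M \<le> i \<Longrightarrow> i \<le> 3 \<Longrightarrow> Gam i \<inter> I = entry 3 M i"
    using assms(2) unfolding associated_def by blast+
  from len show ?thesis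
  proof (elim disjE)
    assume l: "length M = 1"
    then obtain X where M: "M = [X]" by (auto simp: length_Suc_conv)
    show ?thesis
      using before [of 2] entries [of 3] by (simp add: M start_index_def entry_def)
  next
    assume l: "length M = 2"
    then obtain X Y where M: "M = [X, Y]" by (auto simp: length_Suc_conv numeral_2_eq_2)
    show ?thesis
      using start entries [of 2] entries [of 3] by (auto simp: M start_index_def entry_def)
  next
    assume l: "length M = 3"
    then show ?thesis
      using start entries [of 1] Gam_1_Id by (simp add: start_index_def)
  qed
qed

lemma admissible_associated:
  fixes M
  defines "M \<equiv> (if Gam 2 \<inter> I = {0} then [Gam 3 \<inter> I] else [Gam 2 \<inter> I, Gam 3 \<inter> I])"
  shows "admissible 3 M" "associated 3 A star M"
proof -
  have entries: "i = 3 \<or> i = 2 \<and> Gam 2 \<inter> I \<noteq> {0}" "entry 3 M i = Gam i \<inter> I"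
    if "start_index 3 M \<le> i" "i \<le> 3" for i
    using that
    by (auto simp: M_def start_index_def entry_def le_Suc_eq numeral_3_eq_3 numeral_2_eq_2
        split: if_splits)
  have start: "start_index 3 M = (if Gam 2 \<inter> I = {0} then 3 else 2)"
    by (simp add: M_def start_index_def)
  show "associated 3 A star M"
    unfolding associated_def
  proof (intro conjI allI impI)
    fix i assume "1 \<le> i \<and> i < start_index 3 M"
    then have "i = 1 \<or> i = 2 \<and> Gam 2 \<inter> I = {0}" by (auto simp: start split: if_splits)
    then show "Gam i \<inter> I = {0}" using Gam_1_Id by auto
  qed (use entries(2) Gam_high_Id in auto)
  show "admissible 3 M"
    unfolding admissible_def
  proof (intro conjI ballI impI)
    show "1 \<le> length M" "length M \<le> 3" by (simp_all add: M_def)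
    show "entry 3 M (start_index 3 M) \<noteq> {0}" if "start_index 3 M < 3"
      using that entries(2) [of 2] by (auto simp: start split: if_splits)
    show "entry 3 M 3 \<noteq> Gam 3"
      using entries(2) [of 3] Gam_3_Id by (simp add: start)
    fix i assume "i \<in> {start_index 3 M..3}"
    then have i: "i = 2 \<or> i = 3" "entry 3 M i = Gam i \<inter> I" using entries by auto
    then show "hyper_submodule i (entry 3 M i)" "fstar ` entry 3 M i \<subseteq> entry 3 M i"
      using hyper_submodule_Gam_Id fstar_Gam_Id by metis+
  next
    fix j assume j: "j \<in> {start_index 3 M + 1..3}"
    then have j3: "j = 3" "start_index 3 M = 2" by (auto simp: start split: if_splits)
    have "{2..<3} = {2 :: nat}" by auto
    then have "(\<Sum>i\<in>{start_index 3 M..<j}. Tstar_gen (entry 3 M i)) = Tstar_gen (Gam 2 \<inter> I)"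
      using entries(2) [of 2] by (simp add: j3)
    also have "\<dots> \<subseteq> I"
      using closed_ideal.Tstar [OF closed_ideal_Id_star] unfolding Tstar_gen_def by blast
    finally show "(\<Sum>i\<in>{start_index 3 M..<j}. Tstar_gen (entry 3 M i)) \<inter> Gam j \<subseteq> entry 3 M j"
      using entries(2) [of 3] by (auto simp: j3)
  qed
qed

end

section \<open>Realising all pairs of proper codimensions\<close>

definition all_sums :: "'b set \<Rightarrow> ('b \<Rightarrow> nat) \<Rightarrow> bool"
  where "all_sums S f \<longleftrightarrow> finite S \<and> (\<forall>u\<le>sum f S. \<exists>B\<subseteq>S. sum f B = u)"

lemma all_sums_empty: "all_sums {} f"
  by (simp add: all_sums_def)

text \<open>
  Sums up to \<^term>\<open>sum f S\<close> are reached without \<open>x\<close>, and the larger ones with \<open>x\<close>.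
\<close>

lemma all_sums_insert:
  assumes "all_sums S f" "x \<notin> S" "f x \<le> Suc (sum f S)"
  shows "all_sums (insert x S) f"
  unfolding all_sums_def
proof (intro conjI allI impI)
  show "finite (insert x S)" using assms(1) by (simp add: all_sums_def)
  fix u assume u: "u \<le> sum f (insert x S)"
  show "\<exists>B\<subseteq>insert x S. sum f B = u"
  proof (cases "u \<le> sum f S")
    case True
    then show ?thesis using assms(1) unfolding all_sums_def by blast
  next
    case False
    have "u - f x \<le> sum f S" using u assms by (simp add: all_sums_def)
    then obtain B where B: "B \<subseteq> S" "sum f B = u - f x"
      using assms(1) unfolding all_sums_def by blast
    have "finite B" "x \<notin> B" using B assms finite_subset by (auto simp: all_sums_def)
    then have "sum f (insert x B) = u" using B False assms(3) by simp
    then show ?thesis using B(1) by blast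
  qed
qed

lemma all_sumsD: "all_sums S f \<Longrightarrow> u \<le> sum f S \<Longrightarrow> \<exists>B\<subseteq>S. sum f B = u"
  by (simp add: all_sums_def)

text \<open>
  In each case the components in \<open>D\<close> and a set \<open>S\<close> of components of degree three are chosen such
  that the members of \<open>S\<close> are untouched by the identities outside \<open>D\<close>. Subsets \<open>B\<close> of \<open>S\<close> then give
  all codimensions up to the total dimension of \<open>S\<close>. For \<open>p = 3\<close> one choice of \<open>D\<close> does not suffice:
  if symmetric and skew elements commute, at most four dimensions survive, and the fifth value comes
  from the vanishing of all products of two skew elements.
\<close>

lemma component_ideal_exists:
  assumes "(p, u) \<in> cubic_pairs"
  shows "\<exists>D B. proper_codim (component_ideal D B :: 'k::field_char_0 fpoly set) 2 = p \<and>
    proper_codim (component_ideal D B :: 'k fpoly set) 3 = u"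
proof -
  have *: ?thesis
    if DS: "sum deg2 D = p" "all_sums S deg3" "u \<le> sum deg3 S"
      "\<And>m b. m \<notin> D \<Longrightarrow> b \<in> S \<Longrightarrow> untouched b m TYPE('k)" for D S
  proof -
    obtain B where B: "B \<subseteq> S" "sum deg3 B = u" using all_sumsD [OF DS(2,3)] by blast
    have "proper_codim (component_ideal D B :: 'k fpoly set) 2 = p"
      unfolding DS(1) [symmetric] using B(1) DS(4) by (intro proper_codim_2_component_ideal) blast
    then show ?thesis using B(2) proper_codim_component_ideal(1) by metis
  qed
  have "p \<in> {1..5}" "u \<le> cubic_bound p" using assms by (auto simp: cubic_pairs_def)
  then consider "p = 5" "u \<le> 29" | "p = 4" "u \<le> 15" | "p = 3" "u \<le> 4" | "p = 3" "u = 5"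
    | "p = 2" "u \<le> 4" | "p = 1" "u \<le> 1"
    by (fastforce simp: cubic_bound_def split: if_splits)
  then show ?thesis
  proof cases
    case 1
    show ?thesis
    proof (rule *)
      show "all_sums {YYZ1, YYZ2, YYZ3, YZZ1, YZZ2, YZZ3, YZZ4, YYY, ZZZ_plus, ZZZ_minus, ZZZ_sym, ZZZ_alt} deg3"
        by (intro all_sums_insert all_sums_empty) simp_all
      show "sum deg2 UNIV = p" using 1 by (simp add: UNIV_irr2)
    qed (use 1 in simp_all)
  next
    case 2
    show ?thesis
    proof (rule *)
      show "all_sums {YZZ2, YZZ3, YZZ4, ZZZ_plus, ZZZ_minus, ZZZ_sym, ZZZ_alt} deg3"
        by (intro all_sums_insert all_sums_empty) simp_all
      show "untouched b m TYPE('k)" if "m \<notin> {YZ, ZZ_plus, ZZ_minus}"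
        "b \<in> {YZZ2, YZZ3, YZZ4, ZZZ_plus, ZZZ_minus, ZZZ_sym, ZZZ_alt}" for m b
        using that by (cases m) (auto intro!: untouched)
    qed (use 2 in simp_all)
  next
    case 3
    show ?thesis
    proof (rule *)
      show "all_sums {ZZZ_minus, ZZZ_sym, ZZZ_alt} deg3"
        by (intro all_sums_insert all_sums_empty) simp_all
      show "untouched b m TYPE('k)" if "m \<notin> {YY, ZZ_plus, ZZ_minus}"
        "b \<in> {ZZZ_minus, ZZZ_sym, ZZZ_alt}" for m b
        using that by (cases m) (auto intro!: untouched)
    qed (use 3 in simp_all)
  next
    case 4
    have "untouched b m TYPE('k)" if "m \<notin> {YY, YZ}" "b \<in> {YYY, YYZ3}" for m b
      using that by (cases m) (auto intro!: untouched)
    then have "proper_codim (component_ideal {YY, YZ} {YYY, YYZ3} :: 'k fpoly set) 2 = p"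
      using 4 by (subst proper_codim_2_component_ideal) simp_all
    moreover have "proper_codim (component_ideal {YY, YZ} {YYY, YYZ3} :: 'k fpoly set) 3 = u"
      using 4 by (simp add: proper_codim_component_ideal)
    ultimately show ?thesis by blast
  next
    case 5
    show ?thesis
    proof (rule *)
      show "all_sums {ZZZ_minus, ZZZ_sym, ZZZ_alt} deg3"
        by (intro all_sums_insert all_sums_empty) simp_all
      show "untouched b m TYPE('k)" if "m \<notin> {ZZ_plus, ZZ_minus}"
        "b \<in> {ZZZ_minus, ZZZ_sym, ZZZ_alt}" for m b
        using that by (cases m) (auto intro!: untouched)
    qed (use 5 in simp_all)
  next
    case 6
    show ?thesis
    proof (rule *)
      show "all_sums {ZZZ_sym} deg3"
        by (intro all_sums_insert all_sums_empty) simp_all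
      show "untouched b m TYPE('k)" if "m \<notin> {ZZ_plus}" "b \<in> {ZZZ_sym}" for m b
        using that by (cases m) (auto intro!: untouched)
    qed (use 6 in simp_all)
  qed
qed

lemma rel_free_cubic:
  assumes I: "closed_ideal (I :: 'k::field_char_0 fpoly set)"
    and 3: "proper_codim I 3 \<noteq> 0" and high: "\<And>k. k > 3 \<Longrightarrow> proper_codim I k = 0"
  obtains U st where "star_algebra (U :: ('k, 'k fpoly set) module) st" "poly_growth (codim U st) 3"
    "codim_seq U st = binom_seq (proper_codim I 2) (proper_codim I 3)"
proof -
  interpret closed_ideal I by fact
  have codim: "codim rel_free rel_free_star n =
      1 + (n choose 1) + proper_codim I 2 * (n choose 2) + proper_codim I 3 * (n choose 3)" for n
    unfolding codim_def Id_star_rel_free quot_dim_proper_codim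
    using proper_codim_0_1 [OF 3]
    by (subst sum_choose_cubic) (simp_all add: high mult.commute)
  show ?thesis
  proof (rule that [OF star_algebra_rel_free])
    show "poly_growth (codim rel_free rel_free_star) 3"
      by (rule poly_growth_cubic [OF 3 codim])
    show "codim_seq rel_free rel_free_star = binom_seq (proper_codim I 2) (proper_codim I 3)"
      unfolding codim_seq_def binom_seq_def codim [abs_def] ..
  qed
qed

lemma binom_seq_inject: "binom_seq p q = binom_seq p' q' \<longleftrightarrow> p = p' \<and> q = q'"
proof
  assume eq: "binom_seq p q = binom_seq p' q'"
  have "binom_seq p q 2 = binom_seq p' q' 2" "binom_seq p q 3 = binom_seq p' q' 3"
    by (simp_all only: eq)
  then show "p = p' \<and> q = q'" by (simp add: binom_seq_def numeral_3_eq_3 numeral_2_eq_2)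
qed simp

lemma cubic_pairs_eq: "cubic_pairs =
    Pair 5 ` {1..29} \<union> Pair 4 ` {1..15} \<union> Pair 3 ` {1..5} \<union> Pair 2 ` {1..4} \<union> {(1, 1)}"
proof -
  have "{1..5} = {5, 4, 3, 2, 1 :: nat}" by auto
  moreover have "Sigma (insert a S) F = Pair a ` F a \<union> Sigma S F" for a :: nat and S and F :: "nat \<Rightarrow> nat set"
    by auto
  ultimately show ?thesis by (simp add: cubic_pairs_def cubic_bound_def Un_assoc)
qed

lemma card_cubic_pairs: "card cubic_pairs = 54"
proof -
  have "{1..5} = {1, 2, 3, 4, 5 :: nat}" by auto
  then show ?thesis by (simp add: cubic_pairs_def cubic_bound_def)
qed

definition arising_seqs :: "'k::field_char_0 itself \<Rightarrow> (nat \<Rightarrow> nat) set"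
  where "arising_seqs _ = {codim_seq U st | (U :: ('k, 'k fpoly set) module) st.
    star_algebra U st \<and> poly_growth (codim U st) 3}"

lemma arising_seqs_eq:
  "arising_seqs TYPE('k::field_char_0) = case_prod binom_seq ` cubic_pairs"
proof (intro equalityI subsetI)
  fix c assume "c \<in> arising_seqs TYPE('k)"
  then obtain U :: "('k, 'k fpoly set) module" and st where
    U: "c = codim_seq U st" "star_algebra U st" "poly_growth (codim U st) 3"
    unfolding arising_seqs_def by blast
  then interpret cubic_star_algebra U st
    by (simp add: cubic_star_algebra_def cubic_star_algebra_axioms_def)
  show "c \<in> case_prod binom_seq ` cubic_pairs"
    using proper_codim_pair codim_seq_eq U(1) by force
next
  fix c assume "c \<in> case_prod binom_seq ` cubic_pairs"
  then obtain p u where c: "c = binom_seq p u" and pu: "(p, u) \<in> cubic_pairs" by auto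
  obtain D B where DB: "proper_codim (component_ideal D B :: 'k fpoly set) 2 = p"
    "proper_codim (component_ideal D B :: 'k fpoly set) 3 = u"
    using component_ideal_exists [OF pu] by blast
  moreover have "u \<noteq> 0" using pu by (auto simp: cubic_pairs_def)
  ultimately have "proper_codim (component_ideal D B :: 'k fpoly set) 3 \<noteq> 0" by simp
  then obtain U :: "('k, 'k fpoly set) module" and st where "star_algebra U st"
    "poly_growth (codim U st) 3" "codim_seq U st = c"
    by (rule rel_free_cubic [OF closed_ideal_component_ideal])
      (simp_all add: proper_codim_component_ideal(2) DB c)
  then show "c \<in> arising_seqs TYPE('k)" unfolding arising_seqs_def by blast
qed

theorem theorem2p13:
  "let arising = {codim_seq U st | (U :: ('k::field_char_0, 'k fpoly set) module) st.
                    star_algebra U st \<and> poly_growth (codim U st) 3}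
   in (\<forall>(A :: ('k, 'a) module) star. star_algebra A star \<and> poly_growth (codim A star) 3 \<longrightarrow>
         codim_seq A star \<in> arising \<and>
         (\<exists>!M. admissible 3 M \<and> associated 3 A star M) \<and>
         (\<forall>M. admissible 3 M \<and> associated 3 A star M \<longrightarrow>
           ((\<exists>M3. M = [M3]) \<longrightarrow> (\<exists>u\<in>{1..29}. codim_seq A star = binom_seq 5 u)) \<and>
           ((\<exists>M2 M3. M = [M2, M3]) \<longrightarrow>
              (\<exists>a\<in>{1..15}. codim_seq A star = binom_seq 4 a) \<or>
              (\<exists>b\<in>{1..5}. codim_seq A star = binom_seq 3 b) \<or>
              (\<exists>c\<in>{1..4}. codim_seq A star = binom_seq 2 c) \<or>
              codim_seq A star = binom_seq 1 1))) \<and>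
      arising = binom_seq 5 ` {1..29} \<union> binom_seq 4 ` {1..15} \<union> binom_seq 3 ` {1..5} \<union>
                binom_seq 2 ` {1..4} \<union> {binom_seq 1 1} \<and>
      card arising = 54"
proof -
  let ?arising = "arising_seqs TYPE('k)"
  have all: "codim_seq A star \<in> ?arising \<and> (\<exists>!M. admissible 3 M \<and> associated 3 A star M) \<and>
      (\<forall>M. admissible 3 M \<and> associated 3 A star M \<longrightarrow>
        ((\<exists>M3. M = [M3]) \<longrightarrow> (\<exists>u\<in>{1..29}. codim_seq A star = binom_seq 5 u)) \<and>
        ((\<exists>M2 M3. M = [M2, M3]) \<longrightarrow>
          (\<exists>a\<in>{1..15}. codim_seq A star = binom_seq 4 a) \<or>
          (\<exists>b\<in>{1..5}. codim_seq A star = binom_seq 3 b) \<or>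
          (\<exists>c\<in>{1..4}. codim_seq A star = binom_seq 2 c) \<or>
          codim_seq A star = binom_seq 1 1))"
    if "star_algebra A star" "poly_growth (codim A star) 3" for A :: "('k, 'a) module" and star
  proof -
    interpret cubic_star_algebra A star
      using that by (simp add: cubic_star_algebra_def cubic_star_algebra_axioms_def)
    define M0 where "M0 = (if Gam 2 \<inter> I = {0} then [Gam 3 \<inter> I] else [Gam 2 \<inter> I, Gam 3 \<inter> I])"
    have "codim_seq A star \<in> ?arising"
      using proper_codim_pair unfolding arising_seqs_eq codim_seq_eq by force
    moreover have "\<exists>!M. admissible 3 M \<and> associated 3 A star M"
    proof (rule ex1I [of _ M0])
      show "admissible 3 M0 \<and> associated 3 A star M0"
        unfolding M0_def using admissible_associated by simp
      show "M = M0" if "admissible 3 M \<and> associated 3 A star M" for M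
        unfolding M0_def using that associated_start by blast
    qed
    moreover have "(\<exists>u\<in>{1..29}. codim_seq A star = binom_seq 5 u)"
      if "admissible 3 M" "associated 3 A star M" "M = [M3]" for M M3
    proof -
      have "proper_codim I 2 = 5"
        using associated_start [OF that(1,2)] that(3) Gam_2_Id by (simp split: if_splits)
      then show ?thesis
        using proper_codim_pair by (auto simp: codim_seq_eq cubic_pairs_def cubic_bound_def)
    qed
    moreover have "(\<exists>a\<in>{1..15}. codim_seq A star = binom_seq 4 a) \<or>
        (\<exists>b\<in>{1..5}. codim_seq A star = binom_seq 3 b) \<or>
        (\<exists>c\<in>{1..4}. codim_seq A star = binom_seq 2 c) \<or> codim_seq A star = binom_seq 1 1"
      if "admissible 3 M" "associated 3 A star M" "M = [M2, M3]" for M M2 M3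
    proof -
      have "proper_codim I 2 \<noteq> 5"
        using associated_start [OF that(1,2)] that(3) Gam_2_Id by (simp split: if_splits)
      then show ?thesis
        using proper_codim_pair unfolding codim_seq_eq cubic_pairs_eq by auto
    qed
    ultimately show ?thesis by (intro conjI allI impI) (elim conjE exE, assumption | simp)+
  qed
  have eq: "?arising = binom_seq 5 ` {1..29} \<union> binom_seq 4 ` {1..15} \<union> binom_seq 3 ` {1..5} \<union>
      binom_seq 2 ` {1..4} \<union> {binom_seq 1 1}"
    unfolding arising_seqs_eq cubic_pairs_eq by (simp add: image_Un image_image)
  have card: "card ?arising = 54"
  proof -
    have "inj_on (case_prod binom_seq) cubic_pairs"
      by (auto simp: inj_on_def binom_seq_inject)
    then show ?thesis unfolding arising_seqs_eq by (simp add: card_image card_cubic_pairs)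
  qed
  show ?thesis
    unfolding Let_def arising_seqs_def [of "TYPE('k)", symmetric]
    by (rule conjI [OF _ conjI [OF eq card]]) (intro allI impI, elim conjE, rule all)
qed

end
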